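(* For every centrally symmetric convex body $K \subset \mathbb{R}^n_q$, $$c_{\rm HZ}(K \times K^{\circ}) = 4,$$ where $c_{\rm HZ}$ denotes the Hofer--Zehnder capacity of convex bodies in $\mathbb{R}^{2n}=\mathbb{R}^n_q\times\mathbb{R}^n_p$.
   Context: $\mathbb{R}^{2n} = \mathbb{R}^n_q \times \mathbb{R}^n_p$ carries the standard symplectic form $\omega_{\rm st} = \sum_i dq_i \wedge dp_i$. A convex body is a compact convex set with non-empty interior; it is centrally symmetric if it equals its reflection in the origin. For a centrally symmetric convex body $K\subset\mathbb{R}^n_q$, the polar body is $K^\circ = \{p\in\mathbb{R}^n_p : \langle p,q\rangle \le 1 \text{ for every } q\in K\}$, where $\mathbb{R}^n_p$ is identified with the dual space of $\mathbb{R}^n_q$. Hofer--Zehnder capacity on convex bodies. For a convex body $\Sigma\subset\mathbb{R}^{2n}$ with smooth boundary, a closed characteristic on $\partial\Sigma$ is an embedded circle $\gamma\subset\partial\Sigma$ tangent to the line bundle $\{(x,\xi)\in T\partial\Sigma : \omega_{\rm st}(\xi,\eta)=0 \text{ for all } \eta\in T_x\partial\Sigma\}$. The action of a closed curve $\gamma$ is $A(\gamma)=\int_\gamma \lambda$ with $\lambda = p\,dq$, and $\mathcal{L}(\Sigma)=\{|A(\gamma)| : \gamma \text{ a closed characteristic on } \partial\Sigma\}$. The Hofer--Zehnder capacity of such a $\Sigma$ is $c_{\rm HZ}(\Sigma)=\min\mathcal{L}(\Sigma)$ (it is known that the minimum exists). It is known that $c_{\rm HZ}$ is continuous with respect to the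 Hausdorff metric on convex bodies; for a convex body $\Sigma$ with non-smooth boundary, $c_{\rm HZ}(\Sigma)$ is the limit of $c_{\rm HZ}(\Sigma_k)$ for any sequence of convex bodies $\Sigma_k$ with smooth boundary converging to $\Sigma$ in the Hausdorff metric. *)

theory Defs
  imports "HOL-Analysis.Analysis"
begin

definition convex_body :: "'a::euclidean_space set \<Rightarrow> bool" where
  "convex_body K \<longleftrightarrow> compact K \<and> convex K \<and> interior K \<noteq> {}"

definition centrally_symmetric :: "'a::euclidean_space set \<Rightarrow> bool" where
  "centrally_symmetric K \<longleftrightarrow> uminus ` K = K"

definition polar_body :: "'a::euclidean_space set \<Rightarrow> 'a set" where
  "polar_body K = {p. \<forall>q\<in>K. p \<bullet> q \<le> 1}"

text \<open>The suprema are those of bounded nonempty sets whenever both arguments are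
  bounded and nonempty, in particular for convex bodies.\<close>

definition hausdorff_dist :: "'a::metric_space set \<Rightarrow> 'a set \<Rightarrow> real" where
  "hausdorff_dist A B = max (SUP x\<in>A. infdist x B) (SUP y\<in>B. infdist y A)"

text \<open>To be used on open sets \<^term>\<open>U\<close> only: there the conditions say that all partial
  derivatives of order at most \<^term>\<open>k\<close> exist and are continuous.\<close>

primrec Ck_on :: "nat \<Rightarrow> ('a::euclidean_space \<Rightarrow> 'b::real_normed_vector) \<Rightarrow> 'a set \<Rightarrow> bool" where
  "Ck_on 0 f U \<longleftrightarrow> continuous_on U f"
| "Ck_on (Suc k) f U \<longleftrightarrow>
     f differentiable_on U \<and> (\<forall>i\<in>Basis. Ck_on k (\<lambda>x. frechet_derivative f (at x) i) U)"

definition smooth_on :: "('a::euclidean_space \<Rightarrow> 'b::real_normed_vector) \<Rightarrow> 'a set \<Rightarrow> bool" where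
  "smooth_on f U \<longleftrightarrow> (\<forall>k. Ck_on k f U)"

definition smooth_hypersurface :: "'a::euclidean_space set \<Rightarrow> bool" where
  "smooth_hypersurface S \<longleftrightarrow>
     (\<forall>x\<in>S. \<exists>U (h :: 'a \<Rightarrow> real).
        open U \<and> x \<in> U \<and> smooth_on h U \<and>
        (\<forall>y\<in>U. frechet_derivative h (at y) \<noteq> (\<lambda>_. 0)) \<and>
        S \<inter> U = {y \<in> U. h y = 0})"

definition tangent_space :: "'a::euclidean_space set \<Rightarrow> 'a \<Rightarrow> 'a set" where
  "tangent_space S x =
     {v. \<exists>e>0. \<exists>c :: real \<Rightarrow> 'a.
           smooth_on c {-e<..<e} \<and> c ` {-e<..<e} \<subseteq> S \<and> c 0 = x \<and>
           (c has_vector_derivative v) (at 0)}"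

definition smooth_convex_body :: "'a::euclidean_space set \<Rightarrow> bool" where
  "smooth_convex_body \<Sigma> \<longleftrightarrow> convex_body \<Sigma> \<and> smooth_hypersurface (frontier \<Sigma>)"

text \<open>A point of the phase space is a pair \<^term>\<open>(q, p)\<close>.\<close>

type_synonym 'n phase_space = "(real ^ 'n) \<times> (real ^ 'n)"

definition omega_st :: "'n::finite phase_space \<Rightarrow> 'n phase_space \<Rightarrow> real" where
  "omega_st \<xi> \<eta> = (\<Sum>i\<in>UNIV. fst \<xi> $ i * snd \<eta> $ i - fst \<eta> $ i * snd \<xi> $ i)"

definition characteristic_line ::
    "'n::finite phase_space set \<Rightarrow> 'n phase_space \<Rightarrow> 'n phase_space set" where
  "characteristic_line \<Sigma> x =
     {\<xi> \<in> tangent_space (frontier \<Sigma>) x. \<forall>\<eta>\<in>tangent_space (frontier \<Sigma>) x. omega_st \<xi> \<eta> = 0}"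

text \<open>An embedded circle is represented by a parametrization, that is, by a smooth 1-periodic
  immersion of the real line that is injective on a period. Parametrizations of the same circle
  have the same action up to sign.\<close>

definition closed_characteristic ::
    "'n::finite phase_space set \<Rightarrow> (real \<Rightarrow> 'n phase_space) \<Rightarrow> bool" where
  "closed_characteristic \<Sigma> \<gamma> \<longleftrightarrow>
     smooth_on \<gamma> UNIV \<and>
     (\<forall>t. \<gamma> (t + 1) = \<gamma> t) \<and>
     inj_on \<gamma> {0..<1} \<and>
     (\<forall>t. vector_derivative \<gamma> (at t) \<noteq> 0) \<and>
     range \<gamma> \<subseteq> frontier \<Sigma> \<and>
     (\<forall>t. vector_derivative \<gamma> (at t) \<in> characteristic_line \<Sigma> (\<gamma> t))"

definition action :: "(real \<Rightarrow> 'n::finite phase_space) \<Rightarrow> real" where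
  "action \<gamma> = integral {0..1} (\<lambda>t. snd (\<gamma> t) \<bullet> fst (vector_derivative \<gamma> (at t)))"

definition action_spectrum :: "'n::finite phase_space set \<Rightarrow> real set" where
  "action_spectrum \<Sigma> = {\<bar>action \<gamma>\<bar> |\<gamma>. closed_characteristic \<Sigma> \<gamma>}"

definition smooth_hz_capacity :: "'n::finite phase_space set \<Rightarrow> real" where
  "smooth_hz_capacity \<Sigma> = (LEAST a. a \<in> action_spectrum \<Sigma>)"

definition hz_capacity :: "'n::finite phase_space set \<Rightarrow> real" where
  "hz_capacity \<Sigma> =
     (if smooth_convex_body \<Sigma> then smooth_hz_capacity \<Sigma>
      else THE c. \<forall>S :: nat \<Rightarrow> 'n phase_space set.
             (\<forall>k. smooth_convex_body (S k)) \<longrightarrow>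
             (\<lambda>k. hausdorff_dist (S k) \<Sigma>) \<longlonglongrightarrow> 0 \<longrightarrow>
             (\<lambda>k. smooth_hz_capacity (S k)) \<longlonglongrightarrow> c)"

end

theory Submission
  imports Defs "HOL-Complex_Analysis.Great_Picard"
begin

text \<open>The capacity of a convex body \<open>S\<close> with the origin in its interior is computed from an
  isoperimetric problem, a form of Clarke's dual action principle. Let
  \<open>C = {u. \<forall>x\<in>S. \<omega>(x, u) \<le> 1}\<close> be the polar of \<open>S\<close> with respect to the symplectic form \<open>\<omega>\<close>.
  If the boundary of \<open>S\<close> is smooth, then at each boundary point \<open>x\<close> exactly one \<open>u \<in> C\<close> satisfies
  \<open>\<omega>(x, u) = 1\<close>, and this \<open>u = U x\<close> spans the characteristic line. A closed characteristic can
  therefore be reparametrised to satisfy \<open>\<gamma>' = T U(\<gamma>)\<close> on the unit interval; its action is \<open>T / 2\<close> up to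
  sign, and \<open>w = \<gamma> / T\<close> is a closed loop with velocities in \<open>C\<close> and with
  \<open>\<integral> \<omega>(w, w') = 1 / T\<close>. So the smallest action is \<open>1 / (2 \<rho>)\<close>, where \<open>\<rho>\<close> is the maximum of
  \<open>\<integral> \<omega>(w, w')\<close>, twice the enclosed symplectic area, over all closed loops on the unit interval
  with velocities in \<open>C\<close>, provided that this maximum is attained by a loop that solves the
  characteristic equation.

  The maximiser is found by finite-dimensional means. Among closed polygons with \<open>N\<close> edges, each a
  vector of the compact set \<open>C\<close> divided by \<open>N\<close>, one has largest area (\<open>ex_max_area\<close>). A separation
  argument yields a Lagrange multiplier for the closing condition, and after translating by it each
  edge maximises \<open>\<omega>(x, \<cdot>)\<close> over \<open>C\<close>, where \<open>x\<close> is the midpoint of this edge (\<open>extremal_polygon\<close>).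
  As \<open>N\<close> grows, the theorem of Arzela and Ascoli gives a limit loop \<open>Z\<close> with \<open>Z' = U(Z)\<close>; the gauge of
  \<open>S\<close> is constant along \<open>Z\<close>, and the constant is \<open>\<rho>\<close> (\<open>extremal_limit\<close>). Inscribing polygons shows
  that no loop exceeds \<open>\<rho>\<close> (\<open>loop_le_limit\<close>). This has two consequences. Every closed
  characteristic has action at least \<open>1 / (2 \<rho>)\<close>. And \<open>Z\<close> is injective on a period, because a
  proper closed subarc, rescaled to unit time, would have larger area. The smoothness of
  \<open>Z\<close> follows from the differential equation, since \<open>U\<close> is locally the restriction of a smooth map.

  For the product of \<open>K\<close> with its polar the velocities \<open>(a, b)\<close> in \<open>C\<close> are those with
  \<open>\<parallel>a\<parallel> + \<parallel>b\<parallel> \<le> 1\<close>, for the norm with unit ball \<open>K\<close> and its dual norm. A closed curve of length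
  \<open>L\<close> stays within distance \<open>L / 4\<close> of some point, so the integral \<open>\<integral> p dq\<close> over a loop whose two
  components have lengths \<open>A\<close> and \<open>B\<close> is at most \<open>A B / 4\<close>, which is at most \<open>1 / 16\<close> when
  \<open>A + B \<le> 1\<close> (\<open>area_form_isoperimetric\<close>). The rectangle with sides along \<open>q \<in> K\<close> and
  \<open>p\<close> in the polar, where \<open>p \<bullet> q = 1\<close>, gives equality. Hence \<open>\<rho> = 1 / 8\<close> and the capacity
  is \<open>4\<close>. The estimates scale: if a smooth body lies between the dilates of the product by \<open>a\<close> and by
  \<open>b\<close>, then its capacity lies between \<open>4 a\<^sup>2\<close> and \<open>4 b\<^sup>2\<close> (\<open>capacity_between_products\<close>). Smooth bodies
  that converge to the product in the Hausdorff metric lie between dilates whose factors tend to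
  one, so their capacities tend to \<open>4\<close>; and such smooth bodies exist (\<open>smooth_approximation\<close>), so
  the limit that defines the capacity of the product is determined.\<close>

section \<open>The symplectic form and polarity\<close>

lemma omega_st_inner: "omega_st x y = fst x \<bullet> snd y - fst y \<bullet> snd x"
  by (simp add: omega_st_def inner_vec_def sum_subtractf)

text \<open>The complex structure compatible with \<open>omega_st\<close>: it converts between \<open>omega_st\<close> and the inner
  product.\<close>

definition symp_rot :: "'n::finite phase_space \<Rightarrow> 'n phase_space" where
  "symp_rot x = (- snd x, fst x)"

lemma omega_symp_rot: "omega_st x (symp_rot y) = x \<bullet> y"
  by (simp add: omega_st_inner symp_rot_def inner_prod_def inner_commute)

lemma omega_st_eq_inner: "omega_st x y = symp_rot x \<bullet> y"
  by (simp add: omega_st_inner symp_rot_def inner_prod_def inner_commute)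

lemma norm_symp_rot: "norm (symp_rot x) = norm x"
  by (simp add: symp_rot_def norm_prod_def)

lemma linear_symp_rot: "bounded_linear symp_rot"
  unfolding symp_rot_def 
  by (intro bounded_linear_Pair bounded_linear_minus bounded_linear_fst bounded_linear_snd)

lemma abs_omega_le: "\<bar>omega_st x y\<bar> \<le> norm x * norm y"
  unfolding omega_st_eq_inner
  by (metis Cauchy_Schwarz_ineq2 norm_symp_rot)

interpretation omega: bounded_bilinear omega_st
proof
  show "\<exists>K. \<forall>a b. norm (omega_st a b) \<le> norm a * norm b * K"
    by (rule exI[of _ 1]) (simp add: abs_omega_le)
qed (simp_all add: omega_st_inner algebra_simps)

lemma omega_antisym: "omega_st x y = - omega_st y x"
  by (simp add: omega_st_inner inner_commute)

lemma omega_self [simp]: "omega_st x x = 0"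
  by (simp add: omega_st_inner inner_commute)

lemma omega_nondegenerate:
  assumes "\<And>x. omega_st x u = omega_st x v" shows "u = v"
proof -
  have "omega_st x (u - v) = 0" for x by (simp add: omega.diff_right assms)
  from this[of "- symp_rot (u - v)"] have "(u - v) \<bullet> (u - v) = 0"
    by (simp add: omega_st_eq_inner symp_rot_def inner_prod_def algebra_simps)
  then show ?thesis by simp
qed

text \<open>The usual polar body rotated by the complex structure. In this form velocities of characteristics
  are elements of the polar itself.\<close>

definition omega_polar :: "'n::finite phase_space set \<Rightarrow> 'n phase_space set" where
  "omega_polar S = {u. \<forall>x\<in>S. omega_st x u \<le> 1}"

text \<open>By the bipolar theorem this support function of the polar is the Minkowski gauge of \<open>S\<close>.\<close>

definition omega_gauge :: "'n::finite phase_space set \<Rightarrow> 'n phase_space \<Rightarrow> real" where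
  "omega_gauge S x = (SUP u\<in>omega_polar S. omega_st x u)"

locale origin_body =
  fixes S :: "'n::finite phase_space set"
  assumes compact_S: "compact S" and convex_S: "convex S" and zero_int: "0 \<in> interior S"
begin

abbreviation C where "C \<equiv> omega_polar S"
abbreviation g where "g \<equiv> omega_gauge S"

lemma C_le: "x \<in> S \<Longrightarrow> u \<in> C \<Longrightarrow> omega_st x u \<le> 1"
  by (simp add: omega_polar_def)

lemma zero_C: "0 \<in> C"
  by (simp add: omega_polar_def omega.zero_right)

lemma convex_C: "convex C"
proof -
  have "C = (\<Inter>x\<in>S. {u. symp_rot x \<bullet> u \<le> 1})"
    by (auto simp: omega_polar_def omega_st_eq_inner)
  show ?thesis unfolding \<open>C = _\<close> by (intro convex_INT convex_halfspace_le)
qed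

lemma closed_C: "closed C"
proof -
  have "C = (\<Inter>x\<in>S. {u. symp_rot x \<bullet> u \<le> 1})"
    by (auto simp: omega_polar_def omega_st_eq_inner)
  show ?thesis unfolding \<open>C = _\<close> by (intro closed_INT ballI closed_halfspace_le)
qed

text \<open>A ball of radius \<open>r\<close> inside \<open>S\<close> contains a multiple of the rotated vector \<open>u\<close>, on which
  \<open>u\<close> takes the value \<open>r\<close> times its norm.\<close>

lemma bounded_C: "bounded C"
proof -
  obtain r where r: "r > 0" "cball 0 r \<subseteq> S"
    using zero_int by (auto simp: mem_interior_cball)
  have "norm u \<le> 1 / r" if u: "u \<in> C" for u
  proof (cases "u = 0")
    case False
    define x where "x = (r / norm u) *\<^sub>R symp_rot (- u)"
    have "norm x = r" using False r by (simp add: x_def norm_symp_rot)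
    then have "x \<in> S" using r by auto
    then have "omega_st x u \<le> 1" using u C_le by blast
    moreover have "omega_st x u = r * norm u"
    proof -
      have "symp_rot (symp_rot (-u)) = u" by (simp add: symp_rot_def)
      moreover have "omega_st (symp_rot (-u)) u = (norm u)\<^sup>2"
        by (simp add: omega_antisym[of _ u] omega_symp_rot power2_norm_eq_inner)
      ultimately show ?thesis using False by (simp add: x_def omega.scaleR_left power2_eq_square)
    qed
    ultimately show ?thesis using r by (simp add: field_simps)
  qed (use r in auto)
  then show ?thesis unfolding bounded_iff by blast
qed

lemma compact_C: "compact C"
  using bounded_C closed_C compact_eq_bounded_closed by blast

definition polar_radius where "polar_radius = (SOME r. r > 0 \<and> (\<forall>u\<in>C. norm u \<le> r))"

lemma polar_radius: "polar_radius > 0" "u \<in> C \<Longrightarrow> norm u \<le> polar_radius"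
proof -
  have "\<exists>r. r > 0 \<and> (\<forall>u\<in>C. norm u \<le> r)"
    using bounded_C by (meson bounded_pos)
  then have "polar_radius > 0 \<and> (\<forall>u\<in>C. norm u \<le> polar_radius)" unfolding polar_radius_def by (rule someI_ex)
  then show "polar_radius > 0" "u \<in> C \<Longrightarrow> norm u \<le> polar_radius" by auto
qed

lemma ball_in_C: obtains c where "c > 0" "cball 0 c \<subseteq> C"
proof -
  obtain B where B: "B > 0" "\<And>x. x \<in> S \<Longrightarrow> norm x \<le> B"
    using compact_S compact_imp_bounded by (meson bounded_pos)
  have "cball 0 (1/B) \<subseteq> C"
  proof (clarsimp simp: omega_polar_def)
    fix u x :: "'n phase_space" assume u: "norm u \<le> 1 / B" and x: "x \<in> S"
    have "omega_st x u \<le> norm x * norm u" using abs_omega_le[of x u] by linarith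
    also have "\<dots> \<le> B * (1 / B)" using B x u by (intro mult_mono) auto
    finally show "omega_st x u \<le> 1" using B by simp
  qed
  then show ?thesis using that[of "1/B"] B by auto
qed

lemma bdd_g: "bdd_above ((\<lambda>u. omega_st x u) ` C)"
proof (rule bdd_aboveI2)
  fix u assume "u \<in> C"
  then show "omega_st x u \<le> norm x * polar_radius"
    using abs_omega_le[of x u] polar_radius(2)[of u] by (smt (verit, best) mult_left_mono norm_ge_zero)
qed

lemma g_upper: "u \<in> C \<Longrightarrow> omega_st x u \<le> g x"
  unfolding omega_gauge_def by (intro cSUP_upper bdd_g)

lemma g_least: "(\<And>u. u \<in> C \<Longrightarrow> omega_st x u \<le> c) \<Longrightarrow> g x \<le> c"
  unfolding omega_gauge_def using zero_C by (intro cSUP_least) auto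

lemma g_eqI: "u \<in> C \<Longrightarrow> (\<And>v. v \<in> C \<Longrightarrow> omega_st x v \<le> omega_st x u) \<Longrightarrow> g x = omega_st x u"
  by (meson antisym g_least g_upper)

lemma g_attained: "\<exists>u\<in>C. omega_st x u = g x"
proof -
  have "continuous_on C (omega_st x)"
    by (intro omega.continuous_on continuous_intros)
  then obtain u where "u \<in> C" "\<forall>v\<in>C. omega_st x v \<le> omega_st x u"
    using continuous_attains_sup[OF compact_C] zero_C by blast
  then show ?thesis using g_eqI by metis
qed

lemma g_nonneg: "0 \<le> g x"
  using g_upper[OF zero_C, of x] by (simp add: omega.zero_right)

lemma g_ge_norm: obtains c where "c > 0" "\<And>x. c * norm x \<le> g x"
proof -
  obtain c where c: "c > 0" "cball 0 c \<subseteq> C" by (rule ball_in_C)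
  have "c * norm x \<le> g x" for x
  proof (cases "x = 0")
    case False
    define u where "u = (c / norm x) *\<^sub>R symp_rot x"
    have "norm u = c" using False c by (simp add: u_def norm_symp_rot)
    then have "u \<in> C" using c by auto
    then have "omega_st x u \<le> g x" by (rule g_upper)
    then show ?thesis using False
      by (simp add: u_def omega.scaleR_right omega_symp_rot power2_norm_eq_inner[symmetric] power2_eq_square)
  qed (simp add: g_nonneg)
  then show ?thesis using c that by blast
qed

lemma g_pos: "x \<noteq> 0 \<Longrightarrow> 0 < g x"
  by (metis g_ge_norm less_le_trans mult_pos_pos zero_less_norm_iff)

lemma g_zero: "g 0 = 0"
  using g_attained[of 0] by (auto simp: omega.zero_left)

lemma g_scale: assumes "c \<ge> 0" shows "g (c *\<^sub>R x) = c * g x"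
proof -
  obtain u where u: "u \<in> C" "omega_st x u = g x" using g_attained by blast
  have "g (c *\<^sub>R x) = omega_st (c *\<^sub>R x) u"
    by (rule g_eqI) (use u assms in \<open>simp_all add: omega.scaleR_left mult_left_mono g_upper\<close>)
  then show ?thesis by (simp add: u omega.scaleR_left)
qed

lemma g_diff_le: "g x - g y \<le> polar_radius * norm (x - y)"
proof -
  obtain u where u: "u \<in> C" "omega_st x u = g x" using g_attained by blast
  have "g x - g y \<le> omega_st x u - omega_st y u" using u g_upper[of u y] by simp
  also have "\<dots> = omega_st (x - y) u" by (simp add: omega.diff_left)
  also have "\<dots> \<le> norm (x - y) * norm u" using abs_omega_le[of "x-y" u] by linarith
  also have "\<dots> \<le> norm (x - y) * polar_radius" using polar_radius u by (intro mult_left_mono) auto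
  finally show ?thesis by (simp add: mult.commute)
qed

lemma g_lipschitz: "\<bar>g x - g y\<bar> \<le> polar_radius * norm (x - y)"
  using g_diff_le[of x y] g_diff_le[of y x] by (simp add: norm_minus_commute abs_le_iff)

lemma g_continuous: "continuous_on A g"
proof -
  have "polar_radius-lipschitz_on A g"
    using g_lipschitz polar_radius by (intro lipschitz_onI) (auto simp: dist_norm)
  then show ?thesis by (rule lipschitz_on_continuous_on)
qed

lemma g_le_1: "x \<in> S \<Longrightarrow> g x \<le> 1"
  by (rule g_least) (simp add: C_le)

text \<open>The bipolar theorem: a hyperplane that separates \<open>x\<close> from \<open>S\<close> misses the origin, and its
  normalised functional is an element of the polar.\<close>

lemma g_gt_1: assumes "x \<notin> S" shows "1 < g x"
proof -
  have "closed S" "S \<noteq> {}" "0 \<in> S" using compact_S compact_imp_closed zero_int interior_subset by auto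
  then obtain a b where ab: "a \<bullet> x < b" "\<And>y. y \<in> S \<Longrightarrow> b < a \<bullet> y"
    using separating_hyperplane_closed_point[OF convex_S _ assms] by blast
  have b: "b < 0" using ab(2)[OF \<open>0 \<in> S\<close>] by simp
  define u where "u = symp_rot ((1/b) *\<^sub>R a)"
  have om: "omega_st y u = (a \<bullet> y) / b" for y
    by (simp add: u_def omega_symp_rot inner_commute)
  have "u \<in> C" unfolding omega_polar_def
    using ab(2) b by (auto simp: om field_simps intro: less_imp_le)
  then have "omega_st x u \<le> g x" by (rule g_upper)
  moreover have "omega_st x u > 1" using ab(1) b by (simp add: om field_simps)
  ultimately show ?thesis by simp
qed

lemma S_iff: "x \<in> S \<longleftrightarrow> g x \<le> 1"
  using g_le_1 g_gt_1 by (meson not_le)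

text \<open>The gauge is continuous, and a point of gauge one leaves \<open>S\<close> when it is dilated.\<close>

lemma frontier_S: "frontier S = {x. g x = 1}"
proof -
  have cl: "closed S" using compact_S compact_imp_closed by auto
  have "interior S = {x. g x < 1}"
  proof
    have "open {x. g x < 1}"
      using open_Collect_less[of g "\<lambda>_. 1"] g_continuous by auto
    then show "{x. g x < 1} \<subseteq> interior S"
      by (intro interior_maximal) (auto simp: S_iff)
    show "interior S \<subseteq> {x. g x < 1}"
    proof
      fix x assume "x \<in> interior S"
      then obtain e where e: "e > 0" "cball x e \<subseteq> S" by (auto simp: mem_interior_cball)
      show "x \<in> {x. g x < 1}"
      proof (cases "x = 0")
        case False
        have "dist x (x + (e / norm x) *\<^sub>R x) = e" using False e by (simp add: dist_norm)
        then have "x + (e / norm x) *\<^sub>R x \<in> S" using e by auto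
        then have "(1 + e / norm x) *\<^sub>R x \<in> S" by (simp add: scaleR_left_distrib)
        then have "(1 + e / norm x) * g x \<le> 1" using e g_scale[of "1 + e / norm x" x] g_le_1 by fastforce
        moreover have "e / norm x * g x > 0" using e False g_pos by simp
        ultimately show ?thesis by (simp add: algebra_simps)
      qed (simp add: g_zero)
    qed
  qed
  then show ?thesis unfolding frontier_def using cl by (auto simp: S_iff)
qed

end

section \<open>Closed polygons of maximal area\<close>

text \<open>For a closed polygon with successive edge vectors \<open>u i\<close> this is twice the symplectic area.\<close>

definition area_form :: "nat \<Rightarrow> (nat \<Rightarrow> 'n::finite phase_space) \<Rightarrow> real" where
  "area_form N u = (\<Sum>j<N. omega_st (\<Sum>i<j. u i) (u j))"

text \<open>The midpoint of the edge number \<open>j\<close> of the polygon that starts at the origin.\<close>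

definition midpoint_sum :: "(nat \<Rightarrow> 'a::real_vector) \<Rightarrow> nat \<Rightarrow> 'a" where
  "midpoint_sum u j = (\<Sum>i<j. u i) + (1/2) *\<^sub>R u j"

lemma area_form_midpoint: "area_form N u = (\<Sum>j<N. omega_st (midpoint_sum u j) (u j))"
  by (simp add: area_form_def midpoint_sum_def omega.add_left omega.scaleR_left)

text \<open>Discrete counterpart of integrating \<open>\<omega>(d, du)\<close> by parts. It makes the first variation of the
  area symmetric.\<close>

lemma omega_summation_by_parts:
  fixes n :: nat
  shows "(\<Sum>j<n. omega_st (\<Sum>i<j. d i) (u j)) =
     omega_st (\<Sum>i<n. d i) (\<Sum>i<n. u i) + (\<Sum>j<n. omega_st ((\<Sum>i<j. u i) + u j) (d j))"
proof (induction n)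
  case (Suc n)
  show ?case
    using omega_antisym[of "d n" "sum u {..<n}"] omega_antisym[of "d n" "u n"]
    by (simp add: Suc omega.add_left omega.add_right)
qed (simp add: omega.zero_left)

text \<open>The area is a quadratic form in the edges, and its first variation at a closed polygon pairs each
  variation \<open>d j\<close> with the midpoint of the edge \<open>j\<close>.\<close>

lemma area_form_perturb:
  assumes "(\<Sum>i<N. u i) = 0"
  shows "area_form N (\<lambda>i. u i + e *\<^sub>R d i) =
     area_form N u + 2 * e * (\<Sum>j<N. omega_st (midpoint_sum u j) (d j)) + e\<^sup>2 * area_form N d"
proof -
  have "area_form N (\<lambda>i. u i + e *\<^sub>R d i) =
     area_form N u + e * ((\<Sum>j<N. omega_st (\<Sum>i<j. u i) (d j)) + (\<Sum>j<N. omega_st (\<Sum>i<j. d i) (u j)))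
     + e\<^sup>2 * area_form N d"
    by (simp add: area_form_def sum.distrib scaleR_sum_right[symmetric] omega.add_left omega.add_right
        omega.scaleR_left omega.scaleR_right sum_distrib_left algebra_simps power2_eq_square)
  also have "(\<Sum>j<N. omega_st (\<Sum>i<j. d i) (u j)) = (\<Sum>j<N. omega_st ((\<Sum>i<j. u i) + u j) (d j))"
    using omega_summation_by_parts[of d u N] by (simp add: assms omega.zero_right)
  also have "(\<Sum>j<N. omega_st (\<Sum>i<j. u i) (d j)) + \<dots> = 2 * (\<Sum>j<N. omega_st (midpoint_sum u j) (d j))"
    by (simp add: midpoint_sum_def sum_distrib_left sum.distrib[symmetric] omega.add_left omega.scaleR_left algebra_simps)
  finally show ?thesis by simp
qed

context origin_body
begin

text \<open>Entries beyond \<open>N\<close> are constrained to \<open>C\<close> as well, so that the set is a closed subset of a product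
  of compact sets and Tychonoff's theorem applies.\<close>

definition closed_steps :: "nat \<Rightarrow> (nat \<Rightarrow> 'n phase_space) set" where
  "closed_steps N = {u. (\<forall>i. u i \<in> C) \<and> (\<Sum>i<N. u i) = 0}"

lemma compact_closed_steps: "compact (closed_steps N)"
proof -
  have "compactin (product_topology (\<lambda>_. euclidean) UNIV) (PiE (UNIV::nat set) (\<lambda>_. C))"
    using compact_C by (simp add: compactin_PiE)
  then have "compact (PiE (UNIV::nat set) (\<lambda>_. C))"
    by (simp add: euclidean_product_topology)
  moreover have "closed {u::nat \<Rightarrow> 'n phase_space. (\<Sum>i<N. u i) = 0}"
    by (intro closed_Collect_eq continuous_intros continuous_on_product_coordinates)
  moreover have "closed_steps N = PiE UNIV (\<lambda>_. C) \<inter> {u. (\<Sum>i<N. u i) = 0}"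
    by (auto simp: closed_steps_def PiE_def Pi_def)
  ultimately show ?thesis by (simp add: compact_Int_closed)
qed

lemma ex_max_area: "\<exists>u\<in>closed_steps N. \<forall>v\<in>closed_steps N. area_form N v \<le> area_form N u"
proof (rule continuous_attains_sup[OF compact_closed_steps])
  have "(\<lambda>_. 0) \<in> closed_steps N" by (simp add: closed_steps_def zero_C)
  then show "closed_steps N \<noteq> {}" by blast
  show "continuous_on (closed_steps N) (area_form N)"
    unfolding area_form_def
    by (intro continuous_on_sum omega.continuous_on continuous_on_subset[OF continuous_on_product_coordinates subset_UNIV])
qed

text \<open>The admissible polygons form a convex set, so the derivative of the area at a maximiser \<open>u\<close> in the
  direction of another admissible \<open>v\<close> is not positive.\<close>

lemma max_area_first_order:
  assumes u: "u \<in> closed_steps N" and max: "\<And>v. v \<in> closed_steps N \<Longrightarrow> area_form N v \<le> area_form N u"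
    and v: "v \<in> closed_steps N"
  shows "(\<Sum>j<N. omega_st (midpoint_sum u j) (v j)) \<le> (\<Sum>j<N. omega_st (midpoint_sum u j) (u j))"
proof -
  define d where "d = (\<lambda>i. v i - u i)"
  define B where "B = (\<Sum>j<N. omega_st (midpoint_sum u j) (d j))"
  have *: "2 * B + e * area_form N d \<le> 0" if e: "0 < e" "e \<le> 1" for e
  proof -
    have "(\<lambda>i. u i + e *\<^sub>R d i) \<in> closed_steps N"
    proof -
      have "u i + e *\<^sub>R d i \<in> C" for i
      proof -
        have "u i + e *\<^sub>R d i = (1 - e) *\<^sub>R u i + e *\<^sub>R v i" by (simp add: d_def algebra_simps)
        then show ?thesis using e u v convexD[OF convex_C, of "u i" "v i" "1 - e" e]
          by (auto simp: closed_steps_def)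
      qed
      then show ?thesis using u v
        by (simp add: closed_steps_def d_def sum.distrib scaleR_sum_right[symmetric] sum_subtractf)
    qed
    from max[OF this] have "2 * e * B + e\<^sup>2 * area_form N d \<le> 0"
      using u by (simp add: area_form_perturb B_def closed_steps_def)
    then have "e * (2 * B + e * area_form N d) \<le> 0" by (simp add: algebra_simps power2_eq_square)
    then show ?thesis using e by (simp add: mult_le_0_iff)
  qed
  have "((\<lambda>e. 2 * B + e * area_form N d) \<longlongrightarrow> 2 * B + 0 * area_form N d) (at_right 0)"
    by (intro tendsto_intros)
  moreover have "eventually (\<lambda>e. 2 * B + e * area_form N d \<le> 0) (at_right 0)"
    using * by (auto simp: eventually_at_right_field intro!: exI[of _ 1])
  ultimately have "2 * B + 0 * area_form N d \<le> 0"
    by (rule tendsto_upperbound) simp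
  then show ?thesis by (simp add: B_def d_def omega.diff_right sum_subtractf)
qed

text \<open>The Lagrange multiplier for the closing condition. By the first-order condition the maximiser
  solves a linear problem under one vector-valued constraint; separating the set of attainable pairs
  (sum of the edges, gain) from the origin decouples the edges.\<close>

lemma max_area_multiplier:
  assumes u: "u \<in> closed_steps N" and max: "\<And>v. v \<in> closed_steps N \<Longrightarrow> area_form N v \<le> area_form N u"
    and N: "N > 0"
  obtains b where "\<And>j v. j < N \<Longrightarrow> v \<in> C \<Longrightarrow>
     omega_st (midpoint_sum u j - b) v \<le> omega_st (midpoint_sum u j - b) (u j)"
proof -
  define L where "L v = (\<Sum>j<N. omega_st (midpoint_sum u j) (v j))" for v
  \<comment> \<open>Pairs of a sum of edges and a value strictly below the gain over \<open>u\<close>; the strict inequality keeps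
    the origin outside.\<close>
  define T where "T = {(\<Sum>j<N. v j, t) |v t. (\<forall>j. v j \<in> C) \<and> t < L v - L u}"
  have lin: "L (\<lambda>j. x *\<^sub>R v j + y *\<^sub>R w j) = x * L v + y * L w" for x y v w
    by (simp add: L_def omega.add_right omega.scaleR_right sum.distrib sum_distrib_left)
  have "convex T"
  proof (rule convexI)
    fix p q :: "'n phase_space \<times> real" and x y :: real
    assume pq: "p \<in> T" "q \<in> T" and xy: "0 \<le> x" "0 \<le> y" "x + y = 1"
    obtain v t where v: "p = (\<Sum>j<N. v j, t)" "\<forall>j. v j \<in> C" "t < L v - L u"
      using pq(1) unfolding T_def by blast
    obtain w s where w: "q = (\<Sum>j<N. w j, s)" "\<forall>j. w j \<in> C" "s < L w - L u"
      using pq(2) unfolding T_def by blast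
    have "x * t + y * s < x * (L v - L u) + y * (L w - L u)"
    proof (cases "x = 0")
      case False
      then have "x * t < x * (L v - L u)" using xy v by simp
      moreover have "y * s \<le> y * (L w - L u)" using xy w by (simp add: mult_left_mono)
      ultimately show ?thesis by simp
    qed (use xy w in auto)
    also have "\<dots> = L (\<lambda>j. x *\<^sub>R v j + y *\<^sub>R w j) - (x + y) * L u" unfolding lin by (simp add: algebra_simps)
    finally have "x * t + y * s < L (\<lambda>j. x *\<^sub>R v j + y *\<^sub>R w j) - L u" using xy by simp
    moreover have "\<forall>j. x *\<^sub>R v j + y *\<^sub>R w j \<in> C" using v w xy convexD[OF convex_C] by blast
    moreover have "x *\<^sub>R p + y *\<^sub>R q = (\<Sum>j<N. x *\<^sub>R v j + y *\<^sub>R w j, x * t + y * s)"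
      by (simp add: v w sum.distrib scaleR_sum_right)
    ultimately show "x *\<^sub>R p + y *\<^sub>R q \<in> T" unfolding T_def by blast
  qed
  moreover have "0 \<notin> T"
  proof
    assume "0 \<in> T"
    then obtain v where v: "(\<Sum>j<N. v j) = 0" "\<forall>j. v j \<in> C" "0 < L v - L u"
      unfolding T_def zero_prod_def by auto
    then have "v \<in> closed_steps N" by (simp add: closed_steps_def)
    from max_area_first_order[OF u max this] v(3) show False by (simp add: L_def)
  qed
  ultimately obtain p where p: "p \<noteq> 0" "\<And>x. x \<in> T \<Longrightarrow> 0 \<le> p \<bullet> x"
    using separating_hyperplane_set_0 by blast
  obtain a \<tau> where a: "p = (a, \<tau>)" by (cases p)
  have sep: "0 \<le> a \<bullet> (\<Sum>j<N. v j) + \<tau> * t" if "\<forall>j. v j \<in> C" "t < L v - L u" for v t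
    using p(2)[of "(\<Sum>j<N. v j, t)"] that by (auto simp: T_def a inner_prod_def)
  have uC: "\<forall>j. u j \<in> C" and usum: "(\<Sum>j<N. u j) = 0" using u by (auto simp: closed_steps_def)
  have "\<tau> \<le> 0" using sep[OF uC, of "-1"] usum by simp
  \<comment> \<open>The separating hyperplane is not vertical, because the sums of edges fill a neighbourhood of zero.\<close>
  have "\<tau> \<noteq> 0"
  proof
    assume "\<tau> = 0"
    then have "a \<noteq> 0" using p a by (auto simp: zero_prod_def)
    obtain c where c: "c > 0" "cball 0 c \<subseteq> C" by (rule ball_in_C)
    define v where "v = (\<lambda>j::nat. (- c / norm a) *\<^sub>R a)"
    have "norm (v j) = c" for j using \<open>a \<noteq> 0\<close> c by (simp add: v_def)
    then have "\<forall>j. v j \<in> C" using c by auto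
    from sep[OF this, of "L v - L u - 1"] have "0 \<le> a \<bullet> (\<Sum>j<N. v j)" using \<open>\<tau> = 0\<close> by simp
    moreover have "a \<bullet> (\<Sum>j<N. v j) = - (real N * c * norm a)"
      using \<open>a \<noteq> 0\<close>
      by (simp add: v_def sum_constant_scaleR power2_norm_eq_inner[symmetric] power2_eq_square
          del: scaleR_minus_left sum_constant)
    ultimately show False using N c \<open>a \<noteq> 0\<close> by (simp add: mult_le_0_iff)
  qed
  with \<open>\<tau> \<le> 0\<close> have \<tau>: "\<tau> < 0" by simp
  define a' where "a' = (1 / (- \<tau>)) *\<^sub>R a"
  have sep': "L v - L u \<le> a' \<bullet> (\<Sum>j<N. v j)" if v: "\<forall>j. v j \<in> C" for v
  proof (rule dense_le)
    fix t assume "t < L v - L u"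
    from sep[OF v this] show "t \<le> a' \<bullet> (\<Sum>j<N. v j)" using \<tau> by (simp add: a'_def field_simps)
  qed
  \<comment> \<open>The multiplier, as a vector that represents it through the symplectic form.\<close>
  define b where "b = - symp_rot a'"
  have b: "omega_st b x = a' \<bullet> x" for x
    by (simp add: b_def omega_st_eq_inner symp_rot_def inner_prod_def)
  show ?thesis
  proof (rule that)
    fix j v assume j: "j < N" and v: "v \<in> C"
    have upd: "(\<Sum>i<N. F i ((u(j := v)) i)) = (\<Sum>i<N. F i (u i)) + (F j v - F j (u j))"
      for F :: "nat \<Rightarrow> 'n phase_space \<Rightarrow> 'b::real_vector"
      using j by (simp add: sum.remove[of "{..<N}" j])
    have "L (u(j := v)) - L u \<le> a' \<bullet> (\<Sum>i<N. (u(j := v)) i)"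
      using uC v by (intro sep') auto
    then have "omega_st (midpoint_sum u j) v - omega_st (midpoint_sum u j) (u j) \<le> a' \<bullet> (v - u j)"
      using upd[of "\<lambda>i x. omega_st (midpoint_sum u i) x"] upd[of "\<lambda>i x. x"] usum unfolding L_def by simp
    then show "omega_st (midpoint_sum u j - b) v \<le> omega_st (midpoint_sum u j - b) (u j)"
      by (simp add: omega.diff_left b inner_diff_right)
  qed
qed

text \<open>After translation by the multiplier every edge maximises the symplectic form against its own
  midpoint: a discrete version of the characteristic equation. Since the edges sum to zero, the
  translation does not change the area, which becomes the sum of the gauges of the midpoints.\<close>

lemma extremal_polygon:
  assumes "N > 0"
  obtains u b where "u \<in> closed_steps N" "\<And>v. v \<in> closed_steps N \<Longrightarrow> area_form N v \<le> area_form N u"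
    "\<And>j. j < N \<Longrightarrow> g (midpoint_sum u j - b) = omega_st (midpoint_sum u j - b) (u j)"
    "(\<Sum>j<N. g (midpoint_sum u j - b)) = area_form N u"
proof -
  obtain u where u: "u \<in> closed_steps N" "\<And>v. v \<in> closed_steps N \<Longrightarrow> area_form N v \<le> area_form N u"
    using ex_max_area by blast
  obtain b where b: "\<And>j v. j < N \<Longrightarrow> v \<in> C \<Longrightarrow>
     omega_st (midpoint_sum u j - b) v \<le> omega_st (midpoint_sum u j - b) (u j)"
    using max_area_multiplier[OF u assms] by blast
  have geq: "g (midpoint_sum u j - b) = omega_st (midpoint_sum u j - b) (u j)" if "j < N" for j
    using u b[OF that] by (intro g_eqI) (auto simp: closed_steps_def)
  have "(\<Sum>j<N. g (midpoint_sum u j - b)) = (\<Sum>j<N. omega_st (midpoint_sum u j) (u j)) - omega_st b (\<Sum>j<N. u j)"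
    by (simp add: geq omega.diff_left sum_subtractf omega.sum_right)
  also have "\<dots> = area_form N u"
    using u by (simp add: area_form_midpoint closed_steps_def omega.zero_right)
  finally show ?thesis using that[OF u geq] by blast
qed

end

section \<open>Rectangles and polygonal loops\<close>

definition then_const :: "nat \<Rightarrow> (nat \<Rightarrow> 'a) \<Rightarrow> 'a \<Rightarrow> nat \<Rightarrow> 'a" where
  "then_const N u v i = (if i < N then u i else v)"

lemma sum_then_const:
  fixes v :: "'a::real_vector"
  shows "(\<Sum>i<N + m. then_const N u v i) = (\<Sum>i<N. u i) + real m *\<^sub>R v"
proof (induction m)
  case 0 then show ?case by (simp add: then_const_def)
next
  case (Suc m) then show ?case by (simp add: then_const_def algebra_simps)
qed

lemma area_form_then_const:
  "area_form (N + m) (then_const N u v) = area_form N u + real m * omega_st (\<Sum>i<N. u i) v"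
proof (induction m)
  case 0 then show ?case by (simp add: area_form_def then_const_def)
next
  case (Suc m)
  have "area_form (N + Suc m) (then_const N u v) =
      area_form (N + m) (then_const N u v) + omega_st (\<Sum>i<N + m. then_const N u v i) (then_const N u v (N + m))"
    by (simp add: area_form_def)
  also have "omega_st (\<Sum>i<N + m. then_const N u v i) (then_const N u v (N + m)) = omega_st (\<Sum>i<N. u i) v"
    by (simp only: sum_then_const) (simp add: then_const_def omega.add_left omega.scaleR_left)
  finally show ?case by (simp add: Suc algebra_simps)
qed

text \<open>Four sides of \<open>m\<close> equal edges each, in the directions \<open>e\<close>, \<open>f\<close>, \<open>- e\<close> and \<open>- f\<close>.\<close>

definition rectangle :: "nat \<Rightarrow> 'n::finite phase_space \<Rightarrow> 'n phase_space \<Rightarrow> nat \<Rightarrow> 'n phase_space" where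
  "rectangle m e f = then_const (m + m + m) (then_const (m + m) (then_const m (\<lambda>_. e) f) (- e)) (- f)"

lemma sum_rectangle: "(\<Sum>i<m+m+m+m. rectangle m e f i) = 0"
  by (simp add: rectangle_def sum_then_const sum_constant_scaleR)

lemma area_form_rectangle: "area_form (m+m+m+m) (rectangle m e f) = 2 * (real m)\<^sup>2 * omega_st e f"
proof -
  have "area_form m (\<lambda>_. e) = 0"
    by (simp add: area_form_def sum_constant_scaleR omega.scaleR_left)
  then show ?thesis
    unfolding rectangle_def area_form_then_const sum_then_const
    by (simp add: sum_constant_scaleR
        omega.add_left omega.scaleR_left omega.minus_right omega.minus_left omega.diff_left
        omega_antisym[of f e] power2_eq_square algebra_simps)
qed

text \<open>The share of an edge that has been traversed by time \<open>x\<close>, when the edge starts at time zero and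
  takes unit time.\<close>

definition ramp :: "real \<Rightarrow> real" where "ramp x = max 0 (min 1 x)"

lemma sum_ramp: "0 \<le> x \<Longrightarrow> (\<Sum>i<N. ramp (x - real i)) = min (real N) x"
  by (induction N) (auto simp: ramp_def)

lemma ramp_mono: "x \<le> y \<Longrightarrow> ramp x \<le> ramp y"
  by (auto simp: ramp_def)

text \<open>The polygon with edges \<open>u i / N\<close> and starting point \<open>- b / N\<close>, traversed in unit time.\<close>

definition polygon :: "nat \<Rightarrow> (nat \<Rightarrow> 'a::real_vector) \<Rightarrow> 'a \<Rightarrow> real \<Rightarrow> 'a" where
  "polygon N u b t = (1 / real N) *\<^sub>R ((\<Sum>i<N. ramp (real N * t - real i) *\<^sub>R u i) - b)"

text \<open>An increment of the polygon is an average of the edges traversed in between, times the elapsed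
  time. So it is close to \<open>(t - s) v\<close> when these edges are close to \<open>v\<close>. The case \<open>v = 0\<close> is the
  Lipschitz estimate.\<close>

lemma polygon_increment:
  fixes u :: "nat \<Rightarrow> 'a::real_normed_vector"
  assumes st: "0 \<le> s" "s \<le> t" "t \<le> 1" and N: "N > 0"
    and close: "\<And>i. i < N \<Longrightarrow> real i < real N * t \<Longrightarrow> real N * s < real i + 1 \<Longrightarrow> norm (u i - v) \<le> e"
  shows "norm (polygon N u b t - polygon N u b s - (t - s) *\<^sub>R v) \<le> e * (t - s)"
proof -
  define w where "w i = ramp (real N * t - real i) - ramp (real N * s - real i)" for i
  have w0: "w i \<ge> 0" for i using st by (simp add: w_def ramp_mono mult_left_mono)
  \<comment> \<open>The weights of the edges add up to the elapsed time, measured in edges.\<close>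
  have "real N * t \<le> real N" "real N * s \<le> real N"
    using st N by (simp_all add: mult_left_le)
  then have wsum: "(\<Sum>i<N. w i) = real N * (t - s)"
    using st by (simp add: w_def sum_subtractf sum_ramp algebra_simps)
  have "polygon N u b t - polygon N u b s = (1 / real N) *\<^sub>R (\<Sum>i<N. w i *\<^sub>R u i)"
    by (simp add: polygon_def w_def scaleR_diff_left sum_subtractf scaleR_diff_right)
  moreover have "(t - s) *\<^sub>R v = (1 / real N) *\<^sub>R (\<Sum>i<N. w i *\<^sub>R v)"
    using N by (simp add: scaleR_sum_left[symmetric] wsum)
  ultimately have "polygon N u b t - polygon N u b s - (t - s) *\<^sub>R v = (1 / real N) *\<^sub>R (\<Sum>i<N. w i *\<^sub>R (u i - v))"
    by (simp add: scaleR_diff_right sum_subtractf)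
  then have "norm (polygon N u b t - polygon N u b s - (t - s) *\<^sub>R v) = (1 / real N) * norm (\<Sum>i<N. w i *\<^sub>R (u i - v))"
    by simp
  also have "norm (\<Sum>i<N. w i *\<^sub>R (u i - v)) \<le> (\<Sum>i<N. w i * e)"
  proof (rule order_trans[OF norm_sum sum_mono])
    fix i assume i: "i \<in> {..<N}"
    show "norm (w i *\<^sub>R (u i - v)) \<le> w i * e"
    proof (cases "real i < real N * t \<and> real N * s < real i + 1")
      case True
      then show ?thesis using close[of i] i w0[of i] by (simp add: mult_left_mono)
    next
      case False
      then have "w i = 0" using st mult_left_mono[OF st(2), of "real N"] by (auto simp: w_def ramp_def)
      then show ?thesis by simp
    qed
  qed
  also have "(\<Sum>i<N. w i * e) = real N * (t - s) * e" by (simp add: sum_distrib_right[symmetric] wsum)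
  finally show ?thesis using N by (simp add: divide_right_mono mult.commute)
qed

lemma polygon_midpoint:
  assumes "j < N"
  shows "polygon N u b ((real j + 1/2) / real N) = (1 / real N) *\<^sub>R (midpoint_sum u j - b)"
proof -
  have "(\<Sum>i<N. ramp (real j + 1/2 - real i) *\<^sub>R u i) = (\<Sum>i<j. u i) + (1/2) *\<^sub>R u j"
  proof -
    have "(\<Sum>i<N. ramp (real j + 1/2 - real i) *\<^sub>R u i) = (\<Sum>i<Suc j. ramp (real j + 1/2 - real i) *\<^sub>R u i)"
      using assms by (intro sum.mono_neutral_right) (auto simp: ramp_def)
    also have "\<dots> = (\<Sum>i<j. ramp (real j + 1/2 - real i) *\<^sub>R u i) + (1/2) *\<^sub>R u j" by (simp add: ramp_def)
    also have "(\<Sum>i<j. ramp (real j + 1/2 - real i) *\<^sub>R u i) = (\<Sum>i<j. u i)"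
      by (intro sum.cong) (auto simp: ramp_def min_def max_def)
    finally show ?thesis .
  qed
  then show ?thesis using assms by (simp add: polygon_def midpoint_sum_def)
qed

lemma polygon_closed:
  assumes "(\<Sum>i<N. u i) = 0"
  shows "polygon N u b 0 = polygon N u b 1"
proof -
  have "ramp (real N * 0 - real i) = 0" for i by (simp add: ramp_def)
  moreover have "ramp (real N * 1 - real i) = 1" if "i < N" for i using that by (simp add: ramp_def)
  ultimately show ?thesis using assms by (simp add: polygon_def)
qed

context origin_body
begin

definition max_area :: "nat \<Rightarrow> real" where
  "max_area N = (SUP u\<in>closed_steps N. area_form N u)"

text \<open>The normalised extremal areas along a subsequence. The number of edges is a multiple of four to
  make room for a rectangle with four equally long sides.\<close>

abbreviation area_limit :: "(nat \<Rightarrow> nat) \<Rightarrow> real \<Rightarrow> bool" where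
  "area_limit r \<rho> \<equiv> (\<lambda>k. max_area (4 * Suc (r k)) / (real (4 * Suc (r k)))\<^sup>2) \<longlonglongrightarrow> \<rho>"

lemma max_area_upper: "u \<in> closed_steps N \<Longrightarrow> area_form N u \<le> max_area N"
  unfolding max_area_def using ex_max_area[of N] by (intro cSUP_upper) (auto simp: bdd_above_def)

lemma max_area_eqI:
  assumes "u \<in> closed_steps N" "\<And>v. v \<in> closed_steps N \<Longrightarrow> area_form N v \<le> area_form N u"
  shows "max_area N = area_form N u"
  using assms max_area_upper[OF assms(1)] unfolding max_area_def
  by (intro antisym cSUP_least) auto

lemma max_area_rectangle:
  assumes "e \<in> C" "- e \<in> C" "f \<in> C" "- f \<in> C" "m > 0"
  shows "omega_st e f / 8 \<le> max_area (4 * m) / (real (4 * m))\<^sup>2"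
proof -
  have eq: "4 * m = m + m + m + m" by simp
  have "rectangle m e f \<in> closed_steps (4 * m)"
    using assms unfolding eq closed_steps_def by (simp add: sum_rectangle) (simp add: rectangle_def then_const_def)
  then have "2 * (real m)\<^sup>2 * omega_st e f \<le> max_area (4 * m)"
    using max_area_upper area_form_rectangle[of m e f] unfolding eq by metis
  then show ?thesis using assms by (simp add: field_simps power2_eq_square)
qed

lemma max_area_bounded_below: obtains c where "c > 0" "\<And>m. m > 0 \<Longrightarrow> c \<le> max_area (4 * m) / (real (4 * m))\<^sup>2"
proof -
  obtain c where c: "c > 0" "cball 0 c \<subseteq> C" by (rule ball_in_C)
  obtain x :: "'n phase_space" where x: "norm x = c" using vector_choose_size[of c] c(1) less_imp_le by blast
  have inC: "y \<in> C" if "norm y = c" for y using c(2) that by (intro subsetD[OF c(2)]) simp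
  have "x \<in> C" "- x \<in> C" "- symp_rot x \<in> C" "symp_rot x \<in> C"
    by (simp_all add: inC x norm_symp_rot)
  from max_area_rectangle[OF this(1,2,4,3)] have "c\<^sup>2 / 8 \<le> max_area (4 * m) / (real (4 * m))\<^sup>2" if "m > 0" for m
    using that x by (simp add: omega_symp_rot power2_norm_eq_inner[symmetric])
  moreover have "c\<^sup>2 / 8 > 0" using c by simp
  ultimately show ?thesis using that by blast
qed

text \<open>Gives the extremal polygons a uniform bound on the area, hence one on their multipliers.\<close>

lemma area_form_le:
  assumes "u \<in> closed_steps N" shows "area_form N u \<le> (real N)\<^sup>2 * polar_radius\<^sup>2"
proof -
  have "area_form N u \<le> (\<Sum>j<N. real N * polar_radius * polar_radius)" unfolding area_form_def
  proof (rule sum_mono)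
    fix j assume j: "j \<in> {..<N}"
    have n: "norm (u i) \<le> polar_radius" for i using assms polar_radius by (auto simp: closed_steps_def)
    have "norm (sum u {..<j}) \<le> (\<Sum>i<j. polar_radius)" by (rule order_trans[OF norm_sum sum_mono]) (use n in auto)
    also have "\<dots> = real j * polar_radius" by simp
    also have "\<dots> \<le> real N * polar_radius" using j polar_radius by (intro mult_right_mono) auto
    finally have "norm (sum u {..<j}) * norm (u j) \<le> real N * polar_radius * polar_radius"
      using n[of j] polar_radius by (intro mult_mono) auto
    then show "omega_st (sum u {..<j}) (u j) \<le> real N * polar_radius * polar_radius"
      using abs_omega_le[of "sum u {..<j}" "u j"] by linarith
  qed
  then show ?thesis by (simp add: power2_eq_square)
qed

end

section \<open>Bodies with unique supporting functionals\<close>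

locale regular_body = origin_body S for S :: "'n::finite phase_space set" +
  assumes unique_dual: "\<lbrakk>g x = 1; u \<in> C; v \<in> C; omega_st x u = 1; omega_st x v = 1\<rbrakk> \<Longrightarrow> u = v"
begin

text \<open>At a boundary point of a smooth body this spans the characteristic line.\<close>

definition dual_vector :: "'n phase_space \<Rightarrow> 'n phase_space" where
  "dual_vector x = (SOME u. u \<in> C \<and> omega_st x u = g x)"

lemma dual_vector: "dual_vector x \<in> C" "omega_st x (dual_vector x) = g x"
proof -
  have "\<exists>u. u \<in> C \<and> omega_st x u = g x" using g_attained by blast
  then have "dual_vector x \<in> C \<and> omega_st x (dual_vector x) = g x" unfolding dual_vector_def by (rule someI_ex)
  then show "dual_vector x \<in> C" "omega_st x (dual_vector x) = g x" by auto
qed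

lemma norm_dual_vector: "norm (dual_vector x) \<le> polar_radius" using dual_vector polar_radius by blast

lemma dual_vector_eqI: assumes "x \<noteq> 0" "u \<in> C" "omega_st x u = g x" shows "u = dual_vector x"
proof (rule unique_dual)
  have pos: "g x > 0" using assms g_pos by simp
  show "g ((1 / g x) *\<^sub>R x) = 1" using pos by (simp add: g_scale)
  show "omega_st ((1 / g x) *\<^sub>R x) u = 1" "omega_st ((1 / g x) *\<^sub>R x) (dual_vector x) = 1"
    using pos assms dual_vector by (auto simp: omega.scaleR_left)
qed (use assms dual_vector in auto)

lemma dual_vector_scale: assumes "x \<noteq> 0" "c > 0" shows "dual_vector (c *\<^sub>R x) = dual_vector x"
  by (rule dual_vector_eqI[symmetric]) (use assms dual_vector in \<open>auto simp: g_scale omega.scaleR_left\<close>)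

text \<open>Upper semicontinuity of the set of maximisers at a point where it is a singleton: maximisers that
  keep a distance from \<open>dual_vector x\<close> lose a fixed amount \<open>m\<close>, and moving \<open>x\<close> slightly changes all
  values by less than half of it.\<close>

lemma maximisers_near:
  assumes "x \<noteq> 0" "e > 0"
  obtains d where "d > 0" "\<And>x' u. norm (x' - x) < d \<Longrightarrow> u \<in> C \<Longrightarrow> omega_st x' u = g x' \<Longrightarrow> norm (u - dual_vector x) < e"
proof (cases "C \<inter> {u. e \<le> norm (u - dual_vector x)} = {}")
  case True
  then show ?thesis using that[of 1] by fastforce
next
  case False
  have "compact (C \<inter> {u. e \<le> norm (u - dual_vector x)})"
    by (intro compact_Int_closed compact_C closed_Collect_le continuous_intros)
  moreover have "continuous_on (C \<inter> {u. e \<le> norm (u - dual_vector x)}) (omega_st x)"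
    by (intro omega.continuous_on continuous_intros)
  ultimately obtain w where w: "w \<in> C" "e \<le> norm (w - dual_vector x)"
     "\<And>u. u \<in> C \<Longrightarrow> e \<le> norm (u - dual_vector x) \<Longrightarrow> omega_st x u \<le> omega_st x w"
    using continuous_attains_sup[OF _ False] by blast
  define m where "m = g x - omega_st x w"
  have "w \<noteq> dual_vector x" using w assms by auto
  then have m: "m > 0" using dual_vector_eqI[OF assms(1) w(1)] g_upper[OF w(1), of x] by (force simp: m_def)
  show ?thesis
  proof (rule that[of "m / (2 * polar_radius)"])
    show "m / (2 * polar_radius) > 0" using m polar_radius by simp
    fix x' u assume x': "norm (x' - x) < m / (2 * polar_radius)" and u: "u \<in> C" "omega_st x' u = g x'"
    have 1: "polar_radius * norm (x' - x) < m / 2" using x' polar_radius by (simp add: field_simps)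
    show "norm (u - dual_vector x) < e"
    proof (rule ccontr)
      assume "\<not> norm (u - dual_vector x) < e"
      then have "omega_st x u \<le> g x - m" using w(3)[OF u(1)] by (simp add: m_def)
      moreover have "omega_st x' u - omega_st x u \<le> norm (x' - x) * norm u"
        using abs_omega_le[of "x' - x" u] by (simp add: omega.diff_left)
      moreover have "norm (x' - x) * norm u \<le> polar_radius * norm (x' - x)"
        using polar_radius u by (metis mult.commute mult_left_mono norm_ge_zero)
      moreover have "g x - g x' \<le> polar_radius * norm (x' - x)" using g_diff_le[of x x'] by (simp add: norm_minus_commute)
      ultimately show False using 1 u by linarith
    qed
  qed
qed

lemma dual_vector_continuous_on: assumes "0 \<notin> A" shows "continuous_on A dual_vector"
proof (clarsimp simp only: continuous_on_iff)
  fix x e assume x: "x \<in> A" and e: "(0::real) < e"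
  then have "x \<noteq> 0" using assms by blast
  then obtain d where "d > 0" "\<And>x' u. norm (x' - x) < d \<Longrightarrow> u \<in> C \<Longrightarrow> omega_st x' u = g x' \<Longrightarrow> norm (u - dual_vector x) < e"
    using maximisers_near e by blast
  then show "\<exists>d>0. \<forall>x'\<in>A. dist x' x < d \<longrightarrow> dist (dual_vector x') (dual_vector x) < e"
    unfolding dist_norm using dual_vector by blast
qed

text \<open>Formally the derivative of \<open>g (Z t)\<close> is \<open>\<omega>(Z', U Z) = \<omega>(U Z, U Z) = 0\<close>. The gauge is only Lipschitz,
  so the difference quotients are squeezed between the values of \<open>\<omega>\<close> at the two maximisers. Squaring
  the gauge makes the derivative vanish also at the zeros of \<open>Z\<close>, where the differential equation
  gives no information.\<close>

lemma gauge_conserved: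
  fixes Z :: "real \<Rightarrow> 'n phase_space"
  assumes lip: "\<And>s t. s \<in> {a..b} \<Longrightarrow> t \<in> {a..b} \<Longrightarrow> norm (Z s - Z t) \<le> polar_radius * \<bar>s - t\<bar>"
    and der: "\<And>t. t \<in> {a..b} \<Longrightarrow> Z t \<noteq> 0 \<Longrightarrow> (Z has_vector_derivative dual_vector (Z t)) (at t within {a..b})"
    and cd: "c \<in> {a..b}" "d \<in> {a..b}"
  shows "g (Z c) = g (Z d)"
proof -
  have fl: "\<bar>g (Z s) - g (Z t)\<bar> \<le> polar_radius * polar_radius * \<bar>s - t\<bar>" if "s \<in> {a..b}" "t \<in> {a..b}" for s t
  proof -
    have "\<bar>g (Z s) - g (Z t)\<bar> \<le> polar_radius * norm (Z s - Z t)" by (rule g_lipschitz)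
    also have "\<dots> \<le> polar_radius * (polar_radius * \<bar>s - t\<bar>)" using lip[OF that] polar_radius by (intro mult_left_mono) auto
    finally show ?thesis by (simp add: mult.assoc)
  qed
  have "((\<lambda>t. (g (Z t))\<^sup>2) has_derivative (\<lambda>h. 0)) (at t within {a..b})" if t: "t \<in> {a..b}" for t
  proof (cases "Z t = 0")
    case True
    show ?thesis unfolding has_derivative_within_alt
    proof (intro conjI bounded_linear_zero allI impI)
      fix e :: real assume e: "e > 0"
      define K where "K = (polar_radius * polar_radius)\<^sup>2"
      have K: "K > 0" using polar_radius by (simp add: K_def)
      show "\<exists>d>0. \<forall>s\<in>{a..b}. norm (s - t) < d \<longrightarrow> norm ((g (Z s))\<^sup>2 - (g (Z t))\<^sup>2 - 0) \<le> e * norm (s - t)"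
      proof (intro exI conjI ballI impI)
        show "e / K > 0" using e K by simp
        fix s assume s: "s \<in> {a..b}" "norm (s - t) < e / K"
        have "(g (Z s))\<^sup>2 \<le> (polar_radius * polar_radius * \<bar>s - t\<bar>)\<^sup>2"
          using fl[OF s(1) t] True by (intro power_mono) (auto simp: g_zero g_nonneg)
        also have "\<dots> = (K * \<bar>s - t\<bar>) * \<bar>s - t\<bar>" by (simp add: K_def power2_eq_square)
        also have "\<dots> \<le> e * \<bar>s - t\<bar>" using s K by (intro mult_right_mono) (auto simp: field_simps)
        finally show "norm ((g (Z s))\<^sup>2 - (g (Z t))\<^sup>2 - 0) \<le> e * norm (s - t)" using True by (simp add: g_zero)
      qed
    qed
  next
    case False
    have "((\<lambda>t. g (Z t)) has_derivative (\<lambda>h. 0)) (at t within {a..b})"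
      unfolding has_derivative_within_alt
    proof (intro conjI bounded_linear_zero allI impI)
      fix e0 :: real assume e0: "e0 > 0"
      define e where "e = e0 / (2 * polar_radius)"
      have e: "e > 0" "2 * e * polar_radius = e0" using e0 polar_radius by (auto simp: e_def)
      obtain d1 where d1: "d1 > 0" "\<And>x' u. norm (x' - Z t) < d1 \<Longrightarrow> u \<in> C \<Longrightarrow> omega_st x' u = g x' \<Longrightarrow> norm (u - dual_vector (Z t)) < e"
        using maximisers_near[OF False e(1)] by blast
      obtain d2 where d2: "d2 > 0" "\<And>s. s \<in> {a..b} \<Longrightarrow> norm (s - t) < d2 \<Longrightarrow>
          norm (Z s - Z t - (s - t) *\<^sub>R dual_vector (Z t)) \<le> e * norm (s - t)"
        using der[OF t False] e(1) unfolding has_vector_derivative_def has_derivative_within_alt by blast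
      show "\<exists>d>0. \<forall>s\<in>{a..b}. norm (s - t) < d \<longrightarrow> norm (g (Z s) - g (Z t) - 0) \<le> e0 * norm (s - t)"
      proof (intro exI conjI ballI impI)
        show "min d2 (d1 / polar_radius) > 0" using d1 d2 polar_radius by simp
        fix s assume s: "s \<in> {a..b}" and st: "norm (s - t) < min d2 (d1 / polar_radius)"
        have "polar_radius * \<bar>s - t\<bar> < d1" using st polar_radius by (simp add: field_simps)
        then have "norm (Z s - Z t) < d1" using lip[OF s t] by simp
        then have Us: "norm (dual_vector (Z s) - dual_vector (Z t)) < e" using d1 dual_vector by blast
        define D where "D = Z s - Z t - (s - t) *\<^sub>R dual_vector (Z t)"
        have D: "norm D \<le> e * \<bar>s - t\<bar>" using d2 s st by (auto simp: D_def)
        have oD: "omega_st D (dual_vector (Z t)) = omega_st (Z s - Z t) (dual_vector (Z t))"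
          by (simp add: D_def omega.diff_left omega.scaleR_left)
        have DR: "\<bar>omega_st D (dual_vector (Z t))\<bar> \<le> e * \<bar>s - t\<bar> * polar_radius"
          using abs_omega_le[of D "dual_vector (Z t)"] mult_mono[OF D norm_dual_vector[of "Z t"]] e by simp
        have "g (Z s) - g (Z t) \<ge> omega_st D (dual_vector (Z t))"
          using g_upper[OF dual_vector(1)[of "Z t"], of "Z s"] dual_vector(2)[of "Z t"] by (simp add: oD omega.diff_left)
        then have lo: "g (Z s) - g (Z t) \<ge> - (e * \<bar>s - t\<bar> * polar_radius)" using DR by linarith
        have "g (Z s) - g (Z t) \<le> omega_st (Z s - Z t) (dual_vector (Z s))"
          using g_upper[OF dual_vector(1)[of "Z s"], of "Z t"] dual_vector(2)[of "Z s"] by (simp add: omega.diff_left)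
        also have "\<dots> = omega_st (Z s - Z t) (dual_vector (Z s) - dual_vector (Z t)) + omega_st D (dual_vector (Z t))"
          by (simp add: oD omega.diff_right)
        also have "omega_st (Z s - Z t) (dual_vector (Z s) - dual_vector (Z t)) \<le> (polar_radius * \<bar>s - t\<bar>) * e"
          using abs_omega_le[of "Z s - Z t" "dual_vector (Z s) - dual_vector (Z t)"]
            mult_mono[OF lip[OF s t] less_imp_le[OF Us]] polar_radius by simp
        finally have hi: "g (Z s) - g (Z t) \<le> 2 * e * polar_radius * \<bar>s - t\<bar>" using DR by (simp add: algebra_simps)
        have "e * \<bar>s - t\<bar> * polar_radius \<le> 2 * e * polar_radius * \<bar>s - t\<bar>" using e(1) polar_radius(1) by simp
        with lo hi show "norm (g (Z s) - g (Z t) - 0) \<le> e0 * norm (s - t)" using e(2) by (simp add: abs_le_iff)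
      qed
    qed
    from has_derivative_power[OF this, of 2] show ?thesis by simp
  qed
  then have "\<exists>k. \<forall>t\<in>{a..b}. (g (Z t))\<^sup>2 = k"
    by (intro has_derivative_zero_constant) auto
  then have "(g (Z c))\<^sup>2 = (g (Z d))\<^sup>2" using cd by force
  then show ?thesis using g_nonneg by simp
qed

end

section \<open>The limit of the extremal polygons\<close>

context origin_body
begin

text \<open>The mean value theorem for each of the functions \<open>\<omega>(x, w t)\<close>.\<close>

lemma increment_in_polar:
  fixes w :: "real \<Rightarrow> 'n phase_space"
  assumes w: "\<And>q. q \<in> {s..t} \<Longrightarrow> (w has_vector_derivative w' q) (at q within {s..t})"
    and w': "\<And>q. q \<in> {s..t} \<Longrightarrow> w' q \<in> C" and st: "s < t"
  shows "(1 / (t - s)) *\<^sub>R (w t - w s) \<in> C"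
  unfolding omega_polar_def
proof (clarify)
  fix x assume x: "x \<in> S"
  have "((\<lambda>t. omega_st x (w t)) has_derivative (\<lambda>h. h * omega_st x (w' q))) (at q within {s..t})"
    if "q \<in> {s..t}" for q
    using omega.bounded_linear_right[of x, THEN bounded_linear.has_vector_derivative, OF w[OF that]]
    by (simp add: has_vector_derivative_def)
  then obtain q where q: "q \<in> {s<..<t}" "omega_st x (w t) - omega_st x (w s) = (t - s) * omega_st x (w' q)"
    using mvt_simple[OF st, of "\<lambda>t. omega_st x (w t)" "\<lambda>q h. h * omega_st x (w' q)"] by auto
  have "omega_st x (w' q) \<le> 1" using q w' x C_le by auto
  then have "omega_st x (w t) - omega_st x (w s) \<le> t - s"
    unfolding q(2) using st by (simp add: mult_left_le)
  then show "omega_st x ((1 / (t - s)) *\<^sub>R (w t - w s)) \<le> 1"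
    using st by (simp add: omega.scaleR_right omega.diff_right)
qed

text \<open>Inscribed polygons have edges in \<open>C\<close> by the mean value theorem, and their areas converge to that
  of the loop by uniform continuity of the velocity.\<close>

lemma loop_le_max_area:
  fixes w :: "real \<Rightarrow> 'n phase_space"
  assumes w: "\<And>t. t \<in> {0..1} \<Longrightarrow> (w has_vector_derivative w' t) (at t within {0..1})"
    and closed: "w 0 = w 1" and cont: "continuous_on {0..1} w'"
    and w': "\<And>t. t \<in> {0..1} \<Longrightarrow> w' t \<in> C"
    and a: "\<And>t. t \<in> {0..1} \<Longrightarrow> a \<le> omega_st (w t) (w' t)"
    and e: "e > 0"
  shows "\<forall>\<^sub>F N in sequentially. a - e \<le> max_area N / (real N)\<^sup>2"
proof -
  have "continuous_on {0..1} w"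
    using w has_vector_derivative_continuous continuous_on_eq_continuous_within by blast
  then have "bounded (w ` {0..1})" by (intro compact_imp_bounded compact_continuous_image) auto
  then obtain B where B: "B > 0" "\<And>t. t \<in> {0..1} \<Longrightarrow> norm (w t) \<le> B"
    unfolding bounded_pos by auto
  have "uniformly_continuous_on {0..1} w'" using cont by (intro compact_uniformly_continuous) auto
  then obtain d where d: "d > 0" "\<And>s t. s \<in> {0..1} \<Longrightarrow> t \<in> {0..1} \<Longrightarrow> norm (t - s) < d \<Longrightarrow> norm (w' t - w' s) < e / B"
    unfolding uniformly_continuous_on_def dist_norm using e B by (metis divide_pos_pos)
  obtain N0 :: nat where N0: "1 / d < real N0" using reals_Archimedean2 by blast
  have "a - e \<le> max_area N / (real N)\<^sup>2" if N: "N \<ge> Suc N0" for N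
  proof -
    have Npos: "N > 0" and Nd: "1 / real N < d"
    proof -
      show "N > 0" using N by simp
      have "1 / d < real N" using N0 N by linarith
      then show "1 / real N < d" using d N by (simp add: field_simps)
    qed
    define p where "p j = real j / real N" for j
    have p: "p j \<in> {0..1}" if "j \<le> N" for j using that Npos by (simp add: p_def)
    have pS: "p (Suc j) - p j = 1 / real N" for j by (simp add: p_def add_divide_distrib)
    define u where "u j = (if j < N then real N *\<^sub>R (w (p (Suc j)) - w (p j)) else 0)" for j
    have psum: "(\<Sum>i<j. u i) = real N *\<^sub>R (w (p j) - w 0)" if "j \<le> N" for j
      using that
    proof (induction j)
      case 0 then show ?case by (simp add: p_def)
    next
      case (Suc j) then show ?case by (simp add: u_def algebra_simps)
    qed
    have uC: "u j \<in> C" for j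
    proof (cases "j < N")
      case True
      have lt: "p j < p (Suc j)" using pS[of j] Npos by (smt (verit) divide_pos_pos of_nat_0_less_iff)
      have sub: "{p j..p (Suc j)} \<subseteq> {0..1}" using p[of j] p[of "Suc j"] True by auto
      have "(1 / (p (Suc j) - p j)) *\<^sub>R (w (p (Suc j)) - w (p j)) \<in> C"
      proof (rule increment_in_polar[where w' = w'])
        fix t assume "t \<in> {p j..p (Suc j)}"
        then show "(w has_vector_derivative w' t) (at t within {p j..p (Suc j)})" "w' t \<in> C"
          using w[of t] w'[of t] sub has_vector_derivative_within_subset by blast+
      qed (rule lt)
      then show ?thesis using True by (simp add: u_def pS)
    qed (simp add: u_def zero_C)
    have pN: "w (p N) = w 0" using Npos closed by (simp add: p_def)
    have "(\<Sum>i<N. u i) = 0" using psum[of N] pN by simp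
    then have u: "u \<in> closed_steps N" using uC by (simp add: closed_steps_def)
    have est: "a - e \<le> omega_st (w (p j)) (u j)" if j: "j < N" for j
    proof -
      have pj: "p j \<in> {0..1}" "p (Suc j) \<in> {0..1}" "p j \<le> p (Suc j)"
        using p[of j] p[of "Suc j"] j pS[of j] Npos by (auto simp: p_def divide_right_mono)
      have "norm (w (p (Suc j)) - w (p j) - (p (Suc j) - p j) *\<^sub>R w' (p j)) \<le> norm (p (Suc j) - p j) * (e / B)"
      proof (rule vector_differentiable_bound_linearization)
        fix x assume x: "x \<in> {p j..p (Suc j)}"
        then have x01: "x \<in> {0..1}" using pj by auto
        show "(w has_vector_derivative w' x) (at x within {p j..p (Suc j)})"
          using has_vector_derivative_within_subset[OF w[OF x01]] pj by auto
        have "norm (x - p j) < d" using x pS[of j] Nd by auto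
        then show "norm (w' x - w' (p j)) \<le> e / B" using d(2)[OF pj(1) x01] by simp
      qed (use pj in \<open>auto simp: closed_segment_eq_real_ivl\<close>)
      then have "norm ((1 / real N) *\<^sub>R (u j - w' (p j))) \<le> (1 / real N) * (e / B)"
        using j Npos by (simp add: u_def pS scaleR_diff_right)
      then have "norm (u j - w' (p j)) \<le> e / B"
        unfolding norm_scaleR using Npos mult_le_cancel_left_pos[of "1 / real N" "norm (u j - w' (p j))" "e / B"]
        by (simp del: divide_divide_eq_left)
      then have "norm (w (p j)) * norm (u j - w' (p j)) \<le> B * (e / B)"
        using B pj e by (intro mult_mono) auto
      then have "\<bar>omega_st (w (p j)) (u j - w' (p j))\<bar> \<le> e"
        using abs_omega_le[of "w (p j)" "u j - w' (p j)"] B by simp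
      then show ?thesis using a[OF pj(1)] by (simp add: omega.diff_right)
    qed
    have "real N * (a - e) = (\<Sum>j<N. a - e)" by simp
    also have "\<dots> \<le> (\<Sum>j<N. omega_st (w (p j)) (u j))" by (intro sum_mono est) auto
    finally have 1: "real N * (a - e) \<le> (\<Sum>j<N. omega_st (w (p j)) (u j))" .
    have "area_form N u = (\<Sum>j<N. omega_st (real N *\<^sub>R (w (p j) - w 0)) (u j))"
      unfolding area_form_def by (intro sum.cong) (auto simp: psum)
    also have "\<dots> = real N * (\<Sum>j<N. omega_st (w (p j)) (u j)) - real N * omega_st (w 0) (\<Sum>j<N. u j)"
      by (simp add: omega.scaleR_left omega.diff_left sum_subtractf sum_distrib_left[symmetric] omega.sum_right right_diff_distrib)
    also have "\<dots> = real N * (\<Sum>j<N. omega_st (w (p j)) (u j))" using \<open>(\<Sum>i<N. u i) = 0\<close> by (simp add: omega.zero_right)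
    finally have "area_form N u \<ge> real N * (real N * (a - e))"
      using 1 Npos by simp
    then have "max_area N \<ge> (a - e) * (real N)\<^sup>2" using max_area_upper[OF u] by (simp add: power2_eq_square mult_ac)
    then show ?thesis using Npos by (simp add: field_simps)
  qed
  then show ?thesis unfolding eventually_sequentially by blast
qed

end

context regular_body
begin

text \<open>Interpolating the extremal polygons gives Lipschitz loops with a common constant, so a subsequence
  converges uniformly. Near a time at which the limit is not zero, all edges are maximisers at
  nearby points and hence close to the maximiser at the limit point; this gives the differential
  equation there. The gauge of the limit is then constant, and positive because the areas
  are bounded below; so the limit vanishes nowhere.\<close>

lemma extremal_limit:
  obtains Z :: "real \<Rightarrow> 'n phase_space" and \<rho> and r :: "nat \<Rightarrow> nat"
  where "strict_mono r" "\<rho> > 0"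
    "area_limit r \<rho>"
    "Z 0 = Z 1" "\<And>t. t \<in> {0..1} \<Longrightarrow> g (Z t) = \<rho>"
    "\<And>t. t \<in> {0..1} \<Longrightarrow> (Z has_vector_derivative dual_vector (Z t)) (at t within {0..1})"
proof -
  define n where "n k = 4 * Suc k" for k :: nat
  have npos: "n k > 0" for k by (simp add: n_def)
  have "\<exists>u b. u \<in> closed_steps (n k) \<and> (\<forall>v\<in>closed_steps (n k). area_form (n k) v \<le> area_form (n k) u) \<and>
      (\<forall>j<n k. g (midpoint_sum u j - b) = omega_st (midpoint_sum u j - b) (u j)) \<and>
      (\<Sum>j<n k. g (midpoint_sum u j - b)) = area_form (n k) u" for k
    using extremal_polygon[OF npos] by metis
  then obtain u b where
    u: "\<And>k. u k \<in> closed_steps (n k)"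
    and max: "\<And>k v. v \<in> closed_steps (n k) \<Longrightarrow> area_form (n k) v \<le> area_form (n k) (u k)"
    and ext: "\<And>k j. j < n k \<Longrightarrow> g (midpoint_sum (u k) j - b k) = omega_st (midpoint_sum (u k) j - b k) (u k j)"
    and tot: "\<And>k. (\<Sum>j<n k. g (midpoint_sum (u k) j - b k)) = area_form (n k) (u k)"
    by metis
  have uC: "u k i \<in> C" and usum: "(\<Sum>i<n k. u k i) = 0" for k i using u[of k] by (auto simp: closed_steps_def)
  define z where "z k = polygon (n k) (u k) (b k)" for k
  define m where "m k j = (real j + 1/2) / real (n k)" for k j :: nat
  define M where "M k = max_area (n k) / (real (n k))\<^sup>2" for k
  have m01: "m k j \<in> {0..1}" if "j < n k" for k j using that npos[of k] by (simp add: m_def)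
  have zm: "z k (m k j) = (1 / real (n k)) *\<^sub>R (midpoint_sum (u k) j - b k)" if "j < n k" for k j
    unfolding z_def m_def using polygon_midpoint[OF that] .
  have ext': "g (z k (m k j)) = omega_st (z k (m k j)) (u k j)" if "j < n k" for k j
    using ext[OF that] by (simp add: zm[OF that] g_scale omega.scaleR_left)
  have M_avg: "M k = (1 / real (n k)) * (\<Sum>j<n k. g (z k (m k j)))" for k
  proof -
    have "(\<Sum>j<n k. g (z k (m k j))) = (\<Sum>j<n k. (1 / real (n k)) * g (midpoint_sum (u k) j - b k))"
      by (intro sum.cong) (auto simp: zm g_scale)
    also have "\<dots> = (1 / real (n k)) * max_area (n k)"
      unfolding sum_distrib_left[symmetric] tot using max_area_eqI[OF u max] by simp
    finally show ?thesis by (simp add: M_def power2_eq_square)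
  qed
  have lip: "norm (z k t - z k s) \<le> polar_radius * (t - s)" if "0 \<le> s" "s \<le> t" "t \<le> 1" for k s t
    using polygon_increment[OF that npos, of k "u k" 0 polar_radius "b k"] uC polar_radius by (simp add: z_def)
  have lip': "norm (z k t - z k s) \<le> polar_radius * \<bar>t - s\<bar>" if "s \<in> {0..1}" "t \<in> {0..1}" for k s t
    using lip[of s t k] lip[of t s k] that by (cases "s \<le> t") (auto simp: norm_minus_commute)
  obtain c where c: "c > 0" "\<And>x. c * norm x \<le> g x" using g_ge_norm by blast
  have M_le: "M k \<le> polar_radius\<^sup>2" for k
    using area_form_le[OF u, of k] max_area_eqI[OF u max, of k] npos[of k]
    by (simp add: M_def divide_le_eq mult.commute)
  \<comment> \<open>The average of the gauges is bounded, and a loop of bounded length that is somewhere near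
    the origin is bounded; this controls the multipliers.\<close>
  define B where "B = polar_radius\<^sup>2 / c + 2 * polar_radius"
  have z_bound: "norm (z k t) \<le> B" if t: "t \<in> {0..1}" for k t
  proof -
    have "c * (norm (z k t) - polar_radius) \<le> g (z k (m k j))" if j: "j < n k" for j
    proof -
      have "norm (z k t) - norm (z k (m k j)) \<le> norm (z k t - z k (m k j))" by (rule norm_triangle_ineq2)
      also have "\<dots> \<le> polar_radius * \<bar>t - m k j\<bar>" by (rule lip'[OF m01[OF j] t])
      also have "\<dots> \<le> polar_radius * 1" using t m01[OF j] polar_radius by (intro mult_left_mono) auto
      finally have "c * (norm (z k t) - polar_radius) \<le> c * norm (z k (m k j))" using c by simp
      then show ?thesis using c(2)[of "z k (m k j)"] by linarith
    qed
    then have "(\<Sum>j<n k. c * (norm (z k t) - polar_radius)) \<le> (\<Sum>j<n k. g (z k (m k j)))" by (intro sum_mono) auto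
    then have "c * (norm (z k t) - polar_radius) \<le> M k" unfolding M_avg using npos[of k] by (simp add: field_simps)
    then have "c * (norm (z k t) - polar_radius) \<le> polar_radius\<^sup>2" using M_le[of k] by linarith
    then have "norm (z k t) \<le> polar_radius\<^sup>2 / c + polar_radius" using c by (simp add: field_simps)
    then show ?thesis using polar_radius(1) by (simp add: B_def)
  qed
  have equi: "\<exists>d. 0 < d \<and> (\<forall>k s. s \<in> {0..1} \<and> norm (t - s) < d \<longrightarrow> norm (z k t - z k s) < e)"
    if "t \<in> {0..1}" "0 < e" for t e
  proof (intro exI conjI allI impI)
    show "0 < e / polar_radius" using that polar_radius by simp
    fix k s assume s: "s \<in> {0..1} \<and> norm (t - s) < e / polar_radius"
    then have "polar_radius * \<bar>t - s\<bar> < e" using polar_radius by (simp add: field_simps)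
    then show "norm (z k t - z k s) < e" using lip'[of s t k] s that by simp
  qed
  obtain Z r where Zc: "continuous_on {0..1} Z" and r: "strict_mono (r :: nat \<Rightarrow> nat)"
    and conv: "\<And>e. 0 < e \<Longrightarrow> \<exists>N. \<forall>k t. k \<ge> N \<and> t \<in> {0..1} \<longrightarrow> norm (z (r k) t - Z t) < e"
    using Arzela_Ascoli[of "{0..1::real}" z B] z_bound equi by (metis compact_Icc)
  have ptw: "(\<lambda>k. z (r k) t) \<longlonglongrightarrow> Z t" if "t \<in> {0..1}" for t
    unfolding LIMSEQ_iff using conv that by blast
  have Zlip: "norm (Z s - Z t) \<le> polar_radius * \<bar>s - t\<bar>" if "s \<in> {0..1}" "t \<in> {0..1}" for s t
  proof (rule tendsto_upperbound)
    show "(\<lambda>k. norm (z (r k) s - z (r k) t)) \<longlonglongrightarrow> norm (Z s - Z t)"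
      by (intro tendsto_intros ptw that)
  qed (use lip' that in auto)
  have Zder: "(Z has_vector_derivative dual_vector (Z t)) (at t within {0..1})" if t: "t \<in> {0..1}" and nz: "Z t \<noteq> 0" for t
    unfolding has_vector_derivative_def has_derivative_within_alt
  proof (intro conjI bounded_linear_scaleR_left allI impI)
    fix e :: real assume e: "e > 0"
    obtain d where d: "d > 0" "\<And>x' v. norm (x' - Z t) < d \<Longrightarrow> v \<in> C \<Longrightarrow> omega_st x' v = g x' \<Longrightarrow> norm (v - dual_vector (Z t)) < e"
      using maximisers_near[OF nz e] by blast
    obtain N1 where N1: "\<And>k s. k \<ge> N1 \<Longrightarrow> s \<in> {0..1} \<Longrightarrow> norm (z (r k) s - Z s) < d / 2"
      using conv[OF half_gt_zero[OF d(1)]] by blast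
    define \<eta> where "\<eta> = d / (2 * polar_radius)"
    have \<eta>: "\<eta> > 0" using d polar_radius by (simp add: \<eta>_def)
    obtain N2 :: nat where N2: "1 / \<eta> < real N2" using reals_Archimedean2 by blast
    \<comment> \<open>All edges that are traversed between the times \<open>x\<close> and \<open>y\<close> have their midpoints close to \<open>Z t\<close>.\<close>
    have key: "norm (z (r k) y - z (r k) x - (y - x) *\<^sub>R dual_vector (Z t)) \<le> e * (y - x)"
      if k: "k \<ge> N1" "k \<ge> N2" and xy: "0 \<le> x" "x \<le> y" "y \<le> 1" "t - \<eta>/2 < x" "y < t + \<eta>/2" for k x y
      unfolding z_def
    proof (rule polygon_increment[OF xy(1-3) npos])
      fix i assume i: "i < n (r k)" "real i < real (n (r k)) * y" "real (n (r k)) * x < real i + 1"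
      define q where "q = m (r k) i"
      have q01: "q \<in> {0..1}" using m01[OF i(1)] by (simp add: q_def)
      have "real N2 \<le> real (n (r k))" using k(2) seq_suble[OF r, of k] by (simp add: n_def)
      then have "1 / \<eta> < real (n (r k))" using N2 by linarith
      then have small: "1 / real (n (r k)) < \<eta>" using \<eta> npos[of "r k"] by (simp add: field_simps)
      define h where "h = 1 / real (n (r k))"
      have qy: "q \<le> y + h / 2" "x - h / 2 \<le> q"
      proof -
        have "real i / real (n (r k)) < y" "x < (real i + 1) / real (n (r k))"
          using i npos[of "r k"] by (simp_all add: divide_less_eq less_divide_eq mult.commute)
        moreover have "q = real i / real (n (r k)) + h / 2"
          by (simp add: q_def m_def h_def add_divide_distrib)
        ultimately show "q \<le> y + h / 2" "x - h / 2 \<le> q"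
          by (simp_all add: add_divide_distrib flip: h_def)
      qed
      have "h < \<eta>" using small by (simp add: h_def)
      then have "\<bar>q - t\<bar> < \<eta>" using qy xy by (auto simp: abs_less_iff)
      then have "polar_radius * \<bar>q - t\<bar> < d / 2" using polar_radius by (simp add: \<eta>_def field_simps)
      then have "norm (Z q - Z t) < d / 2" using Zlip[OF q01 t] by linarith
      moreover have "norm (z (r k) q - Z q) < d / 2" using N1[OF k(1) q01] .
      ultimately have "norm (z (r k) q - Z t) < d"
        using norm_triangle_ineq[of "z (r k) q - Z q" "Z q - Z t"] by simp
      from d(2)[OF this uC] ext'[OF i(1)] show "norm (u (r k) i - dual_vector (Z t)) \<le> e"
        unfolding q_def by (metis less_imp_le)
    qed
    have lim: "norm (Z y - Z x - (y - x) *\<^sub>R dual_vector (Z t)) \<le> e * (y - x)"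
      if xy: "0 \<le> x" "x \<le> y" "y \<le> 1" "t - \<eta>/2 < x" "y < t + \<eta>/2" for x y
    proof (rule tendsto_upperbound)
      show "(\<lambda>k. norm (z (r k) y - z (r k) x - (y - x) *\<^sub>R dual_vector (Z t))) \<longlonglongrightarrow> norm (Z y - Z x - (y - x) *\<^sub>R dual_vector (Z t))"
        using xy by (intro tendsto_intros ptw) auto
      show "\<forall>\<^sub>F k in sequentially. norm (z (r k) y - z (r k) x - (y - x) *\<^sub>R dual_vector (Z t)) \<le> e * (y - x)"
        unfolding eventually_sequentially using key[OF _ _ xy] by (intro exI[of _ "max N1 N2"]) auto
    qed simp
    show "\<exists>d>0. \<forall>y\<in>{0..1}. norm (y - t) < d \<longrightarrow> norm (Z y - Z t - (y - t) *\<^sub>R dual_vector (Z t)) \<le> e * norm (y - t)"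
    proof (intro exI conjI ballI impI)
      show "\<eta> / 2 > 0" using \<eta> by simp
      fix y assume y: "y \<in> {0..1}" "norm (y - t) < \<eta> / 2"
      show "norm (Z y - Z t - (y - t) *\<^sub>R dual_vector (Z t)) \<le> e * norm (y - t)"
      proof (cases "t \<le> y")
        case True
        then show ?thesis using lim[of t y] y t \<eta> by auto
      next
        case False
        then have "norm (Z t - Z y - (t - y) *\<^sub>R dual_vector (Z t)) \<le> e * (t - y)" using lim[of y t] y t \<eta> by auto
        moreover have "Z y - Z t - (y - t) *\<^sub>R dual_vector (Z t) = - (Z t - Z y - (t - y) *\<^sub>R dual_vector (Z t))"
          by (simp add: algebra_simps)
        ultimately show ?thesis using False by (simp only: norm_minus_cancel) simp
      qed
    qed
  qed
  define \<rho> where "\<rho> = g (Z 0)"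
  have gZ: "g (Z t) = \<rho>" if "t \<in> {0..1}" for t
    unfolding \<rho>_def by (rule gauge_conserved[OF Zlip Zder]) (use that in auto)
  have M_lim: "(\<lambda>k. M (r k)) \<longlonglongrightarrow> \<rho>"
  proof (rule LIMSEQ_I)
    fix e :: real assume e: "e > 0"
    obtain N where N: "\<And>k t. k \<ge> N \<Longrightarrow> t \<in> {0..1} \<Longrightarrow> norm (z (r k) t - Z t) < e / (2 * polar_radius)"
      using conv[of "e / (2 * polar_radius)"] e polar_radius(1) by (meson divide_pos_pos mult_pos_pos zero_less_numeral)
    have "norm (M (r k) - \<rho>) < e" if k: "k \<ge> N" for k
    proof -
      let ?n = "n (r k)"
      have "\<rho> = (1 / real ?n) * (\<Sum>j<?n. \<rho>)" using npos[of "r k"] by simp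
      then have "M (r k) - \<rho> = (1 / real ?n) * (\<Sum>j<?n. g (z (r k) (m (r k) j)) - \<rho>)"
        unfolding M_avg sum_subtractf right_diff_distrib by simp
      then have "\<bar>M (r k) - \<rho>\<bar> = (1 / real ?n) * \<bar>\<Sum>j<?n. g (z (r k) (m (r k) j)) - \<rho>\<bar>" by (simp add: abs_mult)
      also have "\<bar>\<Sum>j<?n. g (z (r k) (m (r k) j)) - \<rho>\<bar> \<le> (\<Sum>j<?n. e / 2)"
      proof (rule order_trans[OF sum_abs sum_mono])
        fix j assume "j \<in> {..<?n}"
        then have j: "m (r k) j \<in> {0..1}" using m01 by simp
        have "\<bar>g (z (r k) (m (r k) j)) - \<rho>\<bar> \<le> polar_radius * norm (z (r k) (m (r k) j) - Z (m (r k) j))"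
          using g_lipschitz gZ[OF j] by metis
        also have "\<dots> \<le> polar_radius * (e / (2 * polar_radius))" using N[OF k j] polar_radius by (intro mult_left_mono) auto
        finally show "\<bar>g (z (r k) (m (r k) j)) - \<rho>\<bar> \<le> e / 2" using polar_radius by simp
      qed
      finally have "\<bar>M (r k) - \<rho>\<bar> \<le> e / 2" using npos[of "r k"] by (simp add: divide_right_mono)
      then show ?thesis using e by simp
    qed
    then show "\<exists>N. \<forall>k\<ge>N. norm (M (r k) - \<rho>) < e" by blast
  qed
  obtain c' where c': "c' > 0" "\<And>m. m > 0 \<Longrightarrow> c' \<le> max_area (4 * m) / (real (4 * m))\<^sup>2"
    using max_area_bounded_below by blast
  have "c' \<le> \<rho>"
    by (rule tendsto_lowerbound[OF M_lim]) (use c'(2)[OF zero_less_Suc] in \<open>auto simp: M_def n_def\<close>)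
  then have \<rho>: "\<rho> > 0" using c' by simp
  have "Z 0 = Z 1"
  proof (rule LIMSEQ_unique)
    show "(\<lambda>k. z (r k) 0) \<longlonglongrightarrow> Z 0" by (rule ptw) simp
    have "z k 0 = z k 1" for k unfolding z_def by (rule polygon_closed[OF usum])
    then show "(\<lambda>k. z (r k) 0) \<longlonglongrightarrow> Z 1" using ptw[of 1] by simp
  qed
  moreover have "(Z has_vector_derivative dual_vector (Z t)) (at t within {0..1})" if "t \<in> {0..1}" for t
    using Zder[OF that] gZ[OF that] \<rho> g_zero by force
  ultimately show ?thesis using that[OF r \<rho>] M_lim gZ unfolding M_def n_def by blast
qed

end

section \<open>Loops in the product of a body with its polar\<close>

text \<open>Let \<open>m\<close> be the point that halves the length, measured from the starting point \<open>0\<close>. The distances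
  of a vertex from \<open>0\<close> and from \<open>m\<close> add up to at most half the length, so the vertex is within a
  quarter of the length of the middle of \<open>0\<close> and \<open>m\<close>. Midpoints of edges inherit the bound.\<close>

lemma closed_polygon_near_point:
  fixes n :: "'a::real_vector \<Rightarrow> real" and b :: "nat \<Rightarrow> 'a"
  assumes tri: "\<And>x y. n (x + y) \<le> n x + n y" and scale: "\<And>c x. n (c *\<^sub>R x) = \<bar>c\<bar> * n x"
    and closed: "(\<Sum>i<N. b i) = 0"
  obtains c where "\<And>j. j < N \<Longrightarrow> n (midpoint_sum b j - c) \<le> (\<Sum>i<N. n (b i)) / 4"
proof (cases "N = 0")
  case False
  define P where "P j = (\<Sum>i<j. b i)" for j
  define S where "S j = (\<Sum>i<j. n (b i))" for j
  define L where "L = S N"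
  have minus: "n (- x) = n x" for x using scale[of "-1" x] by simp
  have n0: "n 0 = 0" using scale[of 0 0] by simp
  have nonneg: "n x \<ge> 0" for x using tri[of x "- x"] by (simp add: minus n0)
  have n_sum: "n (\<Sum>i\<in>I. b i) \<le> (\<Sum>i\<in>I. n (b i))" if "finite I" for I :: "nat set"
    using that by (induction I) (auto simp: n0 intro: order_trans[OF tri])
  have PP: "n (P j - P i) \<le> S j - S i" if "i \<le> j" for i j
  proof -
    have "P j - P i = (\<Sum>k\<in>{i..<j}. b k)" "S j - S i = (\<Sum>k\<in>{i..<j}. n (b k))"
      using that by (simp_all add: P_def S_def lessThan_atLeast0 sum_diff_nat_ivl)
    then show ?thesis using n_sum by simp
  qed
  \<comment> \<open>The edge on which half of the length is reached, at the fraction \<open>\<theta>\<close> of this edge.\<close>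
  define k where "k = (LEAST k. L / 2 \<le> S (Suc k))"
  have L0: "0 \<le> L" unfolding L_def S_def by (intro sum_nonneg nonneg)
  obtain N' where N': "N = Suc N'" using False not0_implies_Suc by blast
  have ex: "L / 2 \<le> S (Suc N')" using L0 by (simp add: L_def flip: N')
  have k: "L / 2 \<le> S (Suc k)" unfolding k_def by (rule LeastI[where P = "\<lambda>k. L / 2 \<le> S (Suc k)", OF ex])
  have "k \<le> N'" unfolding k_def by (rule Least_le[where P = "\<lambda>k. L / 2 \<le> S (Suc k)", OF ex])
  have k2: "S k \<le> L / 2"
  proof (cases k)
    case 0 then show ?thesis using L0 by (simp add: S_def)
  next
    case (Suc k')
    then have "\<not> L / 2 \<le> S (Suc k')" unfolding k_def by (metis lessI not_less_Least)
    then show ?thesis using Suc by simp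
  qed
  obtain \<theta> where \<theta>: "0 \<le> \<theta>" "\<theta> \<le> 1" "S k + \<theta> * n (b k) = L / 2"
  proof (cases "n (b k) = 0")
    case True
    then have "S k = L / 2" using k k2 by (simp add: S_def)
    then show ?thesis using that[of 0] by simp
  next
    case False
    then have pos: "n (b k) > 0" using nonneg[of "b k"] by simp
    show ?thesis using k k2 pos by (intro that[of "(L / 2 - S k) / n (b k)"]) (auto simp: S_def field_simps)
  qed
  define m where "m = P k + \<theta> *\<^sub>R b k"
  have near: "n (P j - (1/2) *\<^sub>R m) \<le> L / 4" if j: "j \<le> N" for j
  proof -
    have "n (P j) + n (P j - m) \<le> L / 2"
    proof (cases "j \<le> k")
      case True
      have "n (P j) \<le> S j" using PP[of 0 j] by (simp add: P_def S_def)
      moreover have "n (P j - m) \<le> n (P k - P j) + \<theta> * n (b k)"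
        using tri[of "P k - P j" "\<theta> *\<^sub>R b k"] minus[of "P j - m"] \<theta>(1) by (simp add: m_def scale algebra_simps)
      ultimately show ?thesis using PP[OF True] \<theta> by linarith
    next
      case False
      then have j': "Suc k \<le> j" by simp
      have "P N = 0" using closed by (simp add: P_def)
      then have "n (P j) \<le> L - S j" using PP[OF j] minus[of "P j"] by (simp add: L_def)
      moreover have "n (P j - m) \<le> n (P j - P (Suc k)) + (1 - \<theta>) * n (b k)"
        using tri[of "P j - P (Suc k)" "(1 - \<theta>) *\<^sub>R b k"] \<theta>(2) scale[of "1 - \<theta>" "b k"]
        by (simp add: m_def P_def algebra_simps)
      moreover have "n (P j - P (Suc k)) \<le> S j - S (Suc k)" by (rule PP[OF j'])
      ultimately show ?thesis using \<theta>(3) by (simp add: S_def algebra_simps)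
    qed
    moreover have "n (P j - (1/2) *\<^sub>R m) \<le> (1/2) * n (P j) + (1/2) * n (P j - m)"
    proof -
      have "P j - (1/2) *\<^sub>R m = (1/2) *\<^sub>R P j + (1/2) *\<^sub>R (P j - m)"
        by (simp add: scaleR_diff_right flip: scaleR_left_distrib)
      then show ?thesis using tri[of "(1/2) *\<^sub>R P j" "(1/2) *\<^sub>R (P j - m)"] by (simp add: scale)
    qed
    ultimately show ?thesis by simp
  qed
  show ?thesis
  proof (rule that)
    fix j assume j: "j < N"
    have "midpoint_sum b j - (1/2) *\<^sub>R m = (1/2) *\<^sub>R (P j - (1/2) *\<^sub>R m) + (1/2) *\<^sub>R (P (Suc j) - (1/2) *\<^sub>R m)"
    proof -
      have "(1/2) *\<^sub>R x + (1/2) *\<^sub>R x = x" for x :: 'a by (simp flip: scaleR_left_distrib)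
      then show ?thesis by (simp add: midpoint_sum_def P_def scaleR_diff_right scaleR_add_right) (simp add: algebra_simps flip: scaleR_left_distrib)
    qed
    then have "n (midpoint_sum b j - (1/2) *\<^sub>R m) \<le> (1/2) * n (P j - (1/2) *\<^sub>R m) + (1/2) * n (P (Suc j) - (1/2) *\<^sub>R m)"
      using tri[of "(1/2) *\<^sub>R (P j - (1/2) *\<^sub>R m)" "(1/2) *\<^sub>R (P (Suc j) - (1/2) *\<^sub>R m)"] by (simp add: scale)
    then show "n (midpoint_sum b j - (1/2) *\<^sub>R m) \<le> (\<Sum>i<N. n (b i)) / 4"
      using near[of j] near[of "Suc j"] j by (simp add: L_def S_def)
  qed
qed (use that in auto)

text \<open>The discrete form of \<open>\<integral> \<omega>(w, dw) = - 2 \<integral> p dq\<close> for closed loops.\<close>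

lemma area_form_one_sided:
  assumes "(\<Sum>i<N. u i) = 0"
  shows "area_form N u = - 2 * (\<Sum>j<N. midpoint_sum (\<lambda>i. snd (u i)) j \<bullet> fst (u j))"
proof -
  define a where "a i = fst (u i)" for i
  define b where "b i = snd (u i)" for i
  have parts: "(\<Sum>j<n. (\<Sum>i<j. a i) \<bullet> b j) = (\<Sum>i<n. a i) \<bullet> (\<Sum>i<n. b i) - (\<Sum>j<n. ((\<Sum>i<j. b i) + b j) \<bullet> a j)" for n
    by (induction n) (auto simp: algebra_simps inner_commute)
  have "(\<Sum>i<N. a i) = fst (\<Sum>i<N. u i)" unfolding a_def by (simp add: fst_sum)
  then have a0: "(\<Sum>i<N. a i) = 0" using assms by simp
  have "area_form N u = (\<Sum>j<N. (\<Sum>i<j. a i) \<bullet> b j) - (\<Sum>j<N. (\<Sum>i<j. b i) \<bullet> a j)"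
    by (simp add: area_form_def omega_st_inner fst_sum snd_sum a_def b_def sum_subtractf inner_commute)
  also have "\<dots> = - 2 * (\<Sum>j<N. midpoint_sum b j \<bullet> a j)"
    by (simp add: parts a0 midpoint_sum_def inner_add_left sum.distrib sum_distrib_left sum_negf algebra_simps)
  finally show ?thesis by (simp add: a_def b_def[abs_def])
qed

text \<open>Shifting \<open>p\<close> by a constant does not change \<open>\<integral> p dq\<close>. For the constant of
  \<open>closed_polygon_near_point\<close> the integral is at most a quarter of the product of the two lengths,
  and the arithmetic-geometric mean inequality bounds this by the total length.\<close>

lemma area_form_isoperimetric:
  fixes u :: "nat \<Rightarrow> 'n::finite phase_space" and n n' :: "real^'n \<Rightarrow> real"
  assumes tri: "\<And>x y. n (x + y) \<le> n x + n y" and scale: "\<And>c x. n (c *\<^sub>R x) = \<bar>c\<bar> * n x"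
    and dual: "\<And>x y. \<bar>x \<bullet> y\<bar> \<le> n x * n' y" and n'0: "\<And>y. 0 \<le> n' y"
    and closed: "(\<Sum>i<N. u i) = 0"
    and le: "\<And>i. i < N \<Longrightarrow> n (snd (u i)) + n' (fst (u i)) \<le> c"
  shows "area_form N u \<le> (real N * c)\<^sup>2 / 8"
proof -
  define a where "a i = fst (u i)" for i
  define b where "b i = snd (u i)" for i
  define La where "La = (\<Sum>i<N. n' (a i))"
  define Lb where "Lb = (\<Sum>i<N. n (b i))"
  have "(\<Sum>i<N. b i) = snd (\<Sum>i<N. u i)" "(\<Sum>i<N. a i) = fst (\<Sum>i<N. u i)" unfolding a_def b_def by (simp_all add: snd_sum fst_sum)
  then have b0: "(\<Sum>i<N. b i) = 0" and a0: "(\<Sum>i<N. a i) = 0" using closed by simp_all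
  obtain x where x: "\<And>j. j < N \<Longrightarrow> n (midpoint_sum b j - x) \<le> Lb / 4"
    unfolding Lb_def using closed_polygon_near_point[of n b N] tri scale b0 by metis
  have "area_form N u = - 2 * (\<Sum>j<N. midpoint_sum b j \<bullet> a j)"
    using area_form_one_sided[OF closed] by (simp add: a_def b_def[abs_def])
  also have "(\<Sum>j<N. midpoint_sum b j \<bullet> a j) = (\<Sum>j<N. (midpoint_sum b j - x) \<bullet> a j)"
    by (simp add: inner_diff_left sum_subtractf a0 flip: inner_sum_right)
  also have "- 2 * \<dots> \<le> 2 * (\<Sum>j<N. Lb / 4 * n' (a j))"
  proof -
    have "- (\<Sum>j<N. (midpoint_sum b j - x) \<bullet> a j) \<le> (\<Sum>j<N. Lb / 4 * n' (a j))"
      unfolding sum_negf[symmetric]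
    proof (rule sum_mono)
      fix j assume "j \<in> {..<N}"
      then have "n (midpoint_sum b j - x) * n' (a j) \<le> Lb / 4 * n' (a j)"
        using x n'0 by (intro mult_right_mono) auto
      then show "- ((midpoint_sum b j - x) \<bullet> a j) \<le> Lb / 4 * n' (a j)"
        using dual[of "midpoint_sum b j - x" "a j"] by linarith
    qed
    then show ?thesis by simp
  qed
  also have "\<dots> = Lb * La / 2" unfolding La_def sum_distrib_left[symmetric] by simp
  also have "\<dots> \<le> (La + Lb)\<^sup>2 / 8"
    using zero_le_power2[of "La - Lb"] by (simp add: power2_eq_square algebra_simps)
  also have "\<dots> \<le> (real N * c)\<^sup>2 / 8"
  proof -
    have "La + Lb \<le> (\<Sum>i<N. c)" unfolding La_def Lb_def sum.distrib[symmetric]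
      by (rule sum_mono) (use le in \<open>force simp: a_def b_def add.commute\<close>)
    moreover have "0 \<le> n x" for x using tri[of x "- x"] scale[of "-1" x] scale[of 0 0] by simp
    then have "0 \<le> La + Lb" unfolding La_def Lb_def using n'0 by (intro add_nonneg_nonneg sum_nonneg) auto
    ultimately show ?thesis by (intro divide_right_mono power_mono) auto
  qed
  finally show ?thesis .
qed

definition support_fun :: "'a::real_inner set \<Rightarrow> 'a \<Rightarrow> real" where
  "support_fun A x = (SUP a\<in>A. a \<bullet> x)"

lemma
  fixes A :: "'a::euclidean_space set"
  assumes A: "compact A" "A \<noteq> {}"
  shows support_upper: "a \<in> A \<Longrightarrow> a \<bullet> x \<le> support_fun A x"
    and support_attained: "\<exists>a\<in>A. a \<bullet> x = support_fun A x"
    and support_triangle: "support_fun A (x + y) \<le> support_fun A x + support_fun A y"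
proof -
  have att: "\<exists>a\<in>A. \<forall>b\<in>A. b \<bullet> x \<le> a \<bullet> x" for x
    by (intro continuous_attains_sup[OF A] continuous_intros)
  have up: "a \<bullet> x \<le> support_fun A x" if "a \<in> A" for a x
    unfolding support_fun_def using att[of x] that by (intro cSUP_upper) (auto simp: bdd_above_def)
  show "a \<in> A \<Longrightarrow> a \<bullet> x \<le> support_fun A x" by (rule up)
  have att': "\<exists>a\<in>A. a \<bullet> x = support_fun A x" for x
  proof -
    obtain a where a: "a \<in> A" "\<forall>b\<in>A. b \<bullet> x \<le> a \<bullet> x" using att by blast
    then have "support_fun A x \<le> a \<bullet> x" unfolding support_fun_def by (intro cSUP_least) auto
    then show ?thesis using a up[OF a(1), of x] by force
  qed
  then show "\<exists>a\<in>A. a \<bullet> x = support_fun A x" .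
  obtain a where "a \<in> A" "a \<bullet> (x + y) = support_fun A (x + y)" using att' by blast
  then show "support_fun A (x + y) \<le> support_fun A x + support_fun A y"
    using up[of a x] up[of a y] by (simp add: inner_add_right)
qed

lemma support_fun_scale:
  fixes A :: "'a::euclidean_space set"
  assumes A: "compact A" "A \<noteq> {}" "uminus ` A = A"
  shows "support_fun A (c *\<^sub>R x) = \<bar>c\<bar> * support_fun A x"
proof -
  have sym: "- a \<in> A" if "a \<in> A" for a using A(3) that by blast
  have le: "support_fun A (c *\<^sub>R x) \<le> \<bar>c\<bar> * support_fun A x" for c x
  proof -
    obtain a where a: "a \<in> A" "a \<bullet> (c *\<^sub>R x) = support_fun A (c *\<^sub>R x)" using support_attained[OF A(1,2)] by blast
    have "\<bar>a \<bullet> x\<bar> \<le> support_fun A x"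
      using support_upper[OF A(1,2) a(1), of x] support_upper[OF A(1,2) sym[OF a(1)], of x] by simp
    then have "\<bar>c * (a \<bullet> x)\<bar> \<le> \<bar>c\<bar> * support_fun A x" by (simp add: abs_mult mult_left_mono)
    then show ?thesis using a(2) by simp
  qed
  show ?thesis
  proof (cases "c = 0")
    case True
    obtain a where "a \<in> A" "a \<bullet> (0::'a) = support_fun A 0" using support_attained[OF A(1,2)] by blast
    then show ?thesis using True by simp
  next
    case False
    have "\<bar>c\<bar> * support_fun A x \<le> support_fun A (c *\<^sub>R x)"
      using le[of "1/c" "c *\<^sub>R x"] False by (simp add: field_simps)
    then show ?thesis using le[of c x] by simp
  qed
qed

text \<open>The origin is the midpoint of an interior point and its negative.\<close>

lemma symmetric_body_zero_interior:
  assumes "convex_body K" "centrally_symmetric K"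
  shows "0 \<in> interior K"
proof -
  obtain x where x: "x \<in> interior K" using assms by (auto simp: convex_body_def)
  have "uminus ` interior K = interior K"
    using interior_negations[of K] assms by (simp add: centrally_symmetric_def)
  then have "- x \<in> interior K" using x by blast
  moreover have "convex (interior K)" using assms by (simp add: convex_body_def convex_interior)
  ultimately have "(1/2) *\<^sub>R x + (1/2) *\<^sub>R (- x) \<in> interior K" using x by (intro convexD) auto
  then show ?thesis by simp
qed

lemma polar_body_properties:
  fixes K :: "'a::euclidean_space set"
  assumes K: "compact K" "0 \<in> interior K"
  shows "compact (polar_body K)" "convex (polar_body K)" "0 \<in> interior (polar_body K)"
proof -
  have eq: "polar_body K = (\<Inter>q\<in>K. {p. q \<bullet> p \<le> 1})" by (auto simp: polar_body_def inner_commute)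
  show "convex (polar_body K)" unfolding eq by (intro convex_INT convex_halfspace_le)
  have cl: "closed (polar_body K)" unfolding eq by (intro closed_INT ballI closed_halfspace_le)
  obtain r where r: "r > 0" "cball 0 r \<subseteq> K" using K by (auto simp: mem_interior_cball)
  have "norm p \<le> 1 / r" if p: "p \<in> polar_body K" for p
  proof (cases "p = 0")
    case False
    have "(r / norm p) *\<^sub>R p \<in> K" using False r by (intro subsetD[OF r(2)]) simp
    then have "p \<bullet> ((r / norm p) *\<^sub>R p) \<le> 1" using p unfolding polar_body_def by blast
    then have "r * (norm p * norm p / norm p) \<le> 1" using False by (simp add: power2_norm_eq_inner[symmetric] power2_eq_square)
    then show ?thesis using False r by (simp add: field_simps)
  qed (use r in auto)
  then have "bounded (polar_body K)" unfolding bounded_iff by blast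
  then show "compact (polar_body K)" using cl compact_eq_bounded_closed by blast
  obtain B where B: "B > 0" "\<And>x. x \<in> K \<Longrightarrow> norm x \<le> B"
    using K(1) compact_imp_bounded by (meson bounded_pos)
  have "cball 0 (1/B) \<subseteq> polar_body K"
  proof
    fix p :: 'a assume p: "p \<in> cball 0 (1/B)"
    show "p \<in> polar_body K" unfolding polar_body_def
    proof (clarify)
      fix q assume q: "q \<in> K"
      have "p \<bullet> q \<le> norm p * norm q" by (rule norm_cauchy_schwarz)
      also have "\<dots> \<le> (1/B) * B" using p B q by (intro mult_mono) auto
      finally show "p \<bullet> q \<le> 1" using B by simp
    qed
  qed
  then show "0 \<in> interior (polar_body K)" using B by (auto simp: mem_interior_cball intro!: exI[of _ "1/B"])
qed

lemma polar_body_symmetric: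
  fixes K :: "'a::euclidean_space set"
  assumes "uminus ` K = K" shows "uminus ` polar_body K = polar_body K"
proof -
  have sub: "uminus ` polar_body K \<subseteq> polar_body K"
  proof clarify
    fix p assume p: "p \<in> polar_body K"
    have "- p \<bullet> q \<le> 1" if "q \<in> K" for q
    proof -
      have "- q \<in> K" using assms that by blast
      then have "p \<bullet> - q \<le> 1" using p unfolding polar_body_def by blast
      then show ?thesis by simp
    qed
    then show "- p \<in> polar_body K" by (simp add: polar_body_def)
  qed
  then have "uminus ` uminus ` polar_body K \<subseteq> uminus ` polar_body K" by (rule image_mono)
  then show ?thesis using sub by (simp add: image_image)
qed

lemma product_with_polar:
  fixes K :: "(real^'n::finite) set"
  assumes "convex_body K" "centrally_symmetric K"
  shows "compact (K \<times> polar_body K)" "convex (K \<times> polar_body K)" "0 \<in> interior (K \<times> polar_body K)"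
  using assms symmetric_body_zero_interior[OF assms] polar_body_properties[of K]
  by (auto simp: convex_body_def compact_Times convex_Times interior_Times zero_prod_def)

context origin_body
begin

text \<open>Testing an edge on pairs \<open>(q, - p)\<close> in which \<open>q\<close> and \<open>p\<close> attain the two support functions shows that
  the lengths of its components add up to at most \<open>1 / c\<close>.\<close>

lemma area_form_le_of_contains_product:
  assumes K: "convex_body K" "centrally_symmetric K" and c: "c > 0"
    and sub: "\<And>x. x \<in> K \<times> polar_body K \<Longrightarrow> c *\<^sub>R x \<in> S"
    and u: "u \<in> closed_steps N"
  shows "area_form N u \<le> (real N)\<^sup>2 / (8 * c\<^sup>2)"
proof -
  let ?P = "polar_body K"
  have symK: "uminus ` K = K" and cK: "compact K" using K by (auto simp: centrally_symmetric_def convex_body_def)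
  have z: "0 \<in> interior K" by (rule symmetric_body_zero_interior[OF K])
  have neK: "K \<noteq> {}" using z interior_subset by blast
  have cP: "compact ?P" and zP: "0 \<in> interior ?P" using polar_body_properties[OF cK z] by auto
  have neP: "?P \<noteq> {}" using zP interior_subset by blast
  have symP: "uminus ` ?P = ?P" by (rule polar_body_symmetric[OF symK])
  have z0: "0 \<in> K" "0 \<in> ?P" using z zP interior_subset by auto
  have "area_form N u \<le> (real N * (1 / c))\<^sup>2 / 8"
  proof (rule area_form_isoperimetric[where n = "support_fun K" and n' = "support_fun ?P"])
    show "support_fun K (x + y) \<le> support_fun K x + support_fun K y" for x y
      by (rule support_triangle[OF cK neK])
    show "support_fun K (c *\<^sub>R x) = \<bar>c\<bar> * support_fun K x" for c x
      by (rule support_fun_scale[OF cK neK symK])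
    show nn: "0 \<le> support_fun ?P y" for y using support_upper[OF cP neP z0(2), of y] by simp
    have nnK: "0 \<le> support_fun K y" for y using support_upper[OF cK neK z0(1), of y] by simp
    have le: "x \<bullet> y \<le> support_fun K x * support_fun ?P y" for x y
    proof (cases "x = 0")
      case True then show ?thesis using nn[of y] nnK[of 0] by simp
    next
      case False
      obtain r where r: "r > 0" "cball 0 r \<subseteq> K" using z by (auto simp: mem_interior_cball)
      define s where "s = support_fun K x"
      have "(r / norm x) *\<^sub>R x \<in> K" using False r by (intro subsetD[OF r(2)]) simp
      from support_upper[OF cK neK this, of x] have "r * norm x \<le> s"
        using False by (simp add: s_def power2_norm_eq_inner[symmetric] power2_eq_square)
      moreover have "0 < r * norm x" using r False by simp
      ultimately have s0: "s > 0" by linarith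
      have "(1/s) *\<^sub>R x \<in> ?P" unfolding polar_body_def
      proof clarify
        fix q assume "q \<in> K"
        then have "q \<bullet> x \<le> s" using support_upper[OF cK neK, of q x] by (simp add: s_def)
        then show "(1/s) *\<^sub>R x \<bullet> q \<le> 1" using s0 by (simp add: inner_commute)
      qed
      from support_upper[OF cP neP this, of y] show ?thesis using s0 by (simp add: s_def[symmetric] field_simps)
    qed
    show "\<bar>x \<bullet> y\<bar> \<le> support_fun K x * support_fun ?P y" for x y
      using le[of x y] le[of "- x" y] support_fun_scale[OF cK neK symK, of "-1" x] by (simp add: abs_le_iff)
    show "(\<Sum>i<N. u i) = 0" using u by (simp add: closed_steps_def)
    fix i
    have uC: "u i \<in> C" using u by (simp add: closed_steps_def)
    obtain q where q: "q \<in> K" "q \<bullet> snd (u i) = support_fun K (snd (u i))" using support_attained[OF cK neK] by blast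
    obtain p where p: "p \<in> ?P" "p \<bullet> fst (u i) = support_fun ?P (fst (u i))" using support_attained[OF cP neP] by blast
    have "- p \<in> ?P" using p symP by blast
    then have "c *\<^sub>R (q, - p) \<in> S" using q by (intro sub) simp
    from C_le[OF this uC] have "c * (support_fun K (snd (u i)) + support_fun ?P (fst (u i))) \<le> 1"
      using q p by (simp add: omega.scaleR_left omega_st_inner inner_commute algebra_simps)
    then show "support_fun K (snd (u i)) + support_fun ?P (fst (u i)) \<le> 1 / c"
      using c by (simp add: field_simps)
  qed
  then show ?thesis by (simp add: power_divide)
qed

text \<open>A rectangle with sides along dual vectors \<open>q\<close> and \<open>p\<close>, \<open>p \<bullet> q = 1\<close>; it corresponds to the
  orbit that bounces between \<open>q\<close> and \<open>- q\<close>.\<close>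

lemma max_area_ge_of_inside_product:
  assumes K: "convex_body K" "centrally_symmetric K" and d: "d > 0"
    and sub: "\<And>x. x \<in> S \<Longrightarrow> (1 / d) *\<^sub>R x \<in> K \<times> polar_body K" and m: "m > 0"
  shows "1 / (8 * d\<^sup>2) \<le> max_area (4 * m) / (real (4 * m))\<^sup>2"
proof -
  let ?P = "polar_body K"
  have symK: "uminus ` K = K" and cK: "compact K" using K by (auto simp: centrally_symmetric_def convex_body_def)
  have z: "0 \<in> interior K" by (rule symmetric_body_zero_interior[OF K])
  have neK: "K \<noteq> {}" using z interior_subset by blast
  have symP: "uminus ` ?P = ?P" by (rule polar_body_symmetric[OF symK])
  obtain x :: "real^'n" where x: "x \<noteq> 0" using nonzero_Basis SOME_Basis by blast
  define s where "s = support_fun K x"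
  obtain r where r: "r > 0" "cball 0 r \<subseteq> K" using z by (auto simp: mem_interior_cball)
  have "(r / norm x) *\<^sub>R x \<in> K" using x r by (intro subsetD[OF r(2)]) simp
  from support_upper[OF cK neK this, of x] have "r * norm x \<le> s"
    using x by (simp add: s_def power2_norm_eq_inner[symmetric] power2_eq_square)
  moreover have "0 < r * norm x" using r x by simp
  ultimately have s0: "s > 0" by linarith
  obtain q where q: "q \<in> K" "q \<bullet> x = s" using support_attained[OF cK neK] unfolding s_def by blast
  define p where "p = (1/s) *\<^sub>R x"
  have p: "p \<in> ?P" unfolding polar_body_def
  proof clarify
    fix q' assume "q' \<in> K"
    then have "q' \<bullet> x \<le> s" using support_upper[OF cK neK, of q' x] by (simp add: s_def)
    then show "p \<bullet> q' \<le> 1" using s0 by (simp add: p_def inner_commute)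
  qed
  have pq: "q \<bullet> p = 1" using q s0 by (simp add: p_def)
  have "- q \<in> K" "- p \<in> ?P" using q p symK symP by blast+
  have eC: "(y, 0) \<in> C" if "d *\<^sub>R (- y) \<in> K" for y
    unfolding omega_polar_def
  proof clarify
    fix a b assume "(a, b) \<in> S"
    then have b: "(1/d) *\<^sub>R b \<in> ?P" using sub by auto
    have "(1/d) *\<^sub>R b \<bullet> (d *\<^sub>R (- y)) \<le> 1" using b that unfolding polar_body_def by blast
    then show "omega_st (a, b) (y, 0) \<le> 1" using d by (simp add: omega_st_inner inner_commute)
  qed
  have fC: "(0, y) \<in> C" if "d *\<^sub>R y \<in> ?P" for y
    unfolding omega_polar_def
  proof clarify
    fix a b assume "(a, b) \<in> S"
    then have b: "(1/d) *\<^sub>R a \<in> K" using sub by auto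
    have "d *\<^sub>R y \<bullet> ((1/d) *\<^sub>R a) \<le> 1" using b that unfolding polar_body_def by blast
    then show "omega_st (a, b) (0, y) \<le> 1" using d by (simp add: omega_st_inner inner_commute)
  qed
  have "((1/d) *\<^sub>R q, 0) \<in> C" "- ((1/d) *\<^sub>R q, 0) \<in> C" "(0, (1/d) *\<^sub>R p) \<in> C" "- (0, (1/d) *\<^sub>R p) \<in> C"
    using eC[of "(1/d) *\<^sub>R q"] eC[of "- ((1/d) *\<^sub>R q)"] fC[of "(1/d) *\<^sub>R p"] fC[of "- ((1/d) *\<^sub>R p)"]
      q p \<open>- q \<in> K\<close> \<open>- p \<in> ?P\<close> d by simp_all
  from max_area_rectangle[OF this m] show ?thesis
    using pq by (simp add: omega_st_inner power2_eq_square)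
qed

end

section \<open>Calculus of smooth functions and curves\<close>

lemma has_derivative_cong_open:
  assumes "open U" "x \<in> U" "\<And>y. y \<in> U \<Longrightarrow> f y = g y"
  shows "(f has_derivative D) (at x) \<longleftrightarrow> (g has_derivative D) (at x)"
  using has_derivative_transform_within_open[of f D x UNIV U g]
    has_derivative_transform_within_open[of g D x UNIV U f] assms by auto

lemma frechet_derivative_cong_open:
  assumes "open U" "x \<in> U" "\<And>y. y \<in> U \<Longrightarrow> f y = g y"
  shows "frechet_derivative f (at x) = frechet_derivative g (at x)"
  unfolding frechet_derivative_def using has_derivative_cong_open[OF assms] by simp

lemma Ck_on_cong:
  assumes "open U" "\<And>x. x \<in> U \<Longrightarrow> f x = g x" "Ck_on k f U"
  shows "Ck_on k g U"
  using assms(2,3)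
proof (induction k arbitrary: f g)
  case 0
  then show ?case using continuous_on_cong[of U U f g] by simp
next
  case (Suc k)
  have "g differentiable_on U"
    unfolding differentiable_on_eq_differentiable_at[OF assms(1)] differentiable_def
  proof
    fix x assume x: "x \<in> U"
    then obtain D where "(f has_derivative D) (at x)"
      using Suc.prems(2) by (auto simp: differentiable_on_eq_differentiable_at[OF assms(1)] differentiable_def)
    then show "\<exists>D. (g has_derivative D) (at x)"
      using has_derivative_cong_open[OF assms(1) x, of f g] Suc.prems(1) by blast
  qed
  moreover have "Ck_on k (\<lambda>x. frechet_derivative g (at x) i) U" if "i \<in> Basis" for i
  proof (rule Suc.IH[of "\<lambda>x. frechet_derivative f (at x) i"])
    show "frechet_derivative f (at x) i = frechet_derivative g (at x) i" if "x \<in> U" for x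
      using frechet_derivative_cong_open[OF assms(1) that, of f g] Suc.prems(1) by simp
    show "Ck_on k (\<lambda>x. frechet_derivative f (at x) i) U" using Suc.prems(2) that by simp
  qed
  ultimately show ?case by simp
qed

text \<open>Replaces the chosen derivative in the definition by any formula for the derivative.\<close>

lemma Ck_on_SucI:
  assumes U: "open U" and f: "\<And>x. x \<in> U \<Longrightarrow> (f has_derivative f' x) (at x)"
    and "\<And>i. i \<in> Basis \<Longrightarrow> Ck_on k (\<lambda>x. f' x i) U"
  shows "Ck_on (Suc k) f U"
proof -
  have "f differentiable_on U" using f U by (auto simp: differentiable_on_eq_differentiable_at differentiable_def)
  moreover have "Ck_on k (\<lambda>x. frechet_derivative f (at x) i) U" if "i \<in> Basis" for i
    by (rule Ck_on_cong[OF U _ assms(3)[OF that]]) (metis f frechet_derivative_at)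
  ultimately show ?thesis by simp
qed

lemma Ck_on_SucD:
  assumes "open U" "Ck_on (Suc k) f U" "x \<in> U"
  shows "(f has_derivative frechet_derivative f (at x)) (at x)"
  using assms by (auto simp: differentiable_on_eq_differentiable_at frechet_derivative_works)

lemma Ck_on_Suc_imp: "Ck_on (Suc k) f U \<Longrightarrow> Ck_on k f U"
  by (induction k arbitrary: f) (auto intro: differentiable_imp_continuous_on)

lemma Ck_on_subset: "Ck_on k f U \<Longrightarrow> V \<subseteq> U \<Longrightarrow> Ck_on k f V"
  by (induction k arbitrary: f) (auto intro: continuous_on_subset differentiable_on_subset)

lemma Ck_on_local:
  assumes "open U" "\<And>x. x \<in> U \<Longrightarrow> \<exists>V. open V \<and> x \<in> V \<and> Ck_on k f V"
  shows "Ck_on k f U"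
  using assms(2)
proof (induction k arbitrary: f)
  case 0
  have "isCont f x" if "x \<in> U" for x
  proof -
    obtain V where "open V" "x \<in> V" "Ck_on 0 f V" using 0 \<open>x \<in> U\<close> by blast
    then show ?thesis by (simp add: continuous_on_eq_continuous_at)
  qed
  then show ?case using continuous_at_imp_continuous_on by auto
next
  case (Suc k)
  have "f differentiable at x" if "x \<in> U" for x
  proof -
    obtain V where "open V" "x \<in> V" "Ck_on (Suc k) f V" using Suc.prems \<open>x \<in> U\<close> by blast
    then show ?thesis by (simp add: differentiable_on_eq_differentiable_at)
  qed
  then have "f differentiable_on U" using assms(1) by (simp add: differentiable_on_eq_differentiable_at)
  moreover have "Ck_on k (\<lambda>x. frechet_derivative f (at x) i) U" if "i \<in> Basis" for i
  proof (rule Suc.IH)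
    fix x assume "x \<in> U"
    then obtain V where "open V" "x \<in> V" "Ck_on (Suc k) f V" using Suc.prems by blast
    then show "\<exists>V. open V \<and> x \<in> V \<and> Ck_on k (\<lambda>x. frechet_derivative f (at x) i) V"
      using that by auto
  qed
  ultimately show ?case by simp
qed

lemma Ck_on_const: "open U \<Longrightarrow> Ck_on k (\<lambda>x. c) U"
proof (induction k arbitrary: c)
  case (Suc k)
  then show ?case by (intro Ck_on_SucI[where f' = "\<lambda>x h. 0"]) (auto intro!: derivative_eq_intros)
qed auto

lemma Ck_on_bounded_linear:
  assumes L: "bounded_linear L" and U: "open U" and "Ck_on k f U"
  shows "Ck_on k (\<lambda>x. L (f x)) U"
  using assms(3)
proof (induction k arbitrary: f)
  case 0
  then show ?case using bounded_linear.continuous_on[OF L] by simp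
next
  case (Suc k)
  show ?case
  proof (rule Ck_on_SucI[OF U])
    fix x assume "x \<in> U"
    from bounded_linear.has_derivative[OF L Ck_on_SucD[OF U Suc.prems this]]
    show "((\<lambda>x. L (f x)) has_derivative (\<lambda>h. L (frechet_derivative f (at x) h))) (at x)" .
  qed (use Suc in auto)
qed

lemma Ck_on_ident: "open U \<Longrightarrow> Ck_on k (\<lambda>x. x) U"
proof (induction k)
  case (Suc k)
  then show ?case by (intro Ck_on_SucI[where f' = "\<lambda>x h. h"] Ck_on_const) auto
qed auto

lemma Ck_on_add:
  assumes U: "open U" and "Ck_on k f U" "Ck_on k g U"
  shows "Ck_on k (\<lambda>x. f x + g x) U"
  using assms(2,3)
proof (induction k arbitrary: f g)
  case (Suc k)
  show ?case
  proof (rule Ck_on_SucI[OF U])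
    fix x assume "x \<in> U"
    from has_derivative_add[OF Ck_on_SucD[OF U Suc.prems(1) this] Ck_on_SucD[OF U Suc.prems(2) this]]
    show "((\<lambda>x. f x + g x) has_derivative (\<lambda>h. frechet_derivative f (at x) h + frechet_derivative g (at x) h)) (at x)" .
  qed (use Suc in auto)
qed (auto intro: continuous_intros)

lemma Ck_on_sum:
  assumes U: "open U" and "\<And>i. i \<in> I \<Longrightarrow> Ck_on k (f i) U"
  shows "Ck_on k (\<lambda>x. \<Sum>i\<in>I. f i x) U"
  using assms(2) by (induction I rule: infinite_finite_induct) (auto intro!: Ck_on_const Ck_on_add U)

lemma Ck_on_scaleR:
  fixes f :: "'a::euclidean_space \<Rightarrow> real"
  assumes U: "open U" and "Ck_on k f U" "Ck_on k g U"
  shows "Ck_on k (\<lambda>x. f x *\<^sub>R g x) U"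
  using assms(2,3)
proof (induction k arbitrary: f g)
  case (Suc k)
  show ?case
  proof (rule Ck_on_SucI[OF U])
    fix x assume "x \<in> U"
    from has_derivative_scaleR[OF Ck_on_SucD[OF U Suc.prems(1) this] Ck_on_SucD[OF U Suc.prems(2) this]]
    show "((\<lambda>x. f x *\<^sub>R g x) has_derivative
       (\<lambda>h. f x *\<^sub>R frechet_derivative g (at x) h + frechet_derivative f (at x) h *\<^sub>R g x)) (at x)" .
  next
    fix i :: 'a assume "i \<in> Basis"
    then show "Ck_on k (\<lambda>x. f x *\<^sub>R frechet_derivative g (at x) i + frechet_derivative f (at x) i *\<^sub>R g x) U"
      using Suc.prems Ck_on_Suc_imp[OF Suc.prems(1)] Ck_on_Suc_imp[OF Suc.prems(2)]
      by (intro Ck_on_add[OF U] Suc.IH) auto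
  qed
qed (auto intro: continuous_intros)

lemma Ck_on_inverse:
  fixes f :: "'a::euclidean_space \<Rightarrow> real"
  assumes U: "open U" and "Ck_on k f U" and nz: "\<And>x. x \<in> U \<Longrightarrow> f x \<noteq> 0"
  shows "Ck_on k (\<lambda>x. inverse (f x)) U"
  using assms(2)
proof (induction k)
  case 0
  then show ?case using nz by (auto intro!: continuous_intros)
next
  case (Suc k)
  show ?case
  proof (rule Ck_on_SucI[OF U])
    fix x assume x: "x \<in> U"
    show "((\<lambda>x. inverse (f x)) has_derivative
       (\<lambda>h. (- 1) *\<^sub>R (inverse (f x) *\<^sub>R (inverse (f x) *\<^sub>R frechet_derivative f (at x) h)))) (at x)"
      using Deriv.has_derivative_inverse[OF nz[OF x] Ck_on_SucD[OF U Suc.prems x]] by (simp add: mult_ac)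
  next
    fix i :: 'a assume "i \<in> Basis"
    then show "Ck_on k (\<lambda>x. (- 1) *\<^sub>R (inverse (f x) *\<^sub>R (inverse (f x) *\<^sub>R frechet_derivative f (at x) i))) U"
      using Suc.prems Suc.IH[OF Ck_on_Suc_imp[OF Suc.prems]]
      by (intro Ck_on_scaleR Ck_on_const U) auto
  qed
qed

lemma linear_basis_expansion:
  fixes v :: "'a::euclidean_space"
  assumes "linear D"
  shows "D v = (\<Sum>i\<in>Basis. (v \<bullet> i) *\<^sub>R D i)"
proof -
  have "D (\<Sum>i\<in>Basis. (v \<bullet> i) *\<^sub>R i) = (\<Sum>i\<in>Basis. (v \<bullet> i) *\<^sub>R D i)"
    unfolding linear_sum[OF assms] linear_scale[OF assms] ..
  then show ?thesis by (simp only: euclidean_representation)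
qed

lemma Ck_on_compose_curve:
  fixes c :: "real \<Rightarrow> 'a::euclidean_space" and G :: "'a \<Rightarrow> 'b::real_normed_vector"
  assumes I: "open I" and W: "open W" and "c ` I \<subseteq> W" and "Ck_on k c I" "Ck_on k G W"
  shows "Ck_on k (\<lambda>t. G (c t)) I"
  using assms(4,5)
proof (induction k arbitrary: G)
  case 0
  then show ?case using assms(3) by (auto intro: continuous_on_compose2)
next
  case (Suc k)
  show ?case
  proof (rule Ck_on_SucI[OF I])
    fix t assume t: "t \<in> I"
    then have "c t \<in> W" using assms(3) by auto
    from has_derivative_compose[OF Ck_on_SucD[OF I Suc.prems(1) t] Ck_on_SucD[OF W Suc.prems(2) this]]
    show "((\<lambda>t. G (c t)) has_derivative (\<lambda>h. frechet_derivative G (at (c t)) (frechet_derivative c (at t) h))) (at t)" .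
  next
    fix i :: real assume "i \<in> Basis"
    then have i: "i = 1" by simp
    have eq: "frechet_derivative G (at (c t)) (frechet_derivative c (at t) 1) =
        (\<Sum>j\<in>Basis. (frechet_derivative c (at t) 1 \<bullet> j) *\<^sub>R frechet_derivative G (at (c t)) j)"
      if t: "t \<in> I" for t
    proof -
      have "c t \<in> W" using t assms(3) by auto
      then have "linear (frechet_derivative G (at (c t)))"
        using Ck_on_SucD[OF W Suc.prems(2)] has_derivative_linear by blast
      then show ?thesis by (rule linear_basis_expansion)
    qed
    have Ck: "Ck_on k (\<lambda>t. \<Sum>j\<in>Basis. (frechet_derivative c (at t) 1 \<bullet> j) *\<^sub>R frechet_derivative G (at (c t)) j) I"
    proof (intro Ck_on_sum Ck_on_scaleR I)
      fix j :: 'a assume "j \<in> Basis"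
      then show "Ck_on k (\<lambda>t. frechet_derivative G (at (c t)) j) I"
        using Suc.prems(2) by (intro Suc.IH[OF Ck_on_Suc_imp[OF Suc.prems(1)]]) simp
      have "Ck_on k (\<lambda>t. frechet_derivative c (at t) 1) I" using Suc.prems by simp
      then show "Ck_on k (\<lambda>t. frechet_derivative c (at t) 1 \<bullet> j) I"
        using Ck_on_bounded_linear[OF bounded_linear_inner_left I] by blast
    qed
    show "Ck_on k (\<lambda>t. frechet_derivative G (at (c t)) (frechet_derivative c (at t) i)) I"
      unfolding i by (rule Ck_on_cong[OF I eq[symmetric] Ck])
  qed
qed

text \<open>Bootstrapping: if \<open>c\<close> is \<open>k\<close> times continuously differentiable, then so is \<open>c' = F(c)\<close>.\<close>

lemma smooth_on_ode:
  fixes c :: "real \<Rightarrow> 'a::euclidean_space"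
  assumes I: "open I" and W: "open W" and "c ` I \<subseteq> W"
    and der: "\<And>t. t \<in> I \<Longrightarrow> (c has_vector_derivative F (c t)) (at t)" and F: "smooth_on F W"
  shows "smooth_on c I"
  unfolding smooth_on_def
proof
  fix k
  show "Ck_on k c I"
  proof (induction k)
    case 0
    have "continuous_on I c"
      using der has_vector_derivative_continuous by (intro continuous_at_imp_continuous_on) blast
    then show ?case by simp
  next
    case (Suc k)
    show ?case
    proof (rule Ck_on_SucI[OF I])
      show "(c has_derivative (\<lambda>h. h *\<^sub>R F (c t))) (at t)" if "t \<in> I" for t
        using der[OF that] by (simp add: has_vector_derivative_def)
      show "Ck_on k (\<lambda>t. i *\<^sub>R F (c t)) I" if "i \<in> Basis" for i :: real
      proof -
        have "Ck_on k F W" using F unfolding smooth_on_def by blast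
        then show ?thesis using Ck_on_compose_curve[OF I W assms(3) Suc.IH] that by simp
      qed
    qed
  qed
qed

lemma smooth_on_has_derivative:
  assumes "open U" "smooth_on f U" "x \<in> U"
  shows "(f has_derivative frechet_derivative f (at x)) (at x)"
  using Ck_on_SucD[OF assms(1) _ assms(3)] assms(2) unfolding smooth_on_def by blast

lemma smooth_on_directional:
  assumes U: "open U" and h: "smooth_on h U"
  shows "smooth_on (\<lambda>x. frechet_derivative h (at x) v) U"
  unfolding smooth_on_def
proof
  fix k
  have "Ck_on k (\<lambda>x. \<Sum>i\<in>Basis. (v \<bullet> i) *\<^sub>R frechet_derivative h (at x) i) U"
  proof (intro Ck_on_sum Ck_on_scaleR Ck_on_const U)
    fix i :: 'a assume "i \<in> Basis"
    moreover have "Ck_on (Suc k) h U" using h smooth_on_def by blast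
    ultimately show "Ck_on k (\<lambda>x. frechet_derivative h (at x) i) U" by simp
  qed
  then show "Ck_on k (\<lambda>x. frechet_derivative h (at x) v) U"
  proof (rule Ck_on_cong[OF U, rotated])
    fix x assume "x \<in> U"
    then have "linear (frechet_derivative h (at x))"
      using smooth_on_has_derivative[OF U h] has_derivative_linear by blast
    then show "(\<Sum>i\<in>Basis. (v \<bullet> i) *\<^sub>R frechet_derivative h (at x) i) = frechet_derivative h (at x) v"
      by (rule linear_basis_expansion[symmetric])
  qed
qed

lemma smooth_on_continuous_on: "smooth_on f U \<Longrightarrow> continuous_on U f"
  unfolding smooth_on_def by (metis Ck_on.simps(1))

lemma smooth_on_subset: "smooth_on f U \<Longrightarrow> V \<subseteq> U \<Longrightarrow> smooth_on f V"
  unfolding smooth_on_def using Ck_on_subset by blast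

section \<open>Smooth hypersurfaces and their characteristics\<close>

text \<open>The smooth implicit function theorem for curves. The map \<open>\<Phi>\<close> moves points along the gradient \<open>a\<close>
  of \<open>h\<close> at \<open>x\<close> so that the level set goes to its tangent hyperplane; it has the identity as
  derivative at \<open>x\<close>. The curve is the preimage of the line \<open>x + t v\<close> under \<open>\<Phi>\<close>. The inverse function
  theorem provides a differentiable curve; it satisfies a differential equation with smooth right
  hand side \<open>F\<close>, and therefore it is smooth.\<close>

lemma level_set_curve:
  fixes h :: "'a::euclidean_space \<Rightarrow> real"
  assumes W: "open W" "x \<in> W" and h: "smooth_on h W" and hx: "h x = 0"
    and nz: "frechet_derivative h (at x) \<noteq> (\<lambda>_. 0)" and v: "frechet_derivative h (at x) v = 0"
  obtains e c where "e > 0" "smooth_on c {-e<..<e}" "c 0 = x" "(c has_vector_derivative v) (at 0)"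
    "\<And>t. t \<in> {-e<..<e} \<Longrightarrow> c t \<in> W \<and> h (c t) = 0"
proof -
  define D where "D y = frechet_derivative h (at y)" for y
  have Dh: "(h has_derivative D y) (at y)" if "y \<in> W" for y
    unfolding D_def using smooth_on_has_derivative[OF W(1) h that] .
  have lin: "linear (D y)" if "y \<in> W" for y using Dh[OF that] has_derivative_linear by blast
  have Dcont: "continuous_on W (\<lambda>y. D y w)" for w
    unfolding D_def by (rule smooth_on_continuous_on[OF smooth_on_directional[OF W(1) h]])
  define a where "a = (\<Sum>i\<in>Basis. D x i *\<^sub>R i)"
  have Dx: "D x w = a \<bullet> w" for w
  proof -
    have "a \<bullet> w = (\<Sum>i\<in>Basis. (w \<bullet> i) *\<^sub>R D x i)"
      unfolding a_def inner_sum_left by (intro sum.cong) (auto simp: inner_commute)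
    then show ?thesis using linear_basis_expansion[OF lin[OF W(2)], of w] by simp
  qed
  have a0: "a \<bullet> a > 0" using nz by (auto simp: D_def[symmetric] fun_eq_iff Dx)
  have av: "a \<bullet> v = 0" using v by (simp add: D_def[symmetric] Dx)
  define W' where "W' = {y \<in> W. D y a > 0}"
  have W': "open W'" "x \<in> W'" "W' \<subseteq> W"
  proof -
    have "W' = W \<inter> (\<lambda>y. D y a) -` {0<..}" by (auto simp: W'_def)
    then show "open W'" using continuous_open_preimage[OF Dcont W(1), of "{0<..}"] by simp
  qed (use W(2) a0 in \<open>auto simp: W'_def Dx\<close>)
  define \<Phi> where "\<Phi> y = y + ((h y - a \<bullet> (y - x)) / (a \<bullet> a)) *\<^sub>R a" for y
  define \<Phi>' where "\<Phi>' y = Blinfun (\<lambda>w. w + ((D y w - a \<bullet> w) / (a \<bullet> a)) *\<^sub>R a)" for y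
  have bl: "bounded_linear (\<lambda>w. w + ((D y w - a \<bullet> w) / (a \<bullet> a)) *\<^sub>R a)" if "y \<in> W" for y
    by (intro bounded_linear_add bounded_linear_ident bounded_linear_scaleR_const
        bounded_linear_compose[OF bounded_linear_divide] bounded_linear_sub bounded_linear_inner_right
        has_derivative_bounded_linear[OF Dh[OF that]])
  have \<Phi>'_apply: "blinfun_apply (\<Phi>' y) w = w + ((D y w - a \<bullet> w) / (a \<bullet> a)) *\<^sub>R a" if "y \<in> W" for y w
    unfolding \<Phi>'_def using bounded_linear_Blinfun_apply[OF bl[OF that]] by simp
  have 1: "(\<Phi> has_derivative blinfun_apply (\<Phi>' y)) (at y)" if "y \<in> W'" for y
  proof -
    have y: "y \<in> W" using that W' by auto
    have "(\<Phi> has_derivative (\<lambda>w. w + ((D y w - a \<bullet> w) / (a \<bullet> a)) *\<^sub>R a)) (at y)"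
      unfolding \<Phi>_def[abs_def] using a0 by (auto intro!: derivative_eq_intros Dh[OF y])
    moreover have "blinfun_apply (\<Phi>' y) = (\<lambda>w. w + ((D y w - a \<bullet> w) / (a \<bullet> a)) *\<^sub>R a)"
      using \<Phi>'_apply[OF y] by (simp add: fun_eq_iff)
    ultimately show ?thesis by simp
  qed
  have 2: "continuous_on W' \<Phi>'"
  proof (rule continuous_on_blinfun_componentwise)
    fix i :: 'a
    have "continuous_on W' (\<lambda>y. i + ((D y i - a \<bullet> i) / (a \<bullet> a)) *\<^sub>R a)"
      using a0 by (intro continuous_intros continuous_on_subset[OF Dcont W'(3)]) auto
    then show "continuous_on W' (\<lambda>y. blinfun_apply (\<Phi>' y) i)"
      by (rule continuous_on_eq) (use \<Phi>'_apply W'(3) in auto)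
  qed
  have 3: "id_blinfun o\<^sub>L \<Phi>' x = id_blinfun"
    by (rule blinfun_eqI) (simp add: \<Phi>'_apply[OF W(2)] Dx)
  obtain U V G G' where UV: "open U" "U \<subseteq> W'" "x \<in> U" "open V" "\<Phi> x \<in> V" and hom: "homeomorphism U V \<Phi> G"
    and G: "\<And>y. y \<in> V \<Longrightarrow> (G has_derivative (G' y)) (at y)"
    using inverse_function_theorem[OF W'(1) 1 2 W'(2) 3] by metis
  have \<Phi>x: "\<Phi> x = x" by (simp add: \<Phi>_def hx)
  have "open ((\<lambda>t. x + t *\<^sub>R v) -` V)" using UV(4) by (intro continuous_open_vimage continuous_intros)
  moreover have "0 \<in> (\<lambda>t. x + t *\<^sub>R v) -` V" using UV(5) \<Phi>x by simp
  ultimately obtain e where e: "e > 0" "ball 0 e \<subseteq> (\<lambda>t. x + t *\<^sub>R v) -` V"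
    using open_contains_ball by blast
  define c where "c t = G (x + t *\<^sub>R v)" for t
  have inV: "x + t *\<^sub>R v \<in> V" if "t \<in> {-e<..<e}" for t using e(2) that by (auto simp: subset_iff dist_real_def)
  have cU: "c t \<in> U" and \<Phi>c: "\<Phi> (c t) = x + t *\<^sub>R v" if "t \<in> {-e<..<e}" for t
    using hom inV[OF that] by (auto simp: c_def homeomorphism_def)
  have hc: "h (c t) = 0" if t: "t \<in> {-e<..<e}" for t
  proof -
    have "a \<bullet> \<Phi> (c t) = a \<bullet> x + h (c t)" using a0 by (simp add: \<Phi>_def inner_add_right inner_diff_right)
    then show ?thesis using \<Phi>c[OF t] av by (simp add: inner_add_right)
  qed
  define F where "F y = v + (inverse (D y a) * (- D y v)) *\<^sub>R a" for y
  have der: "(c has_vector_derivative F (c t)) (at t)" if t: "t \<in> {-e<..<e}" for t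
  proof -
    have cW: "c t \<in> W" and pos: "D (c t) a > 0" using cU[OF t] UV(2) by (auto simp: W'_def)
    have "(c has_derivative (\<lambda>s. G' (x + t *\<^sub>R v) (s *\<^sub>R v))) (at t)"
      unfolding c_def[abs_def]
    proof (rule has_derivative_compose[where f = "\<lambda>t. x + t *\<^sub>R v" and f' = "\<lambda>s. s *\<^sub>R v"])
      show "((\<lambda>t. x + t *\<^sub>R v) has_derivative (\<lambda>s. s *\<^sub>R v)) (at t)"
        by (auto intro!: derivative_eq_intros)
    qed (rule G[OF inV[OF t]])
    then obtain d where d: "(c has_vector_derivative d) (at t)"
      using differentiable_def vector_derivative_works by blast
    define \<mu> where "\<mu> = a \<bullet> d / (a \<bullet> a)"
    have "((\<lambda>t. c t - x - (a \<bullet> (c t - x) / (a \<bullet> a)) *\<^sub>R a) has_vector_derivative (d - \<mu> *\<^sub>R a)) (at t)"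
      unfolding \<mu>_def has_vector_derivative_def using a0
      by (auto intro!: derivative_eq_intros d[unfolded has_vector_derivative_def] simp: algebra_simps)
    moreover have "((\<lambda>t. c t - x - (a \<bullet> (c t - x) / (a \<bullet> a)) *\<^sub>R a) has_vector_derivative v) (at t)"
    proof (rule has_vector_derivative_transform_within_open)
      show "((\<lambda>t. t *\<^sub>R v) has_vector_derivative v) (at t)"
        by (auto intro!: derivative_eq_intros simp: has_vector_derivative_def)
      fix s assume s: "s \<in> {-e<..<e}"
      define k where "k = a \<bullet> (c s - x) / (a \<bullet> a)"
      have "c s + (- k) *\<^sub>R a = x + s *\<^sub>R v"
        using \<Phi>c[OF s] hc[OF s] by (simp add: \<Phi>_def k_def)
      then show "s *\<^sub>R v = c s - x - (a \<bullet> (c s - x) / (a \<bullet> a)) *\<^sub>R a"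
        unfolding k_def[symmetric] by (simp add: algebra_simps)
    qed (use t in auto)
    \<comment> \<open>Up to a multiple of \<open>a\<close> the curve is the line, so only the coefficient of \<open>a\<close> in its velocity is
      open; it is determined by differentiating \<open>h (c t) = 0\<close>.\<close>
    ultimately have dv: "d = v + \<mu> *\<^sub>R a"
      using vector_derivative_unique_at by (metis diff_add_cancel)
    have "((\<lambda>t. h (c t)) has_derivative (\<lambda>s. D (c t) (s *\<^sub>R d))) (at t)"
      by (rule has_derivative_compose[OF d[unfolded has_vector_derivative_def] Dh[OF cW]])
    moreover have "((\<lambda>t. h (c t)) has_derivative (\<lambda>s. 0)) (at t)"
      by (rule has_derivative_transform_within_open[of "\<lambda>_. 0" _ _ _ "{-e<..<e}"]) (use t hc in auto)
    ultimately have "(\<lambda>s. D (c t) (s *\<^sub>R d)) = (\<lambda>s. 0)" using has_derivative_unique by blast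
    then have "D (c t) (1 *\<^sub>R d) = 0" by meson
    then have "D (c t) v + \<mu> * D (c t) a = 0"
      using lin[OF cW] by (simp add: dv linear_add linear_scale)
    then have "\<mu> = inverse (D (c t) a) * (- D (c t) v)" using pos by (simp add: field_simps)
    then show ?thesis using d dv by (simp add: F_def)
  qed
  have "smooth_on F W'"
    unfolding smooth_on_def F_def[abs_def]
  proof
    fix k
    have sm: "Ck_on k (\<lambda>y. D y w) W'" for w
      using smooth_on_subset[OF smooth_on_directional[OF W(1) h] W'(3)] unfolding D_def smooth_on_def by blast
    have "Ck_on k (\<lambda>y. v + (inverse (D y a) *\<^sub>R ((-1) *\<^sub>R D y v)) *\<^sub>R a) W'"
      by (intro Ck_on_add Ck_on_scaleR Ck_on_inverse Ck_on_const sm W'(1)) (auto simp: W'_def)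
    then show "Ck_on k (\<lambda>y. v + (inverse (D y a) * (- D y v)) *\<^sub>R a) W'" by simp
  qed
  then have "smooth_on c {-e<..<e}"
    using cU UV(2) by (intro smooth_on_ode[OF _ W'(1) _ der]) auto
  moreover have c0: "c 0 = x"
    using hom UV(3) \<Phi>x by (simp add: c_def homeomorphism_def) metis
  moreover have "(c has_vector_derivative v) (at 0)"
    using der[of 0] e c0 av by (simp add: F_def Dx)
  ultimately show ?thesis using that[OF e(1)] cU UV(2) W'(3) hc by blast
qed

lemma tangent_space_level_set:
  fixes h :: "'a::euclidean_space \<Rightarrow> real"
  assumes W: "open W" "x \<in> W" and h: "smooth_on h W" and M: "M \<inter> W = {y \<in> W. h y = 0}" and x: "x \<in> M"
    and nz: "frechet_derivative h (at x) \<noteq> (\<lambda>_. 0)"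
  shows "tangent_space M x = {v. frechet_derivative h (at x) v = 0}"
proof
  have hx: "h x = 0" using W x M by blast
  show "tangent_space M x \<subseteq> {v. frechet_derivative h (at x) v = 0}"
  proof (clarsimp simp: tangent_space_def)
    fix v e and c :: "real \<Rightarrow> 'a"
    assume e: "0 < e" and sub: "c ` {- e<..<e} \<subseteq> M" and x: "x = c 0" and c: "(c has_vector_derivative v) (at 0)"
      and sm: "smooth_on c {- e<..<e}"
    have "continuous_on {-e<..<e} c" by (rule smooth_on_continuous_on[OF sm])
    then have "open ({-e<..<e} \<inter> c -` W)" using W(1) by (intro continuous_open_preimage) auto
    moreover have "0 \<in> {-e<..<e} \<inter> c -` W" using e W x by simp
    moreover have "h (c t) = 0" if "t \<in> {-e<..<e} \<inter> c -` W" for t using that sub M by blast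
    ultimately have "((\<lambda>t. h (c t)) has_derivative (\<lambda>s. 0)) (at 0)"
      by (metis (mono_tags, lifting) has_derivative_transform_within_open[OF has_derivative_const])
    moreover have "((\<lambda>t. h (c t)) has_derivative (\<lambda>s. frechet_derivative h (at (c 0)) (s *\<^sub>R v))) (at 0)"
      using W x by (intro has_derivative_compose[OF c[unfolded has_vector_derivative_def]] smooth_on_has_derivative[OF W(1) h]) auto
    ultimately have "(\<lambda>s. frechet_derivative h (at (c 0)) (s *\<^sub>R v)) = (\<lambda>s. 0)"
      using has_derivative_unique by blast
    then have "frechet_derivative h (at (c 0)) (1 *\<^sub>R v) = 0" by meson
    then show "frechet_derivative h (at (c 0)) v = 0" by simp
  qed
  show "{v. frechet_derivative h (at x) v = 0} \<subseteq> tangent_space M x"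
  proof clarify
    fix v assume "frechet_derivative h (at x) v = 0"
    from level_set_curve[OF W h hx nz this] obtain e c where "e > 0" "smooth_on c {-e<..<e}" "c 0 = x"
      "(c has_vector_derivative v) (at 0)" "\<And>t. t \<in> {-e<..<e} \<Longrightarrow> c t \<in> W \<and> h (c t) = 0" by metis
    moreover from this have "c ` {-e<..<e} \<subseteq> M" using M by blast
    ultimately show "v \<in> tangent_space M x" unfolding tangent_space_def by auto
  qed
qed

text \<open>Along a curve in the boundary the functional \<open>\<omega>(\<cdot>, u)\<close> has a maximum at \<open>x\<close>.\<close>

lemma (in origin_body) dual_on_tangent:
  assumes u: "u \<in> C" "omega_st x u = 1" and v: "v \<in> tangent_space (frontier S) x"
  shows "omega_st v u = 0"
proof -
  obtain e c where e: "e > 0" "c ` {-e<..<e} \<subseteq> frontier S" "c 0 = x" "(c has_vector_derivative v) (at 0)"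
    using v unfolding tangent_space_def by blast
  have "((\<lambda>t. omega_st (c t) u) has_vector_derivative omega_st v u) (at 0)"
    by (rule bounded_linear.has_vector_derivative[OF omega.bounded_linear_left e(4)])
  then have "((\<lambda>t. omega_st (c t) u) has_real_derivative omega_st v u) (at 0)"
    by (simp add: has_real_derivative_iff_has_vector_derivative)
  moreover have "omega_st (c t) u \<le> omega_st (c 0) u" if "\<bar>0 - t\<bar> < e" for t
  proof -
    have "c t \<in> frontier S" using e(2) that by (auto simp: abs_less_iff)
    then have "c t \<in> S" by (simp add: frontier_S S_iff)
    then show ?thesis using C_le u e(3) by simp
  qed
  ultimately show ?thesis using e(1) DERIV_local_max[of _ _ 0 e] by blast
qed

locale smooth_body = origin_body S for S :: "'n::finite phase_space set" +
  assumes smooth_frontier: "smooth_hypersurface (frontier S)"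
begin

text \<open>The functionals \<open>\<omega>(\<cdot>, u)\<close> and the derivative of a local defining function \<open>h\<close> vanish on the same
  hyperplane, the tangent space. So the functional is the derivative divided by its value at the
  point. This determines \<open>u\<close> as a smooth function \<open>F\<close> of the point.\<close>

lemma local_dual:
  assumes x: "g x = 1"
  obtains W F where "open W" "x \<in> W" "smooth_on F W"
    "\<And>y u. y \<in> W \<Longrightarrow> g y = 1 \<Longrightarrow> u \<in> C \<Longrightarrow> omega_st y u = 1 \<Longrightarrow> u = F y"
    "\<And>y u. y \<in> W \<Longrightarrow> g y = 1 \<Longrightarrow> u \<in> C \<Longrightarrow> omega_st y u = 1 \<Longrightarrow> tangent_space (frontier S) y = {v. omega_st v u = 0}"
proof -
  have "x \<in> frontier S" using x by (simp add: frontier_S)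
  then obtain W0 and h :: "'n phase_space \<Rightarrow> real" where W0: "open W0" "x \<in> W0" and h: "smooth_on h W0"
    and nz: "\<And>y. y \<in> W0 \<Longrightarrow> frechet_derivative h (at y) \<noteq> (\<lambda>_. 0)"
    and M: "frontier S \<inter> W0 = {y \<in> W0. h y = 0}"
    using bspec[OF smooth_frontier[unfolded smooth_hypersurface_def] \<open>x \<in> frontier S\<close>]
    by (elim exE conjE) (rule that; simp)
  define D where "D y = frechet_derivative h (at y)" for y
  have lin: "linear (D y)" if "y \<in> W0" for y
    unfolding D_def using smooth_on_has_derivative[OF W0(1) h that] has_derivative_linear by blast
  have T: "tangent_space (frontier S) y = {v. D y v = 0}" if "y \<in> W0" "g y = 1" for y
    unfolding D_def using that by (intro tangent_space_level_set[OF W0(1) _ h M _ nz]) (auto simp: frontier_S)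
  have key: "D y y \<noteq> 0 \<and> (\<forall>z. omega_st z u = D y z / D y y)"
    if y: "y \<in> W0" "g y = 1" and u: "u \<in> C" "omega_st y u = 1" for y u
  proof -
    have ker: "omega_st v u = 0" if "D y v = 0" for v
      using dual_on_tangent[OF u] T[OF y] that by blast
    from ker[of y] have nz: "D y y \<noteq> 0" using u(2) by fastforce
    have "omega_st z u = D y z / D y y" for z
    proof -
      have "D y (z - (D y z / D y y) *\<^sub>R y) = 0" using lin[OF y(1)] nz by (simp add: linear_diff linear_scale)
      from ker[OF this] show ?thesis using u(2) by (simp add: omega.diff_left omega.scaleR_left)
    qed
    then show ?thesis using nz by blast
  qed
  define gr where "gr y = (\<Sum>i\<in>Basis. D y i *\<^sub>R i)" for y
  define F where "F y = inverse (D y y) *\<^sub>R symp_rot (gr y)" for y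
  have om: "omega_st z (symp_rot (gr y)) = D y z" if "y \<in> W0" for y z
    using linear_basis_expansion[OF lin[OF that], of z]
    by (simp add: omega_symp_rot gr_def inner_sum_right mult.commute)
  define W where "W = {y \<in> W0. D y y \<noteq> 0}"
  have Ck: "Ck_on k (\<lambda>y. D y w) W0" for k w
    using smooth_on_directional[OF W0(1) h] unfolding D_def smooth_on_def by blast
  have Ck2: "Ck_on k (\<lambda>y. D y y) W0" for k
  proof (rule Ck_on_cong[OF W0(1)])
    show "Ck_on k (\<lambda>y. \<Sum>i\<in>Basis. (y \<bullet> i) *\<^sub>R D y i) W0"
      using Ck_on_bounded_linear[OF bounded_linear_inner_left W0(1) Ck_on_ident[OF W0(1)]]
      by (intro Ck_on_sum Ck_on_scaleR W0(1) Ck) auto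
  qed (use linear_basis_expansion[OF lin] in simp)
  have W: "open W" "W \<subseteq> W0"
  proof -
    have "continuous_on W0 (\<lambda>y. D y y)" using Ck2[of 0] by simp
    moreover have "W = W0 \<inter> (\<lambda>y. D y y) -` (- {0})" by (auto simp: W_def)
    ultimately show "open W" using continuous_open_preimage[OF _ W0(1), of "\<lambda>y. D y y" "- {0}"] by auto
  qed (auto simp: W_def)
  have "smooth_on F W"
    unfolding smooth_on_def F_def[abs_def] gr_def
  proof
    fix k
    show "Ck_on k (\<lambda>y. inverse (D y y) *\<^sub>R symp_rot (\<Sum>i\<in>Basis. D y i *\<^sub>R i)) W"
      using Ck_on_subset[OF Ck W(2)] Ck_on_subset[OF Ck2 W(2)]
      by (intro Ck_on_scaleR W(1) Ck_on_inverse Ck_on_bounded_linear[OF linear_symp_rot] Ck_on_sum Ck_on_const)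
        (auto simp: W_def)
  qed
  moreover obtain u0 where "u0 \<in> C" "omega_st x u0 = 1" using g_attained[of x] x by auto
  then have "x \<in> W" using key[OF W0(2) x] W0(2) by (simp add: W_def)
  moreover have "u = F y" if "y \<in> W" "g y = 1" "u \<in> C" "omega_st y u = 1" for y u
  proof (rule omega_nondegenerate)
    fix z
    have y: "y \<in> W0" using that W by auto
    have "omega_st z u = D y z / D y y" using key[OF y that(2-)] by blast
    then show "omega_st z u = omega_st z (F y)"
      by (simp add: F_def omega.scaleR_right om[OF y] divide_inverse)
  qed
  moreover have "tangent_space (frontier S) y = {v. omega_st v u = 0}"
    if "y \<in> W" "g y = 1" "u \<in> C" "omega_st y u = 1" for y u
  proof -
    have y: "y \<in> W0" using that W by auto
    show ?thesis using T[OF y that(2)] key[OF y that(2-)] by auto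
  qed
  ultimately show ?thesis using that[OF W(1)] by blast
qed

sublocale regular_body S
proof
  fix x u v assume "g x = 1" "u \<in> C" "v \<in> C" "omega_st x u = 1" "omega_st x v = 1"
  then show "u = v" using local_dual[of x] by metis
qed

lemma tangent_space_eq: "g x = 1 \<Longrightarrow> tangent_space (frontier S) x = {v. omega_st v (dual_vector x) = 0}"
  using local_dual[of x] dual_vector[of x] by metis

text \<open>The tangent space is the symplectic complement of the dual vector, and the double symplectic
  complement of a line is the line itself.\<close>

lemma characteristic_line_eq:
  assumes x: "g x = 1"
  shows "characteristic_line S x = range (\<lambda>k. k *\<^sub>R dual_vector x)"
proof
  have T: "tangent_space (frontier S) x = {v. omega_st v (dual_vector x) = 0}" by (rule tangent_space_eq[OF x])
  have x1: "omega_st x (dual_vector x) = 1" using dual_vector(2) x by simp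
  show "characteristic_line S x \<subseteq> range (\<lambda>k. k *\<^sub>R dual_vector x)"
  proof
    fix \<xi> assume xi: "\<xi> \<in> characteristic_line S x"
    have "\<xi> = omega_st x \<xi> *\<^sub>R dual_vector x"
    proof (rule omega_nondegenerate)
      fix z
      have "z - omega_st z (dual_vector x) *\<^sub>R x \<in> tangent_space (frontier S) x"
        using x1 by (simp add: T omega.diff_left omega.scaleR_left)
      then have "omega_st \<xi> (z - omega_st z (dual_vector x) *\<^sub>R x) = 0" using xi unfolding characteristic_line_def by blast
      then show "omega_st z \<xi> = omega_st z (omega_st x \<xi> *\<^sub>R dual_vector x)"
        using omega_antisym[of z \<xi>] omega_antisym[of x \<xi>]
        by (simp add: omega.diff_right omega.scaleR_right omega.minus_right)
    qed
    then show "\<xi> \<in> range (\<lambda>k. k *\<^sub>R dual_vector x)" by blast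
  qed
  show "range (\<lambda>k. k *\<^sub>R dual_vector x) \<subseteq> characteristic_line S x"
  proof (rule image_subsetI)
    fix k
    show "k *\<^sub>R dual_vector x \<in> characteristic_line S x" unfolding characteristic_line_def T
      using omega_antisym[of "dual_vector x"] by (auto simp: omega.scaleR_left)
  qed
qed

lemma smooth_characteristic:
  assumes g1: "\<And>t. g (\<gamma> t) = 1" and der: "\<And>t. (\<gamma> has_vector_derivative k *\<^sub>R dual_vector (\<gamma> t)) (at t)"
  shows "smooth_on \<gamma> UNIV"
  unfolding smooth_on_def
proof (intro allI Ck_on_local open_UNIV)
  fix m t0
  obtain W F where W: "open W" "\<gamma> t0 \<in> W" "smooth_on F W"
    and F: "\<And>y u. y \<in> W \<Longrightarrow> g y = 1 \<Longrightarrow> u \<in> C \<Longrightarrow> omega_st y u = 1 \<Longrightarrow> u = F y"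
    using local_dual[OF g1[of t0]] by metis
  have "continuous_on UNIV \<gamma>"
    using der has_vector_derivative_continuous by (intro continuous_at_imp_continuous_on) blast
  then have op: "open (\<gamma> -` W)" using W(1) open_vimage by blast
  have "smooth_on \<gamma> (\<gamma> -` W)"
  proof (rule smooth_on_ode[OF op W(1)])
    show "(\<gamma> has_vector_derivative k *\<^sub>R F (\<gamma> t)) (at t)" if "t \<in> \<gamma> -` W" for t
      using der[of t] F[of "\<gamma> t" "dual_vector (\<gamma> t)"] that dual_vector g1 by simp
    show "smooth_on (\<lambda>y. k *\<^sub>R F y) W" unfolding smooth_on_def
    proof
      fix j
      have "Ck_on j F W" using W(3) unfolding smooth_on_def by blast
      then show "Ck_on j (\<lambda>y. k *\<^sub>R F y) W" by (rule Ck_on_bounded_linear[OF bounded_linear_scaleR_right W(1)])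
    qed
  qed auto
  then have "Ck_on m \<gamma> (\<gamma> -` W)" unfolding smooth_on_def by blast
  then show "\<exists>V. open V \<and> t0 \<in> V \<and> Ck_on m \<gamma> V" using op W(2) by blast
qed

end

section \<open>The capacity of a smooth convex body\<close>

text \<open>At integers the one-sided derivatives agree, because \<open>d 0 = d 1\<close>.\<close>

lemma periodic_extension_has_vector_derivative:
  fixes Z :: "real \<Rightarrow> 'a::real_normed_vector"
  assumes Z: "\<And>t. t \<in> {0..1} \<Longrightarrow> (Z has_vector_derivative d t) (at t within {0..1})"
    and closed: "Z 0 = Z 1" "d 0 = d 1"
  shows "((\<lambda>t. Z (frac t)) has_vector_derivative d (frac t)) (at t)"
proof -
  have on_cell: "((\<lambda>t. Z (frac t)) has_vector_derivative d (t - of_int n)) (at t within {of_int n..of_int n + 1})"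
    if t: "t \<in> {of_int n..of_int n + 1}" for n :: int and t
  proof (rule has_vector_derivative_transform)
    show "t \<in> {of_int n..of_int n + 1}" by (rule t)
    fix s :: real assume s: "s \<in> {of_int n..of_int n + 1}"
    show "Z (frac s) = Z (s - of_int n)"
    proof (cases "s = of_int n + 1")
      case True then show ?thesis using closed(1) by simp
    next
      case False
      then have "\<lfloor>s\<rfloor> = n" using s by (intro floor_unique) auto
      then show ?thesis by (simp add: frac_def)
    qed
  next
    have im: "(\<lambda>s. s - real_of_int n) ` {of_int n..of_int n + 1} = {0..1}"
      by (auto simp: image_iff intro: bexI[of _ "_ + real_of_int n"])
    have "(Z \<circ> (\<lambda>s. s - real_of_int n) has_vector_derivative 1 *\<^sub>R d (t - of_int n)) (at t within {of_int n..of_int n + 1})"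
    proof (rule vector_diff_chain_within)
      show "((\<lambda>s. s - real_of_int n) has_vector_derivative 1) (at t within {of_int n..of_int n + 1})"
        by (auto intro!: derivative_eq_intros simp: has_vector_derivative_def)
      show "(Z has_vector_derivative d (t - real_of_int n)) (at (t - real_of_int n) within (\<lambda>s. s - real_of_int n) ` {of_int n..of_int n + 1})"
        unfolding im using t by (intro Z) auto
    qed
    then show "((\<lambda>s. Z (s - real_of_int n)) has_vector_derivative d (t - of_int n)) (at t within {of_int n..of_int n + 1})"
      by (simp add: o_def)
  qed
  define n where "n = \<lfloor>t\<rfloor>"
  have t: "of_int n \<le> t" "t < of_int n + 1" by (auto simp: n_def)
  have right: "((\<lambda>t. Z (frac t)) has_vector_derivative d (frac t)) (at t within {of_int n..of_int n + 1})"
    using on_cell[of t n] t by (simp add: n_def frac_def)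
  show ?thesis
  proof (cases "t = of_int n")
    case False
    then have "t \<in> interior {of_int n..of_int n + 1}" using t by simp
    then show ?thesis using right at_within_interior by metis
  next
    case True
    have left: "((\<lambda>t. Z (frac t)) has_vector_derivative d (frac t)) (at t within {of_int (n - 1)..of_int (n - 1) + 1})"
      using on_cell[of t "n - 1"] True closed(2) by simp
    have "((\<lambda>t. Z (frac t)) has_vector_derivative d (frac t))
        (at t within ({of_int (n - 1)..of_int (n - 1) + 1} \<union> {of_int n..of_int n + 1}))"
      using left right unfolding has_vector_derivative_def has_derivative_within by (auto intro: Lim_Un)
    moreover have "{real_of_int (n - 1)..of_int (n - 1) + 1} \<union> {of_int n..of_int n + 1} = {of_int n - 1..of_int n + 1}"
      by auto
    moreover have "t \<in> interior {of_int n - 1..of_int n + 1}" using True by simp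
    ultimately show ?thesis using at_within_interior by metis
  qed
qed

text \<open>The integrand \<open>\<omega>(\<gamma>, \<gamma>') + 2 p q'\<close> is the derivative of \<open>p \<bullet> q\<close>, whose integral over a period
  vanishes.\<close>

lemma action_eq_omega_integral:
  fixes \<gamma> :: "real \<Rightarrow> 'n::finite phase_space"
  assumes der: "\<And>t. (\<gamma> has_vector_derivative d t) (at t)" and cont: "continuous_on {0..1} d" and closed: "\<gamma> 0 = \<gamma> 1"
  shows "action \<gamma> = - (1/2) * integral {0..1} (\<lambda>t. omega_st (\<gamma> t) (d t))"
proof -
  have vd: "vector_derivative \<gamma> (at t) = d t" for t by (rule vector_derivative_at[OF der])
  have c\<gamma>: "continuous_on {0..1} \<gamma>"
    using der has_vector_derivative_continuous by (intro continuous_at_imp_continuous_on) blast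
  have df: "((\<lambda>t. fst (\<gamma> t)) has_vector_derivative fst (d t)) (at t within A)"
    and ds: "((\<lambda>t. snd (\<gamma> t)) has_vector_derivative snd (d t)) (at t within A)" for t A
    using bounded_linear.has_vector_derivative[OF bounded_linear_fst der[of t]]
      bounded_linear.has_vector_derivative[OF bounded_linear_snd der[of t]]
    by (auto intro: has_vector_derivative_at_within)
  have "((\<lambda>t. fst (\<gamma> t) \<bullet> snd (d t) + fst (d t) \<bullet> snd (\<gamma> t)) has_integral
      (fst (\<gamma> 1) \<bullet> snd (\<gamma> 1) - fst (\<gamma> 0) \<bullet> snd (\<gamma> 0))) {0..1}"
    by (rule fundamental_theorem_of_calculus)
      (auto intro!: bounded_bilinear.has_vector_derivative[OF bounded_bilinear_inner] df ds)
  then have 0: "integral {0..1} (\<lambda>t. fst (\<gamma> t) \<bullet> snd (d t) + fst (d t) \<bullet> snd (\<gamma> t)) = 0"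
    using closed by (auto dest: integral_unique)
  have int: "(\<lambda>t. omega_st (\<gamma> t) (d t)) integrable_on {0..1}"
    "(\<lambda>t. snd (\<gamma> t) \<bullet> fst (d t)) integrable_on {0..1}"
    by (auto intro!: integrable_continuous_real omega.continuous_on continuous_intros c\<gamma> cont)
  have "(\<lambda>t. fst (\<gamma> t) \<bullet> snd (d t) + fst (d t) \<bullet> snd (\<gamma> t)) =
      (\<lambda>t. omega_st (\<gamma> t) (d t) + 2 * (snd (\<gamma> t) \<bullet> fst (d t)))"
    by (simp add: fun_eq_iff omega_st_inner inner_commute)
  then have "integral {0..1} (\<lambda>t. omega_st (\<gamma> t) (d t)) + 2 * integral {0..1} (\<lambda>t. snd (\<gamma> t) \<bullet> fst (d t)) = 0"
    using 0 int by (simp add: integral_add integrable_on_mult_right)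
  then show ?thesis by (simp add: action_def vd)
qed

context regular_body
begin

lemma continuous_on_dual_vector:
  assumes "continuous_on A f" "\<And>x. x \<in> A \<Longrightarrow> f x \<noteq> 0"
  shows "continuous_on A (\<lambda>x. dual_vector (f x))"
proof -
  have "continuous_on (f ` A) dual_vector" using assms(2) by (intro dual_vector_continuous_on) force
  from continuous_on_compose2[OF this assms(1)] show ?thesis by simp
qed

text \<open>The limit of the extremal areas dominates all loops with velocities in the polar, although it is
  only taken along a subsequence.\<close>

lemma loop_le_limit:
  fixes w :: "real \<Rightarrow> 'n phase_space"
  assumes r: "strict_mono r"
    and lim: "area_limit r \<rho>"
    and w: "\<And>t. t \<in> {0..1} \<Longrightarrow> (w has_vector_derivative w' t) (at t within {0..1})"
    and closed: "w 0 = w 1" and cont: "continuous_on {0..1} w'"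
    and w': "\<And>t. t \<in> {0..1} \<Longrightarrow> w' t \<in> C"
    and a: "\<And>t. t \<in> {0..1} \<Longrightarrow> a \<le> omega_st (w t) (w' t)"
  shows "a \<le> \<rho>"
proof (rule field_le_epsilon)
  fix e :: real assume e: "e > 0"
  have "strict_mono (\<lambda>k. 4 * Suc (r k))" using r by (auto simp: strict_mono_def)
  from eventually_subseq[OF this loop_le_max_area[OF w closed cont w' a e]]
  have "a - e \<le> \<rho>" by (intro tendsto_lowerbound[OF lim]) auto
  then show "a \<le> \<rho> + e" by simp
qed

text \<open>Reparametrise by the primitive \<open>\<tau>\<close> of \<open>\<kappa>\<close> and divide by \<open>T = \<tau> 1\<close>, the integral of \<open>\<kappa>\<close>. This gives a
  loop with velocities in the polar and constant \<open>\<omega>(w, w') = 1 / T\<close>.\<close>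

lemma characteristic_integral_ge:
  fixes \<gamma> :: "real \<Rightarrow> 'n phase_space"
  assumes r: "strict_mono r"
    and lim: "area_limit r \<rho>" and \<rho>: "\<rho> > 0"
    and der: "\<And>t. (\<gamma> has_vector_derivative \<kappa> t *\<^sub>R dual_vector (\<gamma> t)) (at t)" and g1: "\<And>t. g (\<gamma> t) = 1"
    and closed: "\<gamma> 0 = \<gamma> 1" and cont: "continuous_on UNIV \<kappa>" and pos: "\<And>t. \<kappa> t > 0"
  shows "1 / \<rho> \<le> integral {0..1} \<kappa>"
proof -
  \<comment> \<open>Integrating from \<open>- 1\<close> makes \<open>0\<close> and \<open>1\<close> interior points of the domain, so that the inverse
    function of \<open>\<tau>\<close> is differentiable there.\<close>
  define K where "K t = integral {-1..t} \<kappa>" for t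
  define \<tau> where "\<tau> t = K t - K 0" for t
  have contI: "continuous_on A \<kappa>" for A using cont continuous_on_subset by blast
  have d\<tau>: "(\<tau> has_real_derivative \<kappa> t) (at t)" if t: "t \<in> {-1<..<2}" for t
  proof -
    have "(K has_vector_derivative \<kappa> t) (at t within {-1..2})"
      unfolding K_def using t by (intro integral_has_vector_derivative contI) auto
    moreover have "t \<in> interior {-1..2::real}" using t by simp
    ultimately have "(K has_real_derivative \<kappa> t) (at t)"
      using at_within_interior by (metis has_real_derivative_iff_has_vector_derivative)
    then show ?thesis unfolding \<tau>_def[abs_def] by (auto intro!: derivative_eq_intros)
  qed
  have mono: "\<tau> s < \<tau> t" if "s \<in> {-1<..<2}" "t \<in> {-1<..<2}" "s < t" for s t
  proof (rule DERIV_pos_imp_increasing[OF that(3)])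
    fix x assume "s \<le> x" "x \<le> t"
    then have "x \<in> {-1<..<2}" using that by auto
    then show "\<exists>y. (\<tau> has_real_derivative y) (at x) \<and> 0 < y" using d\<tau> pos by blast
  qed
  have inj: "inj_on \<tau> {-1<..<2}"
    by (rule inj_onI) (metis mono less_irrefl linorder_neqE_linordered_idom)
  define \<sigma> where "\<sigma> = inv_into {-1<..<2} \<tau>"
  have \<sigma>: "\<sigma> (\<tau> t) = t" if "t \<in> {-1<..<2}" for t unfolding \<sigma>_def using inj that by simp
  have c\<tau>: "continuous_on {-1<..<2} \<tau>"
    using d\<tau> DERIV_isCont by (intro continuous_at_imp_continuous_on) blast
  have d\<sigma>: "(\<sigma> has_real_derivative inverse (\<kappa> t)) (at (\<tau> t))" if t: "t \<in> {-1<..<2}" for t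
  proof (rule has_field_derivative_inverse_strong[OF d\<tau>[OF t]])
    show "\<kappa> t \<noteq> 0" using pos[of t] by simp
  qed (use t c\<tau> \<sigma> in auto)
  define T where "T = \<tau> 1"
  have \<tau>0: "\<tau> 0 = 0" by (simp add: \<tau>_def)
  have T: "T > 0" using mono[of 0 1] \<tau>0 by (simp add: T_def)
  have c\<tau>01: "continuous_on {0..1} \<tau>" by (rule continuous_on_subset[OF c\<tau>]) auto
  have onto: "\<exists>t\<in>{0..1}. \<tau> t = s" if "s \<in> {0..T}" for s
    using IVT'[of \<tau> 0 s 1, OF _ _ _ c\<tau>01] that \<tau>0 by (auto simp: T_def)
  define w where "w s = (1 / T) *\<^sub>R \<gamma> (\<sigma> (T * s))" for s
  have der_w: "(w has_vector_derivative dual_vector (\<gamma> (\<sigma> (T * s)))) (at s)" if s: "s \<in> {0..1}" for s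
  proof -
    have "T * s \<in> {0..T}" using s T by (auto simp: mult_left_le)
    then obtain t where t: "t \<in> {0..1}" "\<tau> t = T * s" using onto by blast
    have t': "t \<in> {-1<..<2}" using t by auto
    have st: "\<sigma> (T * s) = t" using \<sigma>[OF t'] t by simp
    have "((\<lambda>s. \<sigma> (T * s)) has_real_derivative inverse (\<kappa> t) * T) (at s)"
      by (rule DERIV_chain2[of \<sigma>]) (use d\<sigma>[OF t'] t(2) in \<open>auto intro!: derivative_eq_intros\<close>)
    then have "((\<lambda>s. \<sigma> (T * s)) has_vector_derivative T / \<kappa> t) (at s)"
      by (simp add: has_real_derivative_iff_has_vector_derivative field_simps)
    from vector_diff_chain_at[OF this, of \<gamma> "\<kappa> t *\<^sub>R dual_vector (\<gamma> t)"] der[of t]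
    have "((\<lambda>s. \<gamma> (\<sigma> (T * s))) has_vector_derivative (T / \<kappa> t) *\<^sub>R (\<kappa> t *\<^sub>R dual_vector (\<gamma> t))) (at s)"
      by (simp only: st o_def)
    then have "((\<lambda>s. \<gamma> (\<sigma> (T * s))) has_vector_derivative T *\<^sub>R dual_vector (\<gamma> t)) (at s)"
      using pos[of t] by simp
    from bounded_linear.has_vector_derivative[OF bounded_linear_scaleR_right[of "1 / T"] this]
    show ?thesis using T by (simp add: w_def[abs_def] st)
  qed
  have \<gamma>nz: "\<gamma> t \<noteq> 0" for t using g1[of t] g_zero by auto
  have "1 / T \<le> \<rho>"
  proof (rule loop_le_limit[OF r lim, of w "\<lambda>s. dual_vector (\<gamma> (\<sigma> (T * s)))"])
    fix s :: real assume s: "s \<in> {0..1}"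
    show "(w has_vector_derivative dual_vector (\<gamma> (\<sigma> (T * s)))) (at s within {0..1})"
      using der_w[OF s] has_vector_derivative_at_within by blast
    show "dual_vector (\<gamma> (\<sigma> (T * s))) \<in> C" by (rule dual_vector)
    show "1 / T \<le> omega_st (w s) (dual_vector (\<gamma> (\<sigma> (T * s))))"
      using dual_vector(2) g1 by (simp add: w_def omega.scaleR_left)
  next
    show "w 0 = w 1" using \<sigma>[of 0] \<sigma>[of 1] \<tau>0 closed by (simp add: w_def T_def)
    have "continuous_on {0..1} w"
      using der_w has_vector_derivative_continuous by (intro continuous_at_imp_continuous_on) blast
    then have "continuous_on {0..1} (\<lambda>s. T *\<^sub>R w s)" by (intro continuous_intros)
    then have "continuous_on {0..1} (\<lambda>s. \<gamma> (\<sigma> (T * s)))" using T by (simp add: w_def)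
    then show "continuous_on {0..1} (\<lambda>s. dual_vector (\<gamma> (\<sigma> (T * s))))"
      by (rule continuous_on_dual_vector) (rule \<gamma>nz)
  qed
  moreover have "T = integral {0..1} \<kappa>"
    using Henstock_Kurzweil_Integration.integral_combine[of "-1" 0 1 \<kappa>] integrable_continuous_real[OF contI]
    by (simp add: T_def \<tau>_def K_def)
  ultimately show ?thesis using T \<rho> by (simp add: field_simps)
qed

end

context smooth_body
begin

text \<open>Scaling the limit loop to gauge one puts it on the boundary.\<close>

lemma extremal_closed_characteristic:
  assumes r: "strict_mono r"
    and lim: "area_limit r \<rho>" and \<rho>: "\<rho> > 0"
    and closed: "Z 0 = Z 1" and gZ: "\<And>t. t \<in> {0..1} \<Longrightarrow> g (Z t) = \<rho>"
    and der: "\<And>t. t \<in> {0..1} \<Longrightarrow> (Z has_vector_derivative dual_vector (Z t)) (at t within {0..1})"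
  defines "\<gamma> \<equiv> \<lambda>t. (1 / \<rho>) *\<^sub>R Z (frac t)"
  shows "closed_characteristic S \<gamma>" "\<bar>action \<gamma>\<bar> = 1 / (2 * \<rho>)"
proof -
  have fr: "frac t \<in> {0..1}" for t :: real using frac_ge_0[of t] frac_lt_1[of t] by auto
  have g1: "g (\<gamma> t) = 1" for t using gZ[OF fr] \<rho> by (simp add: \<gamma>_def g_scale)
  have Znz: "Z t \<noteq> 0" if "t \<in> {0..1}" for t using gZ[OF that] \<rho> g_zero by auto
  have dual_vector\<gamma>: "dual_vector (\<gamma> t) = dual_vector (Z (frac t))" for t using dual_vector_scale[OF Znz[OF fr]] \<rho> by (simp add: \<gamma>_def)
  have d\<gamma>: "(\<gamma> has_vector_derivative (1 / \<rho>) *\<^sub>R dual_vector (\<gamma> t)) (at t)" for t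
    unfolding dual_vector\<gamma> unfolding \<gamma>_def
    by (rule bounded_linear.has_vector_derivative[OF bounded_linear_scaleR_right])
      (rule periodic_extension_has_vector_derivative[OF der], use closed in auto)
  have om: "omega_st (\<gamma> t) ((1 / \<rho>) *\<^sub>R dual_vector (\<gamma> t)) = 1 / \<rho>" for t
    using dual_vector(2) g1 by (simp add: omega.scaleR_right)
  have vd: "vector_derivative \<gamma> (at t) = (1 / \<rho>) *\<^sub>R dual_vector (\<gamma> t)" for t by (rule vector_derivative_at[OF d\<gamma>])
  have ZC: "continuous_on {0..1} Z"
    using der has_vector_derivative_continuous continuous_on_eq_continuous_within by blast
  \<comment> \<open>A proper closed subarc of duration \<open>l < 1\<close>, rescaled to unit time and divided by \<open>l\<close>, would be a
    loop with \<open>\<omega>(w, w') = \<rho> / l > \<rho>\<close>.\<close>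
  have inj: "\<not> (Z s = Z t)" if st: "0 \<le> s" "s < t" "t < 1" for s t
  proof
    assume eq: "Z s = Z t"
    define l where "l = t - s"
    have l: "l > 0" "l < 1" using st by (auto simp: l_def)
    define w where "w x = (1 / l) *\<^sub>R Z (s + l * x)" for x
    have in01: "s + l * x \<in> {0..1}" if "x \<in> {0..1}" for x
    proof -
      have "0 \<le> l * x" "l * x \<le> l" using that l by (auto simp: mult_left_le)
      moreover have "s + l < 1" using st by (simp add: l_def)
      ultimately show ?thesis using st by simp
    qed
    have im: "(\<lambda>x. s + l * x) ` {0..1} \<subseteq> {0..1}" using in01 by blast
    have "\<rho> / l \<le> \<rho>"
    proof (rule loop_le_limit[OF r lim, of w "\<lambda>x. dual_vector (Z (s + l * x))"])
      fix x :: real assume x: "x \<in> {0..1}"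
      have "(Z \<circ> (\<lambda>x. s + l * x) has_vector_derivative l *\<^sub>R dual_vector (Z (s + l * x))) (at x within {0..1})"
      proof (rule vector_diff_chain_within)
        show "((\<lambda>x. s + l * x) has_vector_derivative l) (at x within {0..1})"
          by (auto intro!: derivative_eq_intros simp: has_vector_derivative_def)
        show "(Z has_vector_derivative dual_vector (Z (s + l * x))) (at (s + l * x) within (\<lambda>x. s + l * x) ` {0..1})"
          using der[OF in01[OF x]] im has_vector_derivative_within_subset by blast
      qed
      from bounded_linear.has_vector_derivative[OF bounded_linear_scaleR_right[of "1 / l"] this]
      show "(w has_vector_derivative dual_vector (Z (s + l * x))) (at x within {0..1})"
        using l by (simp add: w_def[abs_def] o_def)
      show "dual_vector (Z (s + l * x)) \<in> C" by (rule dual_vector)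
      show "\<rho> / l \<le> omega_st (w x) (dual_vector (Z (s + l * x)))"
        using dual_vector(2) gZ[OF in01[OF x]] by (simp add: w_def omega.scaleR_left)
    next
      show "w 0 = w 1" using eq by (simp add: w_def l_def)
      have "continuous_on {0..1} (\<lambda>x. Z (s + l * x))"
        by (rule continuous_on_compose2[OF ZC _ im]) (intro continuous_intros)
      then show "continuous_on {0..1} (\<lambda>x. dual_vector (Z (s + l * x)))"
        by (rule continuous_on_dual_vector) (use Znz in01 in blast)
    qed
    then show False using l \<rho> by (simp add: field_simps)
  qed
  show "closed_characteristic S \<gamma>"
    unfolding closed_characteristic_def
  proof (intro conjI allI)
    show "smooth_on \<gamma> UNIV" by (rule smooth_characteristic[OF g1 d\<gamma>])
    show "\<gamma> (t + 1) = \<gamma> t" for t by (simp add: \<gamma>_def frac_1_eq)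
    show "inj_on \<gamma> {0..<1}"
    proof (rule inj_onI)
      fix s t :: real assume st: "s \<in> {0..<1}" "t \<in> {0..<1}" "\<gamma> s = \<gamma> t"
      have "frac s = s" "frac t = t" using st by (auto simp: frac_eq)
      then have "Z s = Z t" using st(3) \<rho> by (simp add: \<gamma>_def)
      then show "s = t" using inj[of s t] inj[of t s] st by (cases s t rule: linorder_cases) auto
    qed
    show "vector_derivative \<gamma> (at t) \<noteq> 0" for t
      unfolding vd using om[of t] \<rho> by (auto simp: omega.zero_right)
    show "range \<gamma> \<subseteq> frontier S" using g1 by (auto simp: frontier_S)
    show "vector_derivative \<gamma> (at t) \<in> characteristic_line S (\<gamma> t)" for t
      unfolding vd characteristic_line_eq[OF g1] by blast
  qed
  have "continuous_on UNIV \<gamma>"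
    using d\<gamma> has_vector_derivative_continuous by (intro continuous_at_imp_continuous_on) blast
  then have "continuous_on {0..1} \<gamma>" using continuous_on_subset by blast
  then have "continuous_on {0..1} (\<lambda>t. dual_vector (\<gamma> t))"
    by (rule continuous_on_dual_vector) (metis g1 g_zero zero_neq_one)
  then have "action \<gamma> = - (1/2) * integral {0..1} (\<lambda>t. omega_st (\<gamma> t) ((1 / \<rho>) *\<^sub>R dual_vector (\<gamma> t)))"
    by (intro action_eq_omega_integral d\<gamma> continuous_intros) (simp_all add: \<gamma>_def frac_def)
  then show "\<bar>action \<gamma>\<bar> = 1 / (2 * \<rho>)" using \<rho> by (simp add: om)
qed

text \<open>The velocity is \<open>\<kappa> U(\<gamma>)\<close> with \<open>\<kappa> = \<omega>(\<gamma>, \<gamma>')\<close> continuous and without zeros, so \<open>\<kappa>\<close> has a constant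
  sign; reversing the curve makes it positive.\<close>

lemma closed_characteristic_action_ge:
  assumes r: "strict_mono r"
    and lim: "area_limit r \<rho>" and \<rho>: "\<rho> > 0"
    and \<gamma>: "closed_characteristic S \<gamma>"
  shows "1 / (2 * \<rho>) \<le> \<bar>action \<gamma>\<bar>"
proof -
  define d where "d t = vector_derivative \<gamma> (at t)" for t
  have Ck: "Ck_on (Suc (Suc 0)) \<gamma> UNIV" using \<gamma> unfolding closed_characteristic_def smooth_on_def by blast
  have der: "(\<gamma> has_vector_derivative d t) (at t)" for t
    unfolding d_def using Ck_on_SucD[OF open_UNIV Ck] by (metis UNIV_I differentiable_def vector_derivative_works)
  have d_eq: "d t = frechet_derivative \<gamma> (at t) 1" for t
    using frechet_derivative_at[OF der[of t, unfolded has_vector_derivative_def]] by (metis scaleR_one)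
  have "continuous_on UNIV (\<lambda>t. frechet_derivative \<gamma> (at t) 1)"
    using Ck by (auto intro: differentiable_imp_continuous_on)
  then have cd: "continuous_on UNIV d" unfolding d_eq[abs_def] .
  have g1: "g (\<gamma> t) = 1" for t using \<gamma> unfolding closed_characteristic_def frontier_S by blast
  define \<kappa> where "\<kappa> t = omega_st (\<gamma> t) (d t)" for t
  have d\<kappa>: "d t = \<kappa> t *\<^sub>R dual_vector (\<gamma> t)" for t
  proof -
    have "d t \<in> characteristic_line S (\<gamma> t)" using \<gamma> by (simp add: closed_characteristic_def d_def)
    then obtain k where k: "d t = k *\<^sub>R dual_vector (\<gamma> t)" unfolding characteristic_line_eq[OF g1] by blast
    then have "\<kappa> t = k" using dual_vector(2) g1 by (simp add: \<kappa>_def omega.scaleR_right)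
    then show ?thesis using k by simp
  qed
  have c\<gamma>: "continuous_on UNIV \<gamma>"
    using der has_vector_derivative_continuous by (intro continuous_at_imp_continuous_on) blast
  have c\<kappa>: "continuous_on UNIV \<kappa>" unfolding \<kappa>_def[abs_def] by (intro omega.continuous_on c\<gamma> cd)
  have nz: "\<kappa> t \<noteq> 0" for t using \<gamma> d\<kappa>[of t] by (auto simp: closed_characteristic_def d_def)
  have period: "\<gamma> 0 = \<gamma> 1" using \<gamma> unfolding closed_characteristic_def by (metis add_0)
  have act: "action \<gamma> = - (1/2) * integral {0..1} \<kappa>"
    unfolding \<kappa>_def[abs_def] by (rule action_eq_omega_integral[OF der continuous_on_subset[OF cd] period]) simp
  have sign: "(\<forall>t. \<kappa> t > 0) \<or> (\<forall>t. \<kappa> t < 0)"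
  proof (rule ccontr)
    assume "\<not> ?thesis"
    then obtain s t where "\<kappa> s < 0" "\<kappa> t > 0" using nz by (metis linorder_neqE_linordered_idom)
    moreover have "connected (range \<kappa>)" using c\<kappa> by (intro connected_continuous_image) auto
    ultimately have "{\<kappa> s..\<kappa> t} \<subseteq> range \<kappa>" by (intro connected_contains_Icc) auto
    then have "0 \<in> range \<kappa>" using \<open>\<kappa> s < 0\<close> \<open>\<kappa> t > 0\<close> by (auto simp: subset_iff)
    then show False using nz by auto
  qed
  have "1 / \<rho> \<le> \<bar>integral {0..1} \<kappa>\<bar>"
    using sign
  proof
    assume pos: "\<forall>t. \<kappa> t > 0"
    have "1 / \<rho> \<le> integral {0..1} \<kappa>"
      by (rule characteristic_integral_ge[OF r lim \<rho> _ g1 period c\<kappa>]) (use der d\<kappa> pos in auto)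
    then show ?thesis by simp
  next
    assume neg: "\<forall>t. \<kappa> t < 0"
    define \<delta> where "\<delta> t = \<gamma> (1 - t)" for t
    define \<mu> where "\<mu> t = - \<kappa> (1 - t)" for t
    have "(\<delta> has_vector_derivative \<mu> t *\<^sub>R dual_vector (\<delta> t)) (at t)" for t
    proof -
      have "((\<lambda>t. 1 - t) has_vector_derivative - 1) (at t)"
        by (auto intro!: derivative_eq_intros simp: has_vector_derivative_def)
      from vector_diff_chain_at[OF this der] show ?thesis
        by (simp add: o_def \<delta>_def[abs_def] \<mu>_def d\<kappa>)
    qed
    moreover have "continuous_on UNIV \<mu>"
      unfolding \<mu>_def[abs_def] by (intro continuous_intros continuous_on_compose2[OF c\<kappa>]) auto
    ultimately have "1 / \<rho> \<le> integral {0..1} \<mu>"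
      by (intro characteristic_integral_ge[OF r lim \<rho>, of \<delta>]) (use g1 period neg in \<open>auto simp: \<delta>_def \<mu>_def\<close>)
    also have "integral {0..1} \<mu> = - integral {0..1} \<kappa>"
    proof -
      have "(\<kappa> has_integral integral {0..1} \<kappa>) (cbox 0 1)"
        using integrable_integral[OF integrable_continuous_real[OF continuous_on_subset[OF c\<kappa> subset_UNIV]]] by simp
      from has_integral_affinity[OF this, of "-1" 1]
      have "((\<lambda>x. \<kappa> (1 - x)) has_integral integral {0..1} \<kappa>) ((\<lambda>x. 1 - x) ` {0..1})" by simp
      moreover have "(\<lambda>x::real. 1 - x) ` {0..1} = {0..1}" by (auto simp: image_iff intro: bexI[of _ "1 - _"])
      ultimately have "integral {0..1} (\<lambda>x. \<kappa> (1 - x)) = integral {0..1} \<kappa>" by (simp add: integral_unique)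
      then show ?thesis by (simp add: \<mu>_def[abs_def])
    qed
    finally show ?thesis by simp
  qed
  then show ?thesis unfolding act using \<rho> by (simp add: abs_mult field_simps)
qed

theorem capacity_eq_limit:
  obtains \<rho> and r :: "nat \<Rightarrow> nat" where "\<rho> > 0"
    "area_limit r \<rho>"
    "smooth_hz_capacity S = 1 / (2 * \<rho>)"
proof -
  obtain Z \<rho> r where *: "strict_mono r" "\<rho> > 0"
    "area_limit r \<rho>"
    "Z 0 = Z 1" "\<And>t. t \<in> {0..1} \<Longrightarrow> g (Z t) = \<rho>"
    "\<And>t. t \<in> {0..1} \<Longrightarrow> (Z has_vector_derivative dual_vector (Z t)) (at t within {0..1})"
    by (rule extremal_limit) (rule that)
  have "smooth_hz_capacity S = 1 / (2 * \<rho>)"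
    unfolding smooth_hz_capacity_def
  proof (rule Least_equality)
    show "1 / (2 * \<rho>) \<in> action_spectrum S"
      using extremal_closed_characteristic[OF *(1,3,2,4-6)] unfolding action_spectrum_def by force
    fix a assume "a \<in> action_spectrum S"
    then show "1 / (2 * \<rho>) \<le> a"
      using closed_characteristic_action_ge[OF *(1,3,2)] unfolding action_spectrum_def by force
  qed
  then show ?thesis using that *(2,3) by blast
qed

text \<open>The area bounds hold for each number of edges, so they pass to the limit \<open>\<rho>\<close>.\<close>

lemma capacity_between:
  assumes K: "convex_body K" "centrally_symmetric K" and a: "a > 0" and b: "b > 0"
    and inner: "\<And>x. x \<in> K \<times> polar_body K \<Longrightarrow> a *\<^sub>R x \<in> S"
    and outer: "\<And>x. x \<in> S \<Longrightarrow> (1 / b) *\<^sub>R x \<in> K \<times> polar_body K"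
  shows "4 * a\<^sup>2 \<le> smooth_hz_capacity S" "smooth_hz_capacity S \<le> 4 * b\<^sup>2"
proof -
  obtain \<rho> r where \<rho>: "\<rho> > 0"
    and lim: "area_limit r \<rho>"
    and cap: "smooth_hz_capacity S = 1 / (2 * \<rho>)" by (rule capacity_eq_limit)
  have "max_area N \<le> (real N)\<^sup>2 / (8 * a\<^sup>2)" for N
  proof -
    obtain u where "u \<in> closed_steps N" "\<forall>v\<in>closed_steps N. area_form N v \<le> area_form N u" using ex_max_area by blast
    then show ?thesis using area_form_le_of_contains_product[OF K a inner, of u N] max_area_eqI[of u N] by simp
  qed
  then have "max_area N / (real N)\<^sup>2 \<le> 1 / (8 * a\<^sup>2)" if "N > 0" for N
    using that by (simp add: divide_le_eq)
  then have hi: "\<rho> \<le> 1 / (8 * a\<^sup>2)"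
    by (intro tendsto_upperbound[OF lim]) (auto simp del: of_nat_mult of_nat_Suc mult_Suc_right)
  have lo: "1 / (8 * b\<^sup>2) \<le> \<rho>"
    by (rule tendsto_lowerbound[OF lim])
      (use max_area_ge_of_inside_product[OF K b outer zero_less_Suc] in \<open>auto simp del: of_nat_mult of_nat_Suc mult_Suc_right\<close>)
  show "4 * a\<^sup>2 \<le> smooth_hz_capacity S" using hi \<rho> a unfolding cap by (simp add: field_simps)
  show "smooth_hz_capacity S \<le> 4 * b\<^sup>2" using lo \<rho> b unfolding cap by (simp add: field_simps)
qed

end

section \<open>Smooth approximation and the Hausdorff distance\<close>

lemma Ck_on_exp_affine:
  fixes L :: "'a::euclidean_space \<Rightarrow> real"
  assumes L: "bounded_linear L" and U: "open U"
  shows "Ck_on k (\<lambda>x. exp (L x + d)) U"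
proof (induction k)
  case 0
  show ?case using bounded_linear.continuous_on[OF L continuous_on_id] by (auto intro!: continuous_intros)
next
  case (Suc k)
  show ?case
  proof (rule Ck_on_SucI[OF U])
    fix x
    show "((\<lambda>x. exp (L x + d)) has_derivative (\<lambda>h. L h *\<^sub>R exp (L x + d))) (at x)"
      by (auto intro!: derivative_eq_intros bounded_linear.has_derivative[OF L])
    show "Ck_on k (\<lambda>x. L i *\<^sub>R exp (L x + d)) U" for i
      by (rule Ck_on_bounded_linear[OF bounded_linear_scaleR_right U Suc.IH])
  qed
qed

context origin_body
begin

text \<open>Finitely many half-spaces that contain \<open>S\<close> cut out a polytope inside \<open>(1 + e) S\<close>, by compactness of
  the boundary of \<open>(1 + e) S\<close>. A sublevel set of a sum of exponentials of large multiples \<open>m\<close>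
  of their defining functionals is smooth and convex and lies between \<open>(1 - e) S\<close> and the polytope.\<close>

lemma smooth_approximation:
  assumes e: "0 < e" "e < 1"
  obtains T where "smooth_convex_body T" "\<And>x. x \<in> S \<Longrightarrow> (1 - e) *\<^sub>R x \<in> T"
    "\<And>x. x \<in> T \<Longrightarrow> (1 / (1 + e)) *\<^sub>R x \<in> S"
proof -
  define A where "A = {x. g x = 1 + e}"
  obtain c where c: "c > 0" "\<And>x. c * norm x \<le> g x" using g_ge_norm by blast
  have "closed A" unfolding A_def by (intro closed_Collect_eq g_continuous continuous_intros)
  moreover have "norm x \<le> (1 + e) / c" if "x \<in> A" for x
    using c(2)[of x] c(1) that by (simp add: A_def field_simps)
  then have "bounded A" unfolding bounded_iff by blast
  ultimately have cA: "compact A" by (simp add: compact_eq_bounded_closed)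
  have cover: "A \<subseteq> (\<Union>u\<in>C. {x. 1 < omega_st x u})"
  proof
    fix x assume "x \<in> A"
    obtain u where "u \<in> C" "omega_st x u = g x" using g_attained by blast
    then show "x \<in> (\<Union>u\<in>C. {x. 1 < omega_st x u})" using \<open>x \<in> A\<close> e by (intro UN_I[of u]) (simp_all add: A_def)
  qed
  have op: "open {x. 1 < omega_st x u}" for u
    by (intro open_Collect_less continuous_intros omega.continuous_on)
  obtain F where F: "F \<subseteq> C" "finite F" "A \<subseteq> (\<Union>u\<in>F. {x. 1 < omega_st x u})"
    by (rule compactE_image[OF cA op cover])
  have outside: "g x < 1 + e" if "\<And>u. u \<in> F \<Longrightarrow> omega_st x u \<le> 1" for x
  proof (rule ccontr)
    assume "\<not> g x < 1 + e"
    then have gx: "1 + e \<le> g x" by simp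
    define s where "s = (1 + e) / g x"
    have s: "0 < s" "s \<le> 1" using gx e by (auto simp: s_def)
    have "s *\<^sub>R x \<in> A" using gx e s by (simp add: A_def g_scale s_def)
    then obtain u where u: "u \<in> F" "1 < s * omega_st x u" using F(3) by (auto simp: omega.scaleR_left)
    have "s * omega_st x u \<le> s * 1" using that[OF u(1)] s by (intro mult_left_mono) auto
    then show False using u(2) s(2) by linarith
  qed
  define N where "N = real (card F)"
  \<comment> \<open>Large enough for the \<open>N\<close> exponentials to have a sum below one on \<open>(1 - e) S\<close>.\<close>
  define m where "m = (N + 1) / e"
  have N0: "N \<ge> 0" by (simp add: N_def)
  have m: "m > 0" using N0 e by (simp add: m_def)
  have small: "N * exp (- m * s) < 1" if "e \<le> s" for s
  proof -
    have "m * e = N + 1" using e by (simp add: m_def)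
    then have "N + 1 \<le> m * s" using mult_left_mono[OF that, of m] m by simp
    then have "N < exp (m * s)" using exp_ge_add_one_self[of "m * s"] by linarith
    then show ?thesis by (simp add: exp_minus field_simps)
  qed
  define h where "h x = (\<Sum>u\<in>F. exp (omega_st x (m *\<^sub>R u) + (- m))) + (- 1)" for x
  define T where "T = {x. h x \<le> 0}"
  have sm: "smooth_on h UNIV"
    unfolding smooth_on_def h_def[abs_def]
    by (intro allI Ck_on_add Ck_on_sum Ck_on_const Ck_on_exp_affine open_UNIV omega.bounded_linear_left)
  define E where "E x y = (\<Sum>u\<in>F. omega_st y (m *\<^sub>R u) * exp (omega_st x (m *\<^sub>R u) + (- m)))" for x y
  have dh: "(h has_derivative E x) (at x)" for x
  proof -
    have "((\<lambda>x. exp (omega_st x v + (- m))) has_derivative (\<lambda>y. omega_st y v * exp (omega_st x v + (- m)))) (at x)" for v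
      by (auto intro!: derivative_eq_intros bounded_linear.has_derivative[OF omega.bounded_linear_left])
    then show ?thesis unfolding h_def[abs_def] E_def[abs_def]
      by (intro has_derivative_add_const has_derivative_sum)
  qed
  have frech: "frechet_derivative h (at x) = E x" for x using frechet_derivative_at[OF dh] by simp
  have hc: "continuous_on UNIV h" using smooth_on_continuous_on[OF sm] .
  have exp_conv: "exp (s * a + t * b) \<le> s * exp a + t * exp b"
    if "0 \<le> s" "0 \<le> t" "s + t = 1" for s t a b :: real
    using convex_onD[OF exp_convex, of t a b] that by (simp add: eq_diff_eq[symmetric])
  have conv: "h (s *\<^sub>R x + t *\<^sub>R y) \<le> s * h x + t * h y" if "0 \<le> s" "0 \<le> t" "s + t = 1" for s t x y
  proof -
    have "(\<Sum>u\<in>F. exp (omega_st (s *\<^sub>R x + t *\<^sub>R y) (m *\<^sub>R u) + (- m))) \<le>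
       (\<Sum>u\<in>F. s * exp (omega_st x (m *\<^sub>R u) + (- m)) + t * exp (omega_st y (m *\<^sub>R u) + (- m)))"
    proof (rule sum_mono)
      fix u
      have "omega_st (s *\<^sub>R x + t *\<^sub>R y) (m *\<^sub>R u) + (- m) =
         s * (omega_st x (m *\<^sub>R u) + (- m)) + t * (omega_st y (m *\<^sub>R u) + (- m)) + (s + t - 1) * m"
        by (simp add: omega.add_left omega.scaleR_left algebra_simps)
      then show "exp (omega_st (s *\<^sub>R x + t *\<^sub>R y) (m *\<^sub>R u) + (- m)) \<le>
         s * exp (omega_st x (m *\<^sub>R u) + (- m)) + t * exp (omega_st y (m *\<^sub>R u) + (- m))"
        using exp_conv[OF that] that(3) by simp
    qed
    also have "\<dots> = s * (h x + 1) + t * (h y + 1)"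
      by (simp add: h_def sum.distrib sum_distrib_left)
    finally show ?thesis using that(3) by (simp add: h_def algebra_simps)
  qed
  have h0: "h 0 < 0"
    using small[of 1] e by (simp add: h_def omega.zero_left N_def)
  have T_out: "(1 / (1 + e)) *\<^sub>R x \<in> S" if x: "x \<in> T" for x
  proof -
    have "omega_st x u \<le> 1" if u: "u \<in> F" for u
    proof -
      have "exp (omega_st x (m *\<^sub>R u) + (- m)) \<le> (\<Sum>u\<in>F. exp (omega_st x (m *\<^sub>R u) + (- m)))"
        using u F(2) by (intro member_le_sum) auto
      also have "\<dots> \<le> 1" using x by (simp add: T_def h_def)
      finally have "m * omega_st x u \<le> m * 1" by (simp add: omega.scaleR_right)
      then show ?thesis using m by (simp only: mult_le_cancel_left_pos)
    qed
    then have "g x < 1 + e" by (rule outside)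
    then show ?thesis using e by (simp add: S_iff g_scale)
  qed
  have T_in: "(1 - e) *\<^sub>R x \<in> T" if x: "x \<in> S" for x
  proof -
    have "(\<Sum>u\<in>F. exp (omega_st ((1 - e) *\<^sub>R x) (m *\<^sub>R u) + (- m))) \<le> (\<Sum>u\<in>F. exp (- m * e))"
    proof (rule sum_mono)
      fix u assume "u \<in> F"
      then have "omega_st x u \<le> 1" using F(1) x C_le by blast
      then have "(m * (1 - e)) * omega_st x u \<le> (m * (1 - e)) * 1" using m e by (intro mult_left_mono) auto
      moreover have "omega_st ((1 - e) *\<^sub>R x) (m *\<^sub>R u) = (m * (1 - e)) * omega_st x u"
        by (simp only: omega.scaleR_left omega.scaleR_right) simp
      ultimately have "omega_st ((1 - e) *\<^sub>R x) (m *\<^sub>R u) \<le> m - m * e" by (simp only: algebra_simps)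
      then show "exp (omega_st ((1 - e) *\<^sub>R x) (m *\<^sub>R u) + (- m)) \<le> exp (- m * e)" by simp
    qed
    also have "\<dots> = N * exp (- m * e)" by (simp add: N_def)
    also have "\<dots> < 1" by (rule small) simp
    finally show ?thesis by (simp add: T_def h_def)
  qed
  have cl: "closed T" unfolding T_def by (intro closed_Collect_le hc continuous_intros)
  have "T \<subseteq> (\<lambda>x. (1 + e) *\<^sub>R x) ` S"
  proof
    fix x assume "x \<in> T"
    then have "(1 / (1 + e)) *\<^sub>R x \<in> S" by (rule T_out)
    moreover have "x = (1 + e) *\<^sub>R ((1 / (1 + e)) *\<^sub>R x)" using e by simp
    ultimately show "x \<in> (\<lambda>x. (1 + e) *\<^sub>R x) ` S" by blast
  qed
  then have cT: "compact T" using compact_scaling[OF compact_S, of "1 + e"] cl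
    by (meson bounded_subset compact_eq_bounded_closed)
  have convT: "convex T"
  proof (rule convexI)
    fix x y and s t :: real assume "x \<in> T" "y \<in> T" and st: "0 \<le> s" "0 \<le> t" "s + t = 1"
    then have "s * h x + t * h y \<le> 0" by (auto simp: T_def intro!: add_nonpos_nonpos mult_nonneg_nonpos)
    then show "s *\<^sub>R x + t *\<^sub>R y \<in> T" using conv[OF st, of x y] by (simp add: T_def)
  qed
  have intT: "interior T = {x. h x < 0}"
  proof
    have "open {x. h x < 0}" by (intro open_Collect_less hc continuous_intros)
    then show "{x. h x < 0} \<subseteq> interior T" by (intro interior_maximal) (auto simp: T_def)
    show "interior T \<subseteq> {x. h x < 0}"
    proof
      fix x assume "x \<in> interior T"
      then obtain d where d: "d > 0" "cball x d \<subseteq> T" by (auto simp: mem_interior_cball)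
      show "x \<in> {x. h x < 0}"
      proof (cases "x = 0")
        case False
        define l where "l = 1 + d / norm x"
        have l: "l > 1" using d False by (simp add: l_def)
        have "dist x (l *\<^sub>R x) = d"
          using False d by (simp add: l_def dist_norm scaleR_left_distrib)
        then have "l *\<^sub>R x \<in> T" using d by auto
        then have "h (l *\<^sub>R x) \<le> 0" by (simp add: T_def)
        then have "(1 / l) * h (l *\<^sub>R x) \<le> 0" using l by (simp add: divide_nonpos_pos)
        moreover have "(1 - 1 / l) * h 0 < 0" using l h0 by (intro mult_pos_neg) auto
        moreover have "h x \<le> (1 - 1 / l) * h 0 + (1 / l) * h (l *\<^sub>R x)"
          using conv[of "1 - 1/l" "1 / l" 0 "l *\<^sub>R x"] l by simp
        ultimately show ?thesis by simp
      qed (use h0 in simp)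
    qed
  qed
  have frT: "frontier T = {x. h x = 0}"
    unfolding frontier_def intT using cl by (auto simp: T_def)
  \<comment> \<open>The value of \<open>h\<close> at the origin is negative and lies above the tangent hyperplane at \<open>x\<close>, so the
    derivative of \<open>h\<close> in the radial direction is positive.\<close>
  have Epos: "E x x > 0" if "h x = 0" for x
  proof -
    have "(\<Sum>u\<in>F. exp (omega_st x (m *\<^sub>R u) + (- m)) - omega_st x (m *\<^sub>R u) * exp (omega_st x (m *\<^sub>R u) + (- m)))
        \<le> (\<Sum>u\<in>F. exp (- m))"
    proof (rule sum_mono)
      fix u
      let ?q = "omega_st x (m *\<^sub>R u)"
      have "exp (?q + (- m)) * (1 + (- ?q)) \<le> exp (?q + (- m)) * exp (- ?q)"
        by (intro mult_left_mono exp_ge_add_one_self) auto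
      also have "\<dots> = exp (- m)" by (simp flip: exp_add)
      finally show "exp (?q + (- m)) - ?q * exp (?q + (- m)) \<le> exp (- m)" by (simp add: algebra_simps)
    qed
    also have "\<dots> < 1" using small[of 1] e by (simp add: N_def)
    finally have "(h x + 1) - E x x < 1" by (simp add: h_def E_def sum_subtractf)
    then show ?thesis using that by simp
  qed
  have Eop: "open {y. 0 < E y y}"
    unfolding E_def by (intro open_Collect_less continuous_intros omega.continuous_on)
  have "smooth_hypersurface (frontier T)"
    unfolding smooth_hypersurface_def
  proof (rule ballI, intro exI conjI)
    fix x assume "x \<in> frontier T"
    then show "x \<in> {y. 0 < E y y}" using Epos by (simp add: frT)
    show "open {y. 0 < E y y}" by (rule Eop)
    show "smooth_on h {y. 0 < E y y}" using smooth_on_subset[OF sm] by blast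
    show "\<forall>y\<in>{y. 0 < E y y}. frechet_derivative h (at y) \<noteq> (\<lambda>_. 0)"
      unfolding frech by (auto dest: fun_cong)
    show "frontier T \<inter> {y. 0 < E y y} = {y \<in> {y. 0 < E y y}. h y = 0}" by (auto simp: frT)
  qed
  moreover have "0 \<in> interior T" using h0 by (simp add: intT)
  ultimately have "smooth_convex_body T"
    unfolding smooth_convex_body_def convex_body_def using cT convT by blast
  then show ?thesis using that T_in T_out by blast
qed

lemma zero_S: "0 \<in> S" using zero_int interior_subset by blast

lemma hausdorff_pointwise:
  assumes T: "compact T" "T \<noteq> {}"
  shows "x \<in> T \<Longrightarrow> infdist x S \<le> hausdorff_dist T S" "y \<in> S \<Longrightarrow> infdist y T \<le> hausdorff_dist T S"
proof -
  have bdd: "bdd_above ((\<lambda>x. infdist x B) ` A)" if "compact A" for A B :: "'n phase_space set"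
    using that by (intro bounded_imp_bdd_above compact_imp_bounded compact_continuous_image continuous_on_infdist continuous_on_id)
  show "infdist x S \<le> hausdorff_dist T S" if "x \<in> T"
    unfolding hausdorff_dist_def using cSUP_upper[OF that bdd[OF T(1)], of S] by linarith
  show "infdist y T \<le> hausdorff_dist T S" if "y \<in> S"
    unfolding hausdorff_dist_def using cSUP_upper[OF that bdd[OF compact_S], of T] by linarith
qed

lemma hausdorff_le_of_between:
  assumes e: "0 < e" "e < 1" and T: "\<And>x. x \<in> S \<Longrightarrow> (1 - e) *\<^sub>R x \<in> T"
    "\<And>x. x \<in> T \<Longrightarrow> (1 / (1 + e)) *\<^sub>R x \<in> S"
    and B: "\<And>x. x \<in> S \<Longrightarrow> norm x \<le> B"
  shows "hausdorff_dist T S \<le> e * B"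
proof -
  have ne: "T \<noteq> {}" "S \<noteq> {}" using T(1)[OF zero_S] zero_S by auto
  have "(SUP x\<in>T. infdist x S) \<le> e * B"
  proof (rule cSUP_least[OF ne(1)])
    fix x assume "x \<in> T"
    define y where "y = (1 / (1 + e)) *\<^sub>R x"
    have y: "y \<in> S" unfolding y_def by (rule T(2)[OF \<open>x \<in> T\<close>])
    have "x = (1 + e) *\<^sub>R y" using e by (simp add: y_def)
    then have "dist x y = e * norm y" using e by (simp add: dist_norm scaleR_left_distrib)
    also have "\<dots> \<le> e * B" using e B[OF y] by simp
    finally show "infdist x S \<le> e * B" by (rule infdist_le2[OF y])
  qed
  moreover have "(SUP y\<in>S. infdist y T) \<le> e * B"
  proof (rule cSUP_least[OF ne(2)])
    fix y assume y: "y \<in> S"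
    have "dist y ((1 - e) *\<^sub>R y) = e * norm y" using e by (simp add: dist_norm scaleR_left_diff_distrib)
    also have "\<dots> \<le> e * B" using e B[OF y] by simp
    finally show "infdist y T \<le> e * B" by (rule infdist_le2[OF T(1)[OF y]])
  qed
  ultimately show ?thesis by (simp add: hausdorff_dist_def)
qed

text \<open>The ball of radius \<open>r\<close> in \<open>S\<close> turns additive errors into multiplicative ones. For the second part,
  a hyperplane separating \<open>(1 - d / r) y\<close> from \<open>T\<close> is moved by \<open>d\<close> against \<open>T\<close>; the moved point still
  belongs to \<open>S\<close>, but it is farther than \<open>d\<close> from \<open>T\<close>.\<close>

lemma between_of_hausdorff_less:
  assumes T: "compact T" "convex T" "T \<noteq> {}" and r: "cball 0 r \<subseteq> S" "r > 0"
    and d: "hausdorff_dist T S < d" "d < r"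
  shows "x \<in> T \<Longrightarrow> (1 / (1 + d / r)) *\<^sub>R x \<in> S" "y \<in> S \<Longrightarrow> (1 - d / r) *\<^sub>R y \<in> T"
proof -
  have near: "\<exists>b\<in>B. dist a b < d" if inf: "infdist a B \<le> hausdorff_dist T S" and B: "compact B" "B \<noteq> {}" for a and B :: "'n phase_space set"
  proof -
    obtain b where "b \<in> B" "infdist a B = dist a b"
      using infdist_attains_inf[OF compact_imp_closed[OF B(1)] B(2)] by blast
    then show ?thesis using inf d(1) by (intro bexI[of _ b]) linarith
  qed
  have d0: "d > 0"
  proof -
    obtain t where "t \<in> T" using T(3) by blast
    from hausdorff_pointwise(1)[OF T(1,3) this] show ?thesis using infdist_nonneg[of t S] d(1) by linarith
  qed
  show "(1 / (1 + d / r)) *\<^sub>R x \<in> S" if x: "x \<in> T"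
  proof -
    obtain y where y: "y \<in> S" "dist x y < d"
      using near[OF hausdorff_pointwise(1)[OF T(1,3) x] compact_S] zero_S by blast
    define v where "v = (r / d) *\<^sub>R (x - y)"
    have "norm v = (r / d) * dist x y" using r d0 by (simp add: v_def dist_norm)
    also have "\<dots> \<le> (r / d) * d" using y r d0 by (intro mult_left_mono) auto
    finally have v: "v \<in> S" using d0 by (intro subsetD[OF r(1)]) simp
    define a where "a = 1 / (1 + d / r)"
    have a: "0 \<le> a" "0 \<le> a * (d / r)" "a + a * (d / r) = 1"
    proof -
      have p: "1 + d / r > 0" using d0 r by (simp add: add_pos_pos)
      show "0 \<le> a" using p by (simp add: a_def)
      then show "0 \<le> a * (d / r)" using d0 r by simp
      have "a * (1 + d / r) = 1" using p by (simp add: a_def)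
      then show "a + a * (d / r) = 1" by (simp only: distrib_left mult_1_right)
    qed
    have "a *\<^sub>R y + (a * (d / r)) *\<^sub>R v \<in> S" by (rule convexD[OF convex_S y(1) v a])
    moreover have "a *\<^sub>R y + (a * (d / r)) *\<^sub>R v = a *\<^sub>R x" using d0 r by (simp add: v_def algebra_simps)
    ultimately show ?thesis by (simp add: a_def)
  qed
  show "(1 - d / r) *\<^sub>R y \<in> T" if y: "y \<in> S"
  proof (rule ccontr)
    define z where "z = (1 - d / r) *\<^sub>R y"
    assume "(1 - d / r) *\<^sub>R y \<notin> T"
    then obtain a b where ab: "a \<bullet> z < b" "\<And>t. t \<in> T \<Longrightarrow> b < a \<bullet> t"
      using separating_hyperplane_closed_point[OF T(2) compact_imp_closed[OF T(1)]] unfolding z_def by blast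
    obtain t0 where "t0 \<in> T" using T(3) by blast
    then have a0: "a \<noteq> 0" using ab(1) ab(2)[OF \<open>t0 \<in> T\<close>] by auto
    define v where "v = (- r / norm a) *\<^sub>R a"
    have "norm v = r" using a0 r by (simp add: v_def)
    then have v: "v \<in> S" using r(1) by auto
    have "(1 - d / r) *\<^sub>R y + (d / r) *\<^sub>R v \<in> S"
      using d d0 r by (intro convexD[OF convex_S y v]) auto
    then have w: "z + (d / r) *\<^sub>R v \<in> S" by (simp add: z_def)
    obtain t where t: "t \<in> T" "dist (z + (d / r) *\<^sub>R v) t < d"
      using near[OF hausdorff_pointwise(2)[OF T(1,3) w] T(1,3)] by blast
    have "a \<bullet> (t - (z + (d / r) *\<^sub>R v)) \<le> norm a * norm (t - (z + (d / r) *\<^sub>R v))" by (rule norm_cauchy_schwarz)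
    also have "\<dots> \<le> norm a * d" using t(2) by (intro mult_left_mono) (auto simp: dist_norm norm_minus_commute)
    finally have "a \<bullet> t \<le> a \<bullet> z + (d / r) * (a \<bullet> v) + norm a * d" by (simp add: inner_diff_right inner_add_right)
    also have "(d / r) * (a \<bullet> v) = - (norm a * d)"
      using r a0 by (simp add: v_def power2_norm_eq_inner[symmetric] power2_eq_square)
    finally show False using ab(1) ab(2)[OF t(1)] by simp
  qed
qed

end

section \<open>The product of a symmetric body with its polar\<close>

text \<open>A smooth body that contains a dilate of the product has the origin in its interior, so the
  variational description of its capacity applies.\<close>

lemma capacity_between_products:
  fixes K :: "(real ^ 'n::finite) set"
  assumes K: "convex_body K" "centrally_symmetric K" and T: "smooth_convex_body T" and a: "a > 0" and b: "b > 0"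
    and inner: "\<And>x. x \<in> K \<times> polar_body K \<Longrightarrow> a *\<^sub>R x \<in> T"
    and outer: "\<And>x. x \<in> T \<Longrightarrow> (1 / b) *\<^sub>R x \<in> K \<times> polar_body K"
  shows "4 * a\<^sup>2 \<le> smooth_hz_capacity T" "smooth_hz_capacity T \<le> 4 * b\<^sup>2"
proof -
  obtain r where r: "r > 0" "cball 0 r \<subseteq> K \<times> polar_body K"
    using product_with_polar(3)[OF K] by (auto simp: mem_interior_cball)
  have "cball 0 (a * r) \<subseteq> T"
  proof
    fix x :: "'n phase_space" assume x: "x \<in> cball 0 (a * r)"
    have "norm ((1 / a) *\<^sub>R x) \<le> r" using x a by (simp add: field_simps)
    then have "a *\<^sub>R ((1 / a) *\<^sub>R x) \<in> T" using r by (intro inner subsetD[OF r(2)]) simp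
    then show "x \<in> T" using a by simp
  qed
  then have "0 \<in> interior T" using a r by (auto simp: mem_interior_cball intro!: exI[of _ "a * r"])
  then interpret smooth_body T
    using T unfolding smooth_convex_body_def convex_body_def by unfold_locales auto
  show "4 * a\<^sup>2 \<le> smooth_hz_capacity T" "smooth_hz_capacity T \<le> 4 * b\<^sup>2"
    by (rule capacity_between[OF K a b inner outer]; assumption)+
qed

theorem theorem1p7:
  fixes K :: "(real ^ 'n::finite) set"
  assumes "convex_body K" and "centrally_symmetric K"
  shows "hz_capacity (K \<times> polar_body K) = 4"
proof -
  let ?P = "K \<times> polar_body K"
  interpret P: origin_body ?P
    using product_with_polar[OF assms] by unfold_locales
  obtain r where r: "cball 0 r \<subseteq> ?P" "r > 0"
    using product_with_polar(3)[OF assms] by (auto simp: mem_interior_cball)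
  obtain B where B: "B > 0" "\<And>x. x \<in> ?P \<Longrightarrow> norm x \<le> B"
    using compact_imp_bounded[OF P.compact_S] unfolding bounded_pos by blast
  show ?thesis
  proof (cases "smooth_convex_body ?P")
    case True
    \<comment> \<open>If the product itself has smooth boundary, then its capacity is defined by its own closed
      characteristics.\<close>
    have "smooth_hz_capacity ?P = 4"
      using capacity_between_products[OF assms True, of 1 1] by (intro antisym) auto
    then show ?thesis using True by (simp add: hz_capacity_def)
  next
    case False
    let ?lim = "\<lambda>c. \<forall>S :: nat \<Rightarrow> 'n phase_space set. (\<forall>k. smooth_convex_body (S k)) \<longrightarrow>
       (\<lambda>k. hausdorff_dist (S k) ?P) \<longlonglongrightarrow> 0 \<longrightarrow> (\<lambda>k. smooth_hz_capacity (S k)) \<longlonglongrightarrow> c"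
    have nonneg: "0 \<le> hausdorff_dist T ?P" if T: "smooth_convex_body T" for T
    proof -
      have "compact T" "T \<noteq> {}" using T by (auto simp: smooth_convex_body_def convex_body_def)
      from P.hausdorff_pointwise(2)[OF this P.zero_S] show ?thesis using infdist_nonneg[of 0 T] by linarith
    qed
    have lim4: "?lim 4"
    proof (intro allI impI)
      fix S :: "nat \<Rightarrow> 'n phase_space set"
      assume S: "\<forall>k. smooth_convex_body (S k)" and conv: "(\<lambda>k. hausdorff_dist (S k) ?P) \<longlonglongrightarrow> 0"
      \<comment> \<open>The positive summand turns the Hausdorff distance into a strict bound.\<close>
      define d where "d k = hausdorff_dist (S k) ?P + inverse (real (Suc k))" for k
      have "d \<longlonglongrightarrow> 0 + 0" unfolding d_def[abs_def] by (intro tendsto_add conv LIMSEQ_inverse_real_of_nat)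
      then have d: "d \<longlonglongrightarrow> 0" by simp
      have ev: "\<forall>\<^sub>F k in sequentially. d k < r" using order_tendstoD(2)[OF d r(2)] .
      have both: "4 * (1 - d k / r)\<^sup>2 \<le> smooth_hz_capacity (S k) \<and> smooth_hz_capacity (S k) \<le> 4 * (1 + d k / r)\<^sup>2"
        if dk: "d k < r" for k
      proof -
        have Sk: "smooth_convex_body (S k)" "compact (S k)" "convex (S k)" "S k \<noteq> {}"
          using spec[OF S, of k] interior_empty unfolding smooth_convex_body_def convex_body_def by metis+
        have less: "hausdorff_dist (S k) ?P < d k" by (simp add: d_def)
        have d0: "d k > 0" using nonneg[OF Sk(1)] less by linarith
        note btw = P.between_of_hausdorff_less[OF Sk(2-4) r less dk]
        have "0 < 1 - d k / r" "0 < 1 + d k / r" using dk d0 r by (auto simp: add_pos_pos)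
        from capacity_between_products[OF assms Sk(1) this btw(2,1)] show ?thesis by blast
      qed
      show "(\<lambda>k. smooth_hz_capacity (S k)) \<longlonglongrightarrow> 4"
      proof (rule tendsto_sandwich)
        show "\<forall>\<^sub>F k in sequentially. 4 * (1 - d k / r)\<^sup>2 \<le> smooth_hz_capacity (S k)"
          using ev by eventually_elim (use both in blast)
        show "\<forall>\<^sub>F k in sequentially. smooth_hz_capacity (S k) \<le> 4 * (1 + d k / r)\<^sup>2"
          using ev by eventually_elim (use both in blast)
        have "(\<lambda>k. 4 * (1 - d k / r)\<^sup>2) \<longlonglongrightarrow> 4 * (1 - 0 / r)\<^sup>2" using r by (intro tendsto_intros d) auto
        then show "(\<lambda>k. 4 * (1 - d k / r)\<^sup>2) \<longlonglongrightarrow> 4" by simp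
        have "(\<lambda>k. 4 * (1 + d k / r)\<^sup>2) \<longlonglongrightarrow> 4 * (1 + 0 / r)\<^sup>2" using r by (intro tendsto_intros d) auto
        then show "(\<lambda>k. 4 * (1 + d k / r)\<^sup>2) \<longlonglongrightarrow> 4" by simp
      qed
    qed
    \<comment> \<open>The limit is unique because an approximating sequence of smooth bodies exists.\<close>
    have uniq: "c = 4" if c: "?lim c" for c
    proof -
      define e where "e k = inverse (real (Suc (Suc k)))" for k
      have e: "0 < e k" "e k < 1" for k by (auto simp: e_def inverse_eq_divide)
      have "\<exists>T. smooth_convex_body T \<and> (\<forall>x\<in>?P. (1 - e k) *\<^sub>R x \<in> T) \<and> (\<forall>x\<in>T. (1 / (1 + e k)) *\<^sub>R x \<in> ?P)" for k
        by (rule P.smooth_approximation[OF e]) blast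
      then obtain T where T: "\<And>k. smooth_convex_body (T k)" "\<And>k x. x \<in> ?P \<Longrightarrow> (1 - e k) *\<^sub>R x \<in> T k"
        "\<And>k x. x \<in> T k \<Longrightarrow> (1 / (1 + e k)) *\<^sub>R x \<in> ?P" by metis
      have hd: "(\<lambda>k. hausdorff_dist (T k) ?P) \<longlonglongrightarrow> 0"
      proof (rule tendsto_sandwich[OF _ _ tendsto_const])
        have "e \<longlonglongrightarrow> 0"
          unfolding e_def[abs_def] using LIMSEQ_Suc[OF LIMSEQ_inverse_real_of_nat] .
        then show "(\<lambda>k. e k * B) \<longlonglongrightarrow> 0" by (rule tendsto_mult_left_zero)
        have "hausdorff_dist (T k) ?P \<le> e k * B" for k
          by (rule P.hausdorff_le_of_between[OF e T(2,3) B(2)])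
        then show "\<forall>\<^sub>F k in sequentially. hausdorff_dist (T k) ?P \<le> e k * B" by simp
        show "\<forall>\<^sub>F k in sequentially. 0 \<le> hausdorff_dist (T k) ?P" by (simp add: nonneg[OF T(1)])
      qed
      show ?thesis
        by (rule LIMSEQ_unique[OF c[rule_format, of T, OF T(1) hd] lim4[rule_format, of T, OF T(1) hd]])
    qed
    have "(THE c. ?lim c) = 4" by (rule the_equality[of ?lim, OF lim4 uniq])
    then show ?thesis using False by (simp add: hz_capacity_def)
  qed
qed

end
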